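(* Let $\aleph$ be a positive integer with $\frac{\aleph-1}{2}\in\mathbb N$ and $\iota\aleph\in\mathbb N$. Then, for all sufficiently large such $\aleph$, $$|\widetilde{\mathcal T}_{\aleph}|\ \ge\ \alpha^{-\aleph}\exp\Big\{-10\,e^{-\frac{1}{10}\log^2(\iota^{-1})}\,\aleph\Big\}.$$ Consequently, letting $\mathcal T_\aleph$ denote the set of unlabeled (unrooted) trees $\mathbf T$ on $\aleph$ vertices for which there is a vertex $\mathbf u$ with $(\mathbf T,\mathbf u)\in\widetilde{\mathcal T}_\aleph$, we have, as $\aleph\to\infty$, $$|\mathcal T_{\aleph}|\ \ge\ (\alpha+o(1))^{-\aleph}\exp\Big\{-10\,e^{-\frac{1}{10}\log^2(\iota^{-1})}\,\aleph\Big\}.$$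
   Context: All logarithms are natural and $\log^k(x)$ means $(\log x)^k$. $\alpha\approx0.338$ is Otter's constant; $\mathcal V_N$ (resp. $\mathcal R_N$) is the set of unlabeled trees (resp. unlabeled rooted trees) on $N$ vertices, and $|\mathcal V_N|\sim C_0\alpha^{-N}N^{-5/2}$, $|\mathcal R_N|\sim C_0C_1\alpha^{-N}N^{-3/2}$ for constants $C_0,C_1\in(0,1)$. Fix $\epsilon\in(0,1)$, fix an integer $M\ge100$ such that for all $k\ge M$: $\alpha^{-k}/(100k^{2.5})\le|\mathcal V_k|\le\alpha^{-k}/k^{2.5}$ and $\alpha^{-k}/(200k^{1.5})\le|\mathcal R_k|\le\alpha^{-k}/k^{1.5}$; fix $\iota\in(0,1)$ with $\log\log\log\log(\iota^{-1})>\max\{M,\frac1\epsilon,\frac{1}{\log(\epsilon^{-1})}\}$. Tree notions. For a rooted tree $\mathbf T$ and $v\in V(\mathbf T)$, $\mathsf{Des}_{\mathbf T}(v)$ is the rooted tree with root $v$ consisting of $v$ and all its descendants; $\mathbf S$ is a descendant tree of $\mathbf T$ if $\mathbf S=\mathsf{Des}_{\mathbf T}(v)$ for some $v$. A leaf is a vertex of degree $1$; $\mathcal L(\mathbf T)$ is the set of leaves. A self-avoiding path $P=(u_1,\dots,u_m)$ (distinct vertices) is an arm-path of $\mathbf T$ starting from $u_1$, of length $m-1$, if $P=\mathsf{Des}_{\mathbf T}(u_1)$. For a vertex $\mathbf u$ and integer $x\ge0$, $\mathbf T\oplus\mathcal L^{(x)}_{\mathbf u}$ is the rooted tree obtained by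 attaching to $\mathbf u$ a new path with $x$ edges (root unchanged). For rooted trees $\mathbf T,\mathbf T'$ write $\mathbf T\sim\mathbf T'$ if there exist $k\le|V(\mathbf T)|/\log(\iota^{-1})$, $k'\le|V(\mathbf T')|/\log(\iota^{-1})$, non-leaf vertices $\mathbf u_1,\dots,\mathbf u_k$ of $\mathbf T$ and $\mathbf u'_1,\dots,\mathbf u'_{k'}$ of $\mathbf T'$, and integers $0\le x_i,x'_j\le\log^2(\iota^{-1})$ such that $\mathbf T\oplus\mathcal L^{(x_1)}_{\mathbf u_1}\oplus\cdots\oplus\mathcal L^{(x_k)}_{\mathbf u_k}\cong\mathbf T'\oplus\mathcal L^{(x'_1)}_{\mathbf u'_1}\oplus\cdots\oplus\mathcal L^{(x'_{k'})}_{\mathbf u'_{k'}}$. For a rooted tree $\mathbf T$, $\mathbf T_\iota$ is the subtree induced on $\{v\in V(\mathbf T):|V(\mathsf{Des}_{\mathbf T}(v))|\ge\log^2(\iota^{-1})\}$. $\widetilde{\mathcal T}_\aleph$ is the set of $\mathbf T\in\mathcal R_\aleph$ such that: (1) every vertex has degree at most $\log^2(\iota^{-1})$; (2) $\mathbf T$ contains no arm-path of length at least $\log^2(\iota^{-1})$; (3) $|V(\mathbf T_\iota)|\ge\aleph/\log^4(\iota^{-1})$; (4) for any two distinct descendant trees $\mathbf S\ne\mathbf S'$ of $\mathbf T$ with $|V(\mathbf S)|,|V(\mathbf S')|\ge\log^2(\iota^{-1})$ whose roots have the same parent in $\mathbf T$, $\mathbf S\not\sim\mathbf S'$; (5) the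 root has exactly two children, whose descendant trees $\mathbf T_1,\mathbf T_2$ have $\lfloor\frac{\aleph-1}2\rfloor$ and $\lceil\frac{\aleph-1}2\rceil$ vertices respectively, and $\mathbf T_1\not\sim\mathbf S$ for every descendant tree $\mathbf S$ of $\mathbf T_2$, and $\mathbf T_2\not\sim\mathbf S'$ for every descendant tree $\mathbf S'$ of $\mathbf T_1$. *)

theory Defs
  imports "HOL-Analysis.Analysis" "Graph_Theory.Graph_Theory"
begin

text \<open>
  A finite simple undirected graph is a \<^verbatim>\<open>pair_graph\<close>: a finite vertex set with a symmetric,
  irreflexive arc relation, so that each edge is stored as two opposite arcs.  The library's
  \<^verbatim>\<open>forest\<close> and \<^verbatim>\<open>tree\<close> are of no use for such graphs: going along an edge and back is already
  a directed cycle.  The undirected cycles are exactly the directed cycles of length at least 3.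
\<close>

definition simple_tree :: "'a pair_pre_digraph \<Rightarrow> bool" where
  "simple_tree G \<longleftrightarrow> pair_graph G \<and> Digraph_Component.connected (with_proj G) \<and>
     \<not> (\<exists>p. pre_digraph.cycle (with_proj G) p \<and> length p \<ge> 3)"

text \<open>A rooted tree is a pair of a tree and a vertex of it.\<close>

type_synonym 'a rooted = "'a pair_pre_digraph \<times> 'a"

abbreviation graph_of :: "'a rooted \<Rightarrow> 'a pair_pre_digraph" where "graph_of \<equiv> fst"
abbreviation root_of :: "'a rooted \<Rightarrow> 'a" where "root_of \<equiv> snd"
abbreviation vertices :: "'a rooted \<Rightarrow> 'a set" where "vertices T \<equiv> pverts (graph_of T)"

definition rooted_tree :: "'a rooted \<Rightarrow> bool" where
  "rooted_tree T \<longleftrightarrow> simple_tree (graph_of T) \<and> root_of T \<in> vertices T"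

definition rooted_iso :: "'a rooted \<Rightarrow> 'b rooted \<Rightarrow> bool" where
  "rooted_iso T T' \<longleftrightarrow> (\<exists>f. pre_digraph.digraph_isomorphism (with_proj (graph_of T)) f \<and>
     with_proj (graph_of T') = app_iso f (with_proj (graph_of T)) \<and>
     iso_verts f (root_of T) = root_of T')"

text \<open>Unlabeled trees on \<open>N\<close> vertices are the isomorphism classes of trees on \<open>{..<N}\<close>.\<close>

definition trees_on :: "nat \<Rightarrow> nat pair_pre_digraph set" where
  "trees_on N = {G. simple_tree G \<and> pverts G = {..<N}}"

definition rooted_trees_on :: "nat \<Rightarrow> nat rooted set" where
  "rooted_trees_on N = {T. rooted_tree T \<and> vertices T = {..<N}}"

definition tree_iso_rel :: "nat \<Rightarrow> nat pair_pre_digraph rel" where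
  "tree_iso_rel N = {(G, H) \<in> trees_on N \<times> trees_on N. digraph_iso (with_proj G) (with_proj H)}"

definition rooted_iso_rel :: "nat \<Rightarrow> nat rooted rel" where
  "rooted_iso_rel N = {(T, T') \<in> rooted_trees_on N \<times> rooted_trees_on N. rooted_iso T T'}"

definition unlabeled_trees :: "nat \<Rightarrow> nat pair_pre_digraph set set" where
  "unlabeled_trees N = trees_on N // tree_iso_rel N"

definition unlabeled_rooted_trees :: "nat \<Rightarrow> nat rooted set set" where
  "unlabeled_rooted_trees N = rooted_trees_on N // rooted_iso_rel N"

text \<open>
  Otter's constant is the radius of convergence of the generating function of unlabeled rooted
  trees.
\<close>

definition otter_const :: real where
  "otter_const = real_of_ereal (conv_radius (\<lambda>n. real (card (unlabeled_rooted_trees n))))"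

definition induced :: "'a pair_pre_digraph \<Rightarrow> 'a set \<Rightarrow> 'a pair_pre_digraph" where
  "induced G D = \<lparr>pverts = D, parcs = parcs G \<inter> D \<times> D\<rparr>"

text \<open>\<open>w\<close> is a descendant of \<open>v\<close> if the path from the root to \<open>w\<close> visits \<open>v\<close>; so \<open>v\<close> itself is included.\<close>

definition descendants :: "'a rooted \<Rightarrow> 'a \<Rightarrow> 'a set" where
  "descendants T v = {w. \<exists>p. vpath p (with_proj (graph_of T)) \<and> hd p = root_of T \<and> last p = w
     \<and> v \<in> set p}"

definition is_parent :: "'a rooted \<Rightarrow> 'a \<Rightarrow> 'a \<Rightarrow> bool" where
  "is_parent T u v \<longleftrightarrow> (u, v) \<in> parcs (graph_of T) \<and> v \<in> descendants T u"

definition Des :: "'a rooted \<Rightarrow> 'a \<Rightarrow> 'a rooted" where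
  "Des T v = (induced (graph_of T) (descendants T v), v)"

definition descendant_tree :: "'a rooted \<Rightarrow> 'a rooted \<Rightarrow> bool" where
  "descendant_tree S T \<longleftrightarrow> (\<exists>v \<in> vertices T. S = Des T v)"

definition deg :: "'a rooted \<Rightarrow> 'a \<Rightarrow> nat" where
  "deg T v = out_degree (with_proj (graph_of T)) v"

text \<open>A leaf is a vertex of degree 1; this includes the root if it has exactly one child.\<close>

definition leaves :: "'a rooted \<Rightarrow> 'a set" where
  "leaves T = {v \<in> vertices T. deg T v = 1}"

definition path_graph :: "'a list \<Rightarrow> 'a pair_pre_digraph" where
  "path_graph us = \<lparr>pverts = set us, parcs = set (vwalk_arcs us) \<union> (set (vwalk_arcs us))\<inverse>\<rparr>"

definition arm_path :: "'a rooted \<Rightarrow> 'a list \<Rightarrow> bool" where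
  "arm_path T us \<longleftrightarrow> us \<noteq> [] \<and> distinct us \<and> set us \<subseteq> vertices T \<and> Des T (hd us) = (path_graph us, hd us)"

text \<open>
  \<open>attach_path T u x\<close> adds the path \<open>u, m, m + 1, \<dots>, m + x - 1\<close> with \<open>x\<close> edges, where \<open>m\<close> exceeds
  every vertex of \<open>T\<close>.
\<close>

definition attach_path :: "nat rooted \<Rightarrow> nat \<Rightarrow> nat \<Rightarrow> nat rooted" where
  "attach_path T u x =
     (let m = Suc (Max (vertices T)); P = path_graph (u # [m..<m + x])
      in (\<lparr>pverts = vertices T \<union> pverts P, parcs = parcs (graph_of T) \<union> parcs P\<rparr>, root_of T))"

definition attach_paths :: "nat rooted \<Rightarrow> (nat \<times> nat) list \<Rightarrow> nat rooted" where
  "attach_paths T ps = foldl (\<lambda>S (u, x). attach_path S u x) T ps"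

definition admissible :: "real \<Rightarrow> nat rooted \<Rightarrow> (nat \<times> nat) list \<Rightarrow> bool" where
  "admissible \<iota> T ps \<longleftrightarrow> real (length ps) \<le> real (card (vertices T)) / ln (inverse \<iota>) \<and>
     (\<forall>(u, x) \<in> set ps. u \<in> vertices T - leaves T \<and> real x \<le> (ln (inverse \<iota>))^2)"

definition similar :: "real \<Rightarrow> nat rooted \<Rightarrow> nat rooted \<Rightarrow> bool" where
  "similar \<iota> T T' \<longleftrightarrow> (\<exists>ps ps'. admissible \<iota> T ps \<and> admissible \<iota> T' ps' \<and>
     rooted_iso (attach_paths T ps) (attach_paths T' ps'))"

definition core :: "real \<Rightarrow> 'a rooted \<Rightarrow> 'a pair_pre_digraph" where
  "core \<iota> T = induced (graph_of T) {v \<in> vertices T. real (card (vertices (Des T v))) \<ge> (ln (inverse \<iota>))^2}"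

text \<open>
  The five defining conditions, for a labeled representative.  Descendant trees are subtrees of \<open>T\<close>
  carrying their vertices, so in the fourth condition two of them are distinct as soon as they hang
  at different vertices, even if they are isomorphic.
\<close>

definition admissible_tree :: "real \<Rightarrow> nat \<Rightarrow> nat rooted \<Rightarrow> bool" where
  "admissible_tree \<iota> N T \<longleftrightarrow>
     (\<forall>v \<in> vertices T. real (deg T v) \<le> (ln (inverse \<iota>))^2) \<and>
     \<not> (\<exists>us. arm_path T us \<and> real (length us - 1) \<ge> (ln (inverse \<iota>))^2) \<and>
     real (card (pverts (core \<iota> T))) \<ge> real N / (ln (inverse \<iota>))^4 \<and>
     (\<forall>S S'. descendant_tree S T \<and> descendant_tree S' T \<and> S \<noteq> S' \<and>
        real (card (vertices S)) \<ge> (ln (inverse \<iota>))^2 \<and> real (card (vertices S')) \<ge> (ln (inverse \<iota>))^2 \<and>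
        (\<exists>w. is_parent T w (root_of S) \<and> is_parent T w (root_of S')) \<longrightarrow> \<not> similar \<iota> S S') \<and>
     (\<exists>a b. a \<noteq> b \<and> {c. is_parent T (root_of T) c} = {a, b} \<and>
        int (card (vertices (Des T a))) = \<lfloor>(real N - 1) / 2\<rfloor> \<and>
        int (card (vertices (Des T b))) = \<lceil>(real N - 1) / 2\<rceil> \<and>
        (\<forall>S. descendant_tree S (Des T b) \<longrightarrow> \<not> similar \<iota> (Des T a) S) \<and>
        (\<forall>S'. descendant_tree S' (Des T a) \<longrightarrow> \<not> similar \<iota> (Des T b) S'))"

definition rooted_family :: "real \<Rightarrow> nat \<Rightarrow> nat rooted set set" where
  "rooted_family \<iota> N = {C \<in> unlabeled_rooted_trees N. \<exists>T \<in> C. admissible_tree \<iota> N T}"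

definition unrooted_family :: "real \<Rightarrow> nat \<Rightarrow> nat pair_pre_digraph set set" where
  "unrooted_family \<iota> N = {C \<in> unlabeled_trees N. \<exists>G \<in> C. \<exists>u \<in> pverts G.
     rooted_iso_rel N `` {(G, u)} \<in> rooted_family \<iota> N}"

end

theory Submission
  imports Defs
begin

text \<open>
  Write \<open>L = ln (1 / \<iota>)\<close>.  In a random rooted tree the exceptional local patterns (a vertex with
  \<open>L\<^sup>2\<close> children, an arm of length \<open>L\<^sup>2\<close>, two similar sibling subtrees with at least \<open>L\<^sup>2\<close> vertices)
  have density at most \<open>exp (- 0.57 L\<^sup>2)\<close>: a tree similar to a given one arises from it by
  attaching and pruning few paths, so among the trees with \<open>n\<close> vertices there are only
  \<open>exp (O (n ln L / L))\<close> of them, and \<open>\<alpha> \<le> 1 / 2\<close>.  By a union bound over the position of the pattern,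
  at least half of the trees with about \<open>exp (0.102 L\<^sup>2)\<close> vertices contain no such pattern.  These are
  glued recursively: two good trees of nearly equal size that are not similar are put below a new
  root.  One gluing loses a factor 4, and it happens once per \<open>exp (0.102 L\<^sup>2)\<close> vertices, which costs
  less than \<open>exp (- 10 exp (- L\<^sup>2 / 10) N)\<close> in total.  The lower bound on the core follows from the
  degree bound, and an unrooted tree has at most \<open>N\<close> rootings.
\<close>

text \<open>The constants are squeezed from both sides. Put K = L^2 and let trees of size about
  exp(s K) be the starting material. Locating a pattern costs up to n^4 (its position, its size, two
  sibling sizes), and the trees of size n have total weight only about n^(-3/2), so the union bound
  needs 5.5 s < 0.57. Conversely, the deficit n^(3/2) of a starting tree has to be spread over its
  exp(s K) vertices at a rate of 5 exp(-K/10) per vertex, which forces s > 1/10. The window is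
  narrow, and s = 0.102 lies in it. The value 0.57 is below log(9/5), the rate for crowded vertices
  when \<alpha> \<le> 1/2, and below 2/3 - 1/100, the rate for similar siblings.

  Since |R_n| \<alpha>^n tends to 0, a bound by a constant cannot be carried through the gluing with
  base \<alpha>. The base is therefore raised slightly, to y = \<alpha> exp(5 exp(-K/10)), and the
  invariant is that the number of good trees times y^(n+1) is at least 4. The exponents n + 1 add
  exactly when a common root is put above two trees, and 4 * 4 / 4 = 4, so the invariant reproduces
  itself.\<close>

section \<open>Unlabelled rooted trees as a datatype, and crude bounds on their number\<close>

text \<open>An isomorphism class of rooted trees: the multiset forgets the order of the subtrees
  below a vertex but keeps repetitions. Counting classes thus becomes counting values of a
  datatype.\<close>

datatype utree = Node "utree multiset"

primrec children :: "utree \<Rightarrow> utree multiset" where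
  "children (Node A) = A"

primrec tsize :: "utree \<Rightarrow> nat" where
  "tsize (Node A) = Suc (sum_mset (image_mset tsize A))"

lemma tsize_Node_empty [simp]: "tsize (Node {#}) = 1"
  by simp

lemma tsize_add [simp]: "tsize (Node (add_mset b A)) = tsize (Node A) + tsize b"
  by simp

declare tsize.simps [simp del]

lemma tsize_pos [simp]: "0 < tsize t"
  by (cases t) (simp add: tsize.simps)

lemma tsize_neq_0 [simp]: "tsize t \<noteq> 0"
  using tsize_pos[of t] by simp

lemma tsize_child_less: "a \<in># A \<Longrightarrow> tsize a < tsize (Node A)"
  by (auto dest!: multi_member_split)

text \<open>Linking \<open>b\<close> below the root of \<open>Node A\<close> is the basic operation:
  sizes then add with no correction, and it has a direct counterpart on graphs. The decomposition is
  not unique, since any child can play the part of \<open>b\<close>.\<close>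

lemma utree_link_induct [case_names leaf link]:
  assumes leaf: "P (Node {#})"
    and link: "\<And>A b. P (Node A) \<Longrightarrow> P b \<Longrightarrow> P (Node (add_mset b A))"
  shows "P t"
proof (induction t)
  case (Node A)
  then show ?case
    by (induction A) (auto intro: leaf link)
qed

lemma utree_cases_link [case_names leaf link]:
  obtains "t = Node {#}" | b A where "t = Node (add_mset b A)"
  by (metis multiset_cases utree.exhaust)

definition utrees :: "nat \<Rightarrow> utree set" where
  "utrees n = {t. tsize t = n}"

lemma mem_utrees [simp]: "t \<in> utrees n \<longleftrightarrow> tsize t = n"
  by (simp add: utrees_def)

lemma utrees_0 [simp]: "utrees 0 = {}"
  by (auto simp: utrees_def)

lemma finite_tsize_le: "finite {t. tsize t \<le> n}"
proof (induction n)
  case 0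
  then show ?case by simp
next
  case (Suc n)
  let ?S = "{t. tsize t \<le> n}"
  have "{t. tsize t \<le> Suc n} \<subseteq> insert (Node {#}) ((\<lambda>(s, b). Node (add_mset b (children s))) ` (?S \<times> ?S))"
  proof
    fix t assume t: "t \<in> {t. tsize t \<le> Suc n}"
    show "t \<in> insert (Node {#}) ((\<lambda>(s, b). Node (add_mset b (children s))) ` (?S \<times> ?S))"
    proof (cases t rule: utree_cases_link)
      case (link b A)
      have "tsize (Node A) \<le> n" "tsize b \<le> n"
        using t link tsize_pos[of b] tsize_pos[of "Node A"] by (auto simp del: tsize_pos)
      then show ?thesis
        unfolding link by (intro insertI2 image_eqI[where x="(Node A, b)"]) auto
    qed auto
  qed
  then show ?case
    by (rule finite_subset) (use Suc in auto)
qed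

lemma finite_utrees [simp]: "finite (utrees n)"
  by (rule finite_subset[OF _ finite_tsize_le[of n]]) (auto simp: utrees_def)

lemma utrees_1: "utrees 1 = {Node {#}}"
proof -
  have "t = Node {#}" if "tsize t = 1" for t
  proof (cases t rule: utree_cases_link)
    case (link b A)
    then show ?thesis using that tsize_pos[of b] tsize_pos[of "Node A"] by (simp del: tsize_pos)
  qed
  then show ?thesis by (auto simp: utrees_def)
qed

text \<open>A tree can be extended by a new root above it or by a new leaf below its root. The two
  images share only the tree with one edge, which \<open>n \<ge> 2\<close> excludes. This doubling
  is what later forces Otter's constant to be at most 1/2.\<close>

lemma card_utrees_Suc_ge:
  assumes "n \<ge> 2"
  shows "2 * card (utrees n) \<le> card (utrees (Suc n))"
proof -
  let ?f = "\<lambda>t. Node {#t#}" and ?g = "\<lambda>t. Node (add_mset (Node {#}) (children t))"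
  have sz: "tsize (?g t) = Suc (tsize t)" for t by (cases t) simp
  have sub: "?f ` utrees n \<union> ?g ` utrees n \<subseteq> utrees (Suc n)"
    using sz by (auto simp: tsize.simps)
  have inj: "inj_on ?f (utrees n)" "inj_on ?g (utrees n)"
    by (auto simp: inj_on_def) (metis children.simps utree.exhaust)+
  have disj: "?f ` utrees n \<inter> ?g ` utrees n = {}"
  proof (rule equals0I)
    fix x assume "x \<in> ?f ` utrees n \<inter> ?g ` utrees n"
    then obtain s t where "x = ?f s" "tsize s = n" "x = ?g t" by auto
    then have "s = Node {#}" "tsize s = n" by auto
    then show False using assms by simp
  qed
  have "card (?f ` utrees n) + card (?g ` utrees n) \<le> card (utrees (Suc n))"
    using card_mono[OF finite_utrees sub] by (subst (asm) card_Un_disjoint) (use disj in auto)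
  then show ?thesis using card_image[OF inj(1)] card_image[OF inj(2)] by simp
qed

lemma card_utrees_ge_pow: "n \<ge> 2 \<Longrightarrow> 2 ^ (n - 2) \<le> card (utrees n)"
proof (induction n rule: nat_induct_at_least)
  case base
  have "Node {#Node {#}#} \<in> utrees 2" by (simp add: tsize.simps)
  then have "0 < card (utrees 2)"
    by (metis card_gt_0_iff empty_iff finite_utrees)
  then show ?case by simp
next
  case (Suc n)
  have "(2::nat) ^ (Suc n - 2) = 2 * 2 ^ (n - 2)"
    using Suc(1) by (simp add: Suc_diff_le flip: power_Suc)
  then show ?case using card_utrees_Suc_ge[of n] Suc by linarith
qed

lemma card_utrees_mono:
  assumes "m \<le> n" shows "card (utrees m) \<le> card (utrees n)"
  using assms
proof (induction n rule: dec_induct)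
  case (step n)
  have "inj_on (\<lambda>t. Node {#t#}) (utrees n)" by (auto simp: inj_on_def)
  moreover have "(\<lambda>t. Node {#t#}) ` utrees n \<subseteq> utrees (Suc n)" by (auto simp: tsize.simps)
  ultimately have "card (utrees n) \<le> card (utrees (Suc n))" using card_inj_on_le finite_utrees by blast
  then show ?case using step by simp
qed simp

section \<open>Contexts\<close>

text \<open>A context is a tree with a hole, stored as the list of sibling multisets met on the way
  from the root down to the hole.\<close>

type_synonym ctxt = "utree multiset list"

primrec plug :: "ctxt \<Rightarrow> utree \<Rightarrow> utree" where
  "plug [] t = t"
| "plug (A # c) t = Node (add_mset (plug c t) A)"

primrec csize :: "ctxt \<Rightarrow> nat" where
  "csize [] = 0"
| "csize (A # c) = tsize (Node A) + csize c"

lemma tsize_plug: "tsize (plug c t) = csize c + tsize t"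
  by (induction c) auto

text \<open>The tree left after cutting out the hole. Nothing is left of the empty context, so the
  value of \<open>erase []\<close> is a placeholder; the counts below exclude it.\<close>

fun erase :: "ctxt \<Rightarrow> utree" where
  "erase [] = Node {#}"
| "erase [A] = Node A"
| "erase (A # c) = Node (add_mset (erase c) A)"

lemma tsize_erase: "c \<noteq> [] \<Longrightarrow> tsize (erase c) = csize c"
  by (induction c rule: erase.induct) auto

lemma sum_set_mset_le: "sum f (set_mset A) \<le> sum_mset (image_mset f A)" for f :: "'a \<Rightarrow> nat"
proof (induction A)
  case (add x A)
  then show ?case by (cases "x \<in># A") (auto simp: insert_absorb)
qed simp

text \<open>A nonempty context is determined by the remaining tree and the vertex from which the
  hole hangs. Vertices exchanged by an automorphism give the same context, so the number of vertices
  is only an upper bound.\<close>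

lemma erase_fibre:
  "finite {c. c \<noteq> [] \<and> erase c = t} \<and> card {c. c \<noteq> [] \<and> erase c = t} \<le> tsize t"
proof (induction t)
  case (Node A)
  let ?F = "\<lambda>t. {c. c \<noteq> [] \<and> erase c = t}"
  let ?U = "\<Union>a\<in>set_mset A. (\<lambda>c. (A - {#a#}) # c) ` ?F a"
  have sub: "?F (Node A) \<subseteq> insert [A] ?U"
  proof
    fix c assume c: "c \<in> ?F (Node A)"
    then obtain B c' where Bc: "c = B # c'" by (cases c) auto
    show "c \<in> insert [A] ?U"
    proof (cases c')
      case Nil
      then show ?thesis using c Bc by simp
    next
      case (Cons x xs)
      then have A: "A = add_mset (erase c') B" using c Bc by auto
      then show ?thesis using Bc Cons
        by (intro insertI2 UN_I[where a="erase c'"]) auto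
    qed
  qed
  have fin: "finite ?U" using Node by auto
  have "card ?U \<le> (\<Sum>a\<in>set_mset A. card ((\<lambda>c. (A - {#a#}) # c) ` ?F a))"
    by (rule card_UN_le) auto
  also have "\<dots> \<le> (\<Sum>a\<in>set_mset A. tsize a)"
  proof (rule sum_mono)
    fix a assume a: "a \<in># A"
    have "card ((\<lambda>c. (A - {#a#}) # c) ` ?F a) \<le> card (?F a)"
      by (rule card_image_le) (use Node a in auto)
    then show "card ((\<lambda>c. (A - {#a#}) # c) ` ?F a) \<le> tsize a"
      using Node[OF a] by linarith
  qed
  also have "\<dots> \<le> sum_mset (image_mset tsize A)"
    by (rule sum_set_mset_le)
  finally have cU: "card ?U \<le> sum_mset (image_mset tsize A)" .
  have "card (?F (Node A)) \<le> card (insert [A] ?U)"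
    using sub fin by (intro card_mono) auto
  also have "\<dots> \<le> Suc (card ?U)" by (rule card_insert_le_m1) auto
  also have "\<dots> \<le> tsize (Node A)" using cU by (simp add: tsize.simps)
  finally show ?case using sub fin finite_subset by blast
qed

definition ctxts :: "nat \<Rightarrow> ctxt set" where
  "ctxts n = {c. csize c = n}"

lemma ctxts_0: "ctxts 0 = {[]}"
proof -
  have "c = []" if "csize c = 0" for c
    using that by (cases c) auto
  then show ?thesis by (auto simp: ctxts_def)
qed

lemma ctxts_finite_card:
  assumes "n > 0"
  shows "finite (ctxts n) \<and> card (ctxts n) \<le> n * card (utrees n)"
proof -
  let ?F = "\<lambda>t. {c. c \<noteq> [] \<and> erase c = t}"
  have sub: "ctxts n \<subseteq> (\<Union>t\<in>utrees n. ?F t)"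
  proof
    fix c assume c: "c \<in> ctxts n"
    then have "c \<noteq> []" using assms by (auto simp: ctxts_def)
    then show "c \<in> (\<Union>t\<in>utrees n. ?F t)"
      using c by (intro UN_I[where a="erase c"]) (auto simp: ctxts_def tsize_erase)
  qed
  have fin: "finite (\<Union>t\<in>utrees n. ?F t)" using erase_fibre by auto
  have "card (\<Union>t\<in>utrees n. ?F t) \<le> (\<Sum>t\<in>utrees n. card (?F t))"
    by (rule card_UN_le) auto
  also have "\<dots> \<le> (\<Sum>t\<in>utrees n. n)"
    using erase_fibre by (intro sum_mono) fastforce
  finally have "card (\<Union>t\<in>utrees n. ?F t) \<le> n * card (utrees n)" by (simp add: mult.commute)
  then show ?thesis using sub fin card_mono finite_subset by (meson order_trans)
qed

lemma finite_ctxts [simp]: "finite (ctxts n)"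
  using ctxts_finite_card[of n] by (cases "n = 0") (auto simp: ctxts_0)

text \<open>Descending to a leaf exhibits every tree as a context of size \<open>n\<close> filled
  with a single vertex.\<close>

lemma card_utrees_Suc_le:
  assumes "n \<ge> 1"
  shows "card (utrees (Suc n)) \<le> n * card (utrees n)"
proof -
  have leaf: "\<exists>c. t = plug c (Node {#})" for t
  proof (induction t)
    case (Node A)
    show ?case
    proof (cases A)
      case empty
      then show ?thesis by (intro exI[of _ "[]"]) simp
    next
      case (add b B)
      then obtain c where "b = plug c (Node {#})" using Node by auto
      then show ?thesis using add by (intro exI[of _ "B # c"]) simp
    qed
  qed
  have "utrees (Suc n) \<subseteq> (\<lambda>c. plug c (Node {#})) ` ctxts n"
  proof
    fix t assume t: "t \<in> utrees (Suc n)"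
    obtain c where c: "t = plug c (Node {#})" using leaf by blast
    then show "t \<in> (\<lambda>c. plug c (Node {#})) ` ctxts n"
      using t by (auto simp: tsize_plug ctxts_def)
  qed
  then have "card (utrees (Suc n)) \<le> card (ctxts n)"
    by (meson card_image_le card_mono finite_ctxts finite_imageI order_trans)
  also have "\<dots> \<le> n * card (utrees n)" using ctxts_finite_card assms by auto
  finally show ?thesis .
qed

text \<open>Serves the sizes below \<open>M\<close>, about which the asymptotic estimates say
  nothing: any bound depending on the size alone will do there.\<close>

lemma card_utrees_le_fact: "n \<ge> 1 \<Longrightarrow> card (utrees n) \<le> fact (n - 1)"
proof (induction n rule: nat_induct_at_least)
  case base
  have "utrees (Suc 0) = {Node {#}}" using utrees_1 by simp
  then show ?case by simp
next
  case (Suc n)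
  have "card (utrees (Suc n)) \<le> n * card (utrees n)" using card_utrees_Suc_le Suc by simp
  also have "\<dots> \<le> n * fact (n - 1)" using Suc by simp
  also have "\<dots> = fact n" using Suc by (simp add: fact_reduce)
  finally show ?case by simp
qed

section \<open>Attaching and pruning paths\<close>

primrec pth :: "nat \<Rightarrow> utree" where
  "pth 0 = Node {#}"
| "pth (Suc n) = Node {#pth n#}"

lemma tsize_pth [simp]: "tsize (pth n) = Suc n"
  by (induction n) (auto simp: tsize.simps)

text \<open>A path with x edges attached at v shows up among the children of v as
  \<open>pth (x - 1)\<close>, so \<open>{..<D}\<close> encodes x between 1 and \<open>D\<close>. The
  multiset in \<open>grow_leaf\<close> collects the paths attached at one vertex; none is attached
  to an earlier path.\<close>

inductive grow :: "nat \<Rightarrow> nat \<Rightarrow> utree \<Rightarrow> utree \<Rightarrow> bool" for D where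
  grow_leaf: "set_mset P \<subseteq> {..<D} \<Longrightarrow> grow D (size P) (Node {#}) (Node (image_mset pth P))"
| grow_link: "grow D p (Node A) (Node B) \<Longrightarrow> grow D q a b \<Longrightarrow>
    grow D (p + q) (Node (add_mset a A)) (Node (add_mset b B))"

text \<open>Cuts off whole subtrees of any form and counts the cuts. Forgetting that these were
  short paths makes the way back from a grown tree easy to count: each edge is either cut or
  kept.\<close>

inductive prune :: "nat \<Rightarrow> utree \<Rightarrow> utree \<Rightarrow> bool" where
  prune_leaf: "prune 0 (Node {#}) (Node {#})"
| prune_link: "prune p (Node A) (Node B) \<Longrightarrow> prune q a b \<Longrightarrow>
    prune (p + q) (Node (add_mset a A)) (Node (add_mset b B))"
| prune_cut: "prune p (Node A) (Node B) \<Longrightarrow> prune (Suc p) (Node (add_mset a A)) (Node B)"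

lemma grow_imp_prune: "grow D p t u \<Longrightarrow> prune p u t"
proof (induction rule: grow.induct)
  case (grow_leaf P)
  then show ?case
    by (induction P) (auto intro: prune.intros)
qed (auto intro: prune.intros)

lemma grow_tsize_le: "grow D p t u \<Longrightarrow> tsize u \<le> tsize t + p * D"
proof (induction rule: grow.induct)
  case (grow_leaf P)
  then show ?case
    by (induction P) auto
qed (auto simp: algebra_simps)

lemma grow_leaf_inv:
  assumes "grow D p (Node {#}) u"
  shows "\<exists>P. set_mset P \<subseteq> {..<D} \<and> p = size P \<and> u = Node (image_mset pth P)"
  using assms by (cases rule: grow.cases) auto

text \<open>The last linking step may have used a child other than \<open>a\<close>. The induction
  then pulls \<open>a\<close> out of the rest and exchanges the two steps.\<close>

lemma grow_link_inv:
  assumes "grow D p (Node (add_mset a A)) u"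
  shows "\<exists>q r B b. p = q + r \<and> u = Node (add_mset b B) \<and> grow D q (Node A) (Node B) \<and> grow D r a b"
  using assms
proof (induction p "Node (add_mset a A)" u arbitrary: A rule: grow.induct)
  case (grow_link p A' B' q a' b')
  then consider "a = a'" "A = A'" | K where "A' = add_mset a K" "A = add_mset a' K"
    by (auto simp: add_eq_conv_ex)
  then show ?case
  proof cases
    case 1
    then show ?thesis using grow_link by blast
  next
    case 2
    then obtain p1 p2 B b where *: "p = p1 + p2" "B' = add_mset b B"
      "grow D p1 (Node K) (Node B)" "grow D p2 a b"
      using grow_link(2)[of K] by auto
    have "grow D (p1 + q) (Node A) (Node (add_mset b' B))"
      unfolding 2 using * grow_link by (intro grow.grow_link)
    then show ?thesis using *
      by (intro exI[of _ "p1 + q"] exI[of _ p2] exI[of _ "add_mset b' B"] exI[of _ b]) auto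
  qed
qed (metis empty_not_add_mset)

lemma prune_link_inv:
  assumes "prune p (Node (add_mset a A)) u"
  shows "(\<exists>q r B b. p = q + r \<and> u = Node (add_mset b B) \<and> prune q (Node A) (Node B) \<and> prune r a b) \<or>
    (\<exists>q. p = Suc q \<and> prune q (Node A) u)"
  using assms
proof (induction p "Node (add_mset a A)" u arbitrary: A rule: prune.induct)
  case (prune_link p A' B' q a' b')
  then consider "a = a'" "A = A'" | K where "A' = add_mset a K" "A = add_mset a' K"
    by (auto simp: add_eq_conv_ex)
  then show ?case
  proof cases
    case 1
    then show ?thesis using prune_link by blast
  next
    case 2
    show ?thesis
    proof (cases "\<exists>q. p = Suc q \<and> prune q (Node K) (Node B')")
      case True
      then obtain p' where *: "p = Suc p'" "prune p' (Node K) (Node B')" by blast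
      have "prune (p' + q) (Node A) (Node (add_mset b' B'))"
        unfolding 2 using * prune_link by (intro prune.prune_link)
      then show ?thesis using * by auto
    next
      case False
      then obtain p1 p2 B b where *: "p = p1 + p2" "B' = add_mset b B"
        "prune p1 (Node K) (Node B)" "prune p2 a b"
        using prune_link(2)[of K] 2 by auto
      have "prune (p1 + q) (Node A) (Node (add_mset b' B))"
        unfolding 2 using * prune_link by (intro prune.prune_link)
      then show ?thesis using *
        by (intro disjI1 exI[of _ "p1 + q"] exI[of _ p2] exI[of _ "add_mset b' B"] exI[of _ b]) auto
    qed
  qed
next
  case (prune_cut p A' B' a')
  then consider "a = a'" "A = A'" | K where "A' = add_mset a K" "A = add_mset a' K"
    by (auto simp: add_eq_conv_ex)
  then show ?case
  proof cases
    case 1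
    then show ?thesis using prune_cut by blast
  next
    case 2
    show ?thesis
    proof (cases "\<exists>q. p = Suc q \<and> prune q (Node K) (Node B')")
      case True
      then obtain p' where *: "p = Suc p'" "prune p' (Node K) (Node B')" by blast
      then show ?thesis unfolding 2 using prune.prune_cut by blast
    next
      case False
      then obtain p1 p2 B b where *: "p = p1 + p2" "B' = add_mset b B"
        "prune p1 (Node K) (Node B)" "prune p2 a b"
        using prune_cut(2)[of K] 2 by auto
      have "prune (Suc p1) (Node A) (Node B)"
        unfolding 2 using * prune_cut by (intro prune.prune_cut)
      then show ?thesis using *
        by (intro disjI1 exI[of _ "Suc p1"] exI[of _ p2] exI[of _ B] exI[of _ b]) auto
    qed
  qed
qed (metis empty_not_add_mset)

section \<open>Weighted counts of grown and pruned trees\<close>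

text \<open>Generating functions multiply over products; \<open>h\<close> may identify pairs, whence
  only an inequality. Bounds on all finite subsets stand in for infinite series.\<close>

lemma weight_prod_le:
  fixes y a b :: real
  assumes F: "finite F" "F \<subseteq> h ` (S \<times> T)"
    and h: "\<And>s t. s \<in> S \<Longrightarrow> t \<in> T \<Longrightarrow> fst (h (s, t)) = fst s + (fst t :: nat)"
    and S: "\<And>G. finite G \<Longrightarrow> G \<subseteq> S \<Longrightarrow> (\<Sum>s\<in>G. y ^ fst s) \<le> a"
    and T: "\<And>G. finite G \<Longrightarrow> G \<subseteq> T \<Longrightarrow> (\<Sum>t\<in>G. y ^ fst t) \<le> b"
    and y: "0 \<le> y"
  shows "(\<Sum>x\<in>F. y ^ fst x) \<le> a * b"
proof -
  obtain C where C: "C \<subseteq> S \<times> T" "finite C" "F = h ` C"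
    using finite_subset_image[OF F] by blast
  have "(\<Sum>x\<in>F. y ^ fst x) \<le> (\<Sum>c\<in>C. y ^ fst (h c))"
    unfolding C(3) using C(2) y by (intro sum_image_le[where g="\<lambda>x. y ^ fst x", unfolded o_def]) auto
  also have "\<dots> = (\<Sum>c\<in>C. y ^ fst (fst c) * y ^ fst (snd c))"
    using C(1) h by (intro sum.cong refl) (auto simp: power_add subset_eq)
  also have "\<dots> \<le> (\<Sum>c\<in>fst ` C \<times> snd ` C. y ^ fst (fst c) * y ^ fst (snd c))"
    using C(2) y by (intro sum_mono2) (auto intro: rev_image_eqI)
  also have "\<dots> = (\<Sum>s\<in>fst ` C. y ^ fst s) * (\<Sum>t\<in>snd ` C. y ^ fst t)"
    by (simp add: sum_product sum.cartesian_product case_prod_unfold)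
  also have "\<dots> \<le> a * b"
  proof (intro mult_mono S T sum_nonneg)
    show "0 \<le> a" using S[of "{}"] by simp
  qed (use C y in auto)
  finally show ?thesis .
qed

text \<open>Each vertex of \<open>t\<close> independently receives a multiset of paths. Lists
  overcount multisets and contribute the geometric series in \<open>real D * y\<close>, once per
  vertex.\<close>

lemma grow_weight:
  fixes y :: real
  assumes y: "0 \<le> y" "real D * y < 1"
  shows "finite F \<Longrightarrow> F \<subseteq> {(p, u). grow D p t u} \<Longrightarrow>
    (\<Sum>x\<in>F. y ^ fst x) \<le> (1 / (1 - real D * y)) ^ tsize t"
proof (induction t arbitrary: F rule: utree_link_induct)
  case leaf
  let ?h = "\<lambda>xs. (length xs, Node (image_mset pth (mset xs)))"
  have "F \<subseteq> ?h ` lists {..<D}"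
  proof
    fix x assume x: "x \<in> F"
    obtain p u where pu: "x = (p, u)" by force
    then have "grow D p (Node {#}) u" using x leaf by auto
    then obtain P where P: "set_mset P \<subseteq> {..<D}" "x = (size P, Node (image_mset pth P))"
      using grow_leaf_inv pu by blast
    obtain xs where "P = mset xs" by (metis ex_mset)
    then show "x \<in> ?h ` lists {..<D}" using P by (intro image_eqI[of _ _ xs]) auto
  qed
  then obtain C where C: "C \<subseteq> lists {..<D}" "finite C" "F = ?h ` C"
    using finite_subset_image[OF leaf(1)] by blast
  obtain N where N: "\<And>xs. xs \<in> C \<Longrightarrow> length xs < N"
    using C(2) finite_nat_set_iff_bounded[of "length ` C"] by auto
  have "(\<Sum>x\<in>F. y ^ fst x) \<le> (\<Sum>xs\<in>C. y ^ length xs)"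
    unfolding C(3) using C(2) y
    by (intro order_trans[OF sum_image_le[where g="\<lambda>x. y ^ fst x"]]) auto
  also have "\<dots> \<le> (\<Sum>xs\<in>(\<Union>n<N. {xs. set xs \<subseteq> {..<D} \<and> length xs = n}). y ^ length xs)"
    using C(1) N y by (intro sum_mono2) (auto simp: finite_lists_length_eq lists_eq_set)
  also have "\<dots> = (\<Sum>n<N. \<Sum>xs\<in>{xs. set xs \<subseteq> {..<D} \<and> length xs = n}. y ^ length xs)"
    by (intro sum.UNION_disjoint) (auto simp: finite_lists_length_eq)
  also have "\<dots> = (\<Sum>n<N. (real D * y) ^ n)"
    by (intro sum.cong refl) (simp add: card_lists_length_eq power_mult_distrib)
  also have "\<dots> \<le> 1 / (1 - real D * y)"
    using y by (subst sum_gp_strict) (auto intro!: divide_right_mono)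
  finally show ?case by simp
next
  case (link A b)
  let ?h = "\<lambda>((p, u), (q, v)). (p + q, Node (add_mset v (children u)))"
  have "F \<subseteq> ?h ` ({(p, u). grow D p (Node A) u} \<times> {(p, u). grow D p b u})"
  proof
    fix x assume x: "x \<in> F"
    obtain p u where pu: "x = (p, u)" by force
    then have "grow D p (Node (add_mset b A)) u" using x link.prems by auto
    from grow_link_inv[OF this] obtain q r B b' where
      "p = q + r" "u = Node (add_mset b' B)" "grow D q (Node A) (Node B)" "grow D r b b'" by blast
    then show "x \<in> ?h ` ({(p, u). grow D p (Node A) u} \<times> {(p, u). grow D p b u})"
      unfolding pu by (intro image_eqI[of _ _ "((q, Node B), (r, b'))"]) auto
  qed
  then have "(\<Sum>x\<in>F. y ^ fst x) \<le>
      (1 / (1 - real D * y)) ^ tsize (Node A) * (1 / (1 - real D * y)) ^ tsize b"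
    using y link.prems by (intro weight_prod_le[where h="?h"] link.IH) auto
  then show ?case by (simp add: power_add)
qed

text \<open>Each edge is kept or, at weight \<open>y\<close>, cut: one factor \<open>1 + y\<close>
  per non-root vertex.\<close>

lemma prune_weight:
  fixes y :: real
  assumes y: "0 \<le> y"
  shows "finite F \<Longrightarrow> F \<subseteq> {(p, t). prune p u t} \<Longrightarrow> (\<Sum>x\<in>F. y ^ fst x) \<le> (1 + y) ^ (tsize u - 1)"
proof (induction u arbitrary: F rule: utree_link_induct)
  case leaf
  have "p = 0 \<and> u = Node {#}" if "prune p (Node {#}) u" for p u
    using that by (cases rule: prune.cases) auto
  then have "F \<subseteq> {(0, Node {#})}" using leaf(2) by fastforce
  then have "F = {} \<or> F = {(0, Node {#})}" by auto
  then show ?case by auto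
next
  case (link A b)
  let ?h = "\<lambda>((p, u), (q, v)). (p + q, case v of None \<Rightarrow> u | Some v \<Rightarrow> Node (add_mset v (children u)))"
  let ?T = "insert (1, None) (map_prod id Some ` {(p, u). prune p b u})"
  have sub: "F \<subseteq> ?h ` ({(p, u). prune p (Node A) u} \<times> ?T)"
  proof
    fix x assume x: "x \<in> F"
    obtain p u where pu: "x = (p, u)" by force
    then have "prune p (Node (add_mset b A)) u" using x link.prems by auto
    from prune_link_inv[OF this] consider q r B b' where
        "p = q + r" "u = Node (add_mset b' B)" "prune q (Node A) (Node B)" "prune r b b'"
      | q where "p = Suc q" "prune q (Node A) u" by blast
    then show "x \<in> ?h ` ({(p, u). prune p (Node A) u} \<times> ?T)"
    proof cases
      case 1
      then show ?thesis unfolding pu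
        by (intro image_eqI[of _ _ "((q, Node B), (r, Some b'))"]) (auto intro: rev_image_eqI)
    next
      case 2
      then show ?thesis unfolding pu
        by (intro image_eqI[of _ _ "((q, u), (1, None))"]) auto
    qed
  qed
  have T: "(\<Sum>t\<in>G. y ^ fst t) \<le> (1 + y) ^ tsize b" if G: "finite G" "G \<subseteq> ?T" for G
  proof -
    have "finite (G - {(1, None)})" "G - {(1, None)} \<subseteq> map_prod id Some ` {(p, u). prune p b u}"
      using G by auto
    from finite_subset_image[OF this] obtain C
      where C: "C \<subseteq> {(p, u). prune p b u}" "finite C" "G - {(1, None)} = map_prod id Some ` C"
      by auto
    have "(\<Sum>t\<in>G. y ^ fst t) \<le> (\<Sum>t\<in>insert (1, None) (G - {(1, None)}). y ^ fst t)"
      using G y by (intro sum_mono2) auto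
    also have "\<dots> = y + (\<Sum>t\<in>map_prod id Some ` C. y ^ fst t)"
      using G by (subst sum.insert) (auto simp: C(3)[symmetric])
    also have "(\<Sum>t\<in>map_prod id Some ` C. y ^ fst t) = (\<Sum>t\<in>C. y ^ fst t)"
      by (subst sum.reindex) (auto intro: prod.inj_map simp: inj_on_def)
    also have "\<dots> \<le> (1 + y) ^ (tsize b - 1)"
      using C by (intro link.IH)
    \<comment> \<open>Cutting off \<open>b\<close> replaces all choices inside \<open>b\<close>,
      whose total weight is at least 1; so the cut costs no more than \<open>y\<close> times that
      weight, and both alternatives together give one more factor \<open>1 + y\<close>.\<close>
    also have "y + (1 + y) ^ (tsize b - 1) \<le> y * (1 + y) ^ (tsize b - 1) + (1 + y) ^ (tsize b - 1)"
      using y mult_left_mono[of 1 "(1 + y) ^ (tsize b - 1)" y] by simp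
    also have "\<dots> = (1 + y) ^ tsize b"
      by (cases "tsize b") (auto simp: algebra_simps)
    finally show ?thesis by simp
  qed
  have "(\<Sum>x\<in>F. y ^ fst x) \<le> (1 + y) ^ (tsize (Node A) - 1) * (1 + y) ^ tsize b"
    using y link.prems by (intro weight_prod_le[OF _ sub] T link.IH) (auto split: option.splits)
  also have "\<dots> = (1 + y) ^ (tsize (Node (add_mset b A)) - 1)"
    by (cases "tsize (Node A)") (auto simp flip: power_add)
  finally show ?case .
qed

text \<open>Markov's inequality: as \<open>y \<le> 1\<close>, an element reached by at most
  \<open>z\<close> operations has weight at least \<open>y powr z\<close>.\<close>

lemma card_le_weight:
  fixes y z w :: real
  assumes w: "\<And>F. finite F \<Longrightarrow> F \<subseteq> S \<Longrightarrow> (\<Sum>x\<in>F. y ^ fst x) \<le> w"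
    and y: "0 < y" "y \<le> 1" and fin: "finite X"
    and X: "\<And>x. x \<in> X \<Longrightarrow> \<exists>p. (p, x) \<in> S \<and> real p \<le> z"
  shows "real (card X) \<le> w * y powr - z"
proof -
  obtain P where P: "\<And>x. x \<in> X \<Longrightarrow> (P x, x) \<in> S \<and> real (P x) \<le> z"
    using X by metis
  have "real (card X) * y powr z = (\<Sum>x\<in>X. y powr z)" by simp
  also have "\<dots> \<le> (\<Sum>x\<in>X. y ^ P x)"
  proof (rule sum_mono)
    fix x assume "x \<in> X"
    then have "y powr z \<le> y powr P x" using P y by (intro powr_mono') auto
    then show "y powr z \<le> y ^ P x" using y by (simp add: powr_realpow)
  qed
  also have "\<dots> = (\<Sum>x\<in>(\<lambda>x. (P x, x)) ` X. y ^ fst x)"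
    by (subst sum.reindex) (auto simp: inj_on_def)
  also have "\<dots> \<le> w" using fin P by (intro w) auto
  finally have "real (card X) * y powr z \<le> w" .
  then show ?thesis using y by (simp add: powr_minus field_simps)
qed

section \<open>The number of trees similar to a given one\<close>

text \<open>A coarser form of similarity, on isomorphism classes: paths may also be attached at
  leaves. Pairs that avoid it avoid the original relation.\<close>

definition usim :: "nat \<Rightarrow> real \<Rightarrow> utree \<Rightarrow> utree \<Rightarrow> bool" where
  "usim D L t t' \<longleftrightarrow> (\<exists>u p p'. grow D p t u \<and> grow D p' t' u \<and>
     real p \<le> real (tsize t) / L \<and> real p' \<le> real (tsize t') / L)"

lemma usim_sym: "usim D L t t' \<Longrightarrow> usim D L t' t"
  unfolding usim_def by blast

text \<open>A similar tree is reached by growing \<open>t\<close> to a common tree \<open>u\<close>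
  and pruning \<open>u\<close>, and each half is counted by its weight. The given tree may be
  smaller than \<open>n\<close>, as comparisons with a smaller sibling or with a descendant
  require.\<close>

lemma card_usim_le:
  assumes L: "L \<ge> exp 1" and D: "real D \<le> L\<^sup>2" and t: "tsize t \<le> n"
  shows "real (card {t' \<in> utrees n. usim D L t t'}) \<le> exp (10 * ln L / L * n)"
proof -
  \<comment> \<open>Small enough that both generating functions stay within exp(O(n/L)):
    \<open>real D * y\<close> is at most 1/L, and the size of \<open>u\<close> times
    \<open>y\<close> is at most 2n/L^2. The price y^(-n/L) = exp(3 n ln L / L), paid twice, is the
    main term.\<close>
  define y where "y = 1 / L ^ 3"
  define z where "z = real n / L"
  have L2: "L \<ge> 2" using L exp_ge_add_one_self[of 1] by linarith
  have lnL: "ln L \<ge> 1" using L L2 by (subst ln_ge_iff) auto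
  have y: "0 < y" "y \<le> 1" unfolding y_def using L2 by (auto simp: divide_simps intro: one_le_power)
  have Dy: "real D * y \<le> 1 / L"
    using mult_right_mono[OF D, of y] y L2 by (simp add: y_def power2_eq_square power3_eq_cube)
  also have "1 / L < 1" using L2 by simp
  finally have Dy1: "real D * y < 1" .
  define U where "U = {u. \<exists>p. grow D p t u \<and> real p \<le> z \<and> real (tsize u) \<le> n + n * L}"
  have "U \<subseteq> {u. tsize u \<le> nat \<lceil>n + n * L\<rceil>}" unfolding U_def using le_nat_iff by (auto simp: le_ceiling_iff) 
  then have finU: "finite U" using finite_tsize_le finite_subset by blast
  have cU: "real (card U) \<le> (1 / (1 - real D * y)) ^ tsize t * y powr - z"
  proof (rule card_le_weight[OF grow_weight[where D=D and t=t]])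
    fix x assume "x \<in> U"
    then show "\<exists>p. (p, x) \<in> {(p, u). grow D p t u} \<and> real p \<le> z" by (auto simp: U_def)
  qed (use y Dy1 finU in auto)
  define W where "W = (\<lambda>u. {t' \<in> utrees n. \<exists>p. prune p u t' \<and> real p \<le> z})"
  have cW: "real (card (W u)) \<le> exp (2 * n / L\<^sup>2) * y powr - z" if "u \<in> U" for u
  proof -
    have "real (card (W u)) \<le> (1 + y) ^ (tsize u - 1) * y powr - z"
      using y by (intro card_le_weight[OF prune_weight[where u=u]])
        (auto simp: W_def intro: finite_subset[OF _ finite_utrees[of n]])
    also have "(1 + y) ^ (tsize u - 1) \<le> exp y ^ (tsize u - 1)"
      using y exp_ge_add_one_self[of y] by (intro power_mono) (auto simp: add.commute)
    also have "\<dots> \<le> exp (2 * n / L\<^sup>2)"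
    proof -
      have "real (tsize u - 1) * y \<le> (n + n * L) * y"
        using that y by (intro mult_right_mono) (auto simp: U_def)
      also have "\<dots> \<le> (2 * n * L) * y"
        using L2 y mult_left_mono[of 1 L "real n"] by (intro mult_right_mono) (auto simp: mult.commute)
      also have "\<dots> = 2 * n / L\<^sup>2"
        unfolding y_def using L2 by (simp add: field_simps power2_eq_square power3_eq_cube)
      finally have "real (tsize u - 1) * y \<le> 2 * n / L\<^sup>2" .
      then show ?thesis by (subst exp_of_nat_mult[symmetric]) simp
    qed
    finally show ?thesis by (simp add: mult_right_mono)
  qed
  have "{t' \<in> utrees n. usim D L t t'} \<subseteq> (\<Union>u\<in>U. W u)"
  proof
    fix t' assume "t' \<in> {t' \<in> utrees n. usim D L t t'}"
    then obtain u p p' where *: "tsize t' = n" "grow D p t u" "grow D p' t' u"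
      "real p \<le> real (tsize t) / L" "real p' \<le> n / L" by (auto simp: usim_def)
    have pz: "real p \<le> z"
      using * t L2 divide_right_mono[of "real (tsize t)" "real n" L] by (auto simp: z_def)
    have "real (tsize u) \<le> real (tsize t) + real p * real D"
      using grow_tsize_le[OF *(2)] by (metis of_nat_add of_nat_le_iff of_nat_mult)
    also have "\<dots> \<le> n + z * L\<^sup>2"
      using pz D t by (intro add_mono mult_mono) (auto intro: order_trans[OF of_nat_0_le_iff])
    also have "\<dots> = n + n * L" unfolding z_def using L2 by (simp add: field_simps power2_eq_square)
    finally have "u \<in> U" using * pz by (auto simp: U_def)
    moreover have "t' \<in> W u" using * grow_imp_prune[OF *(3)] by (auto simp: W_def z_def)
    ultimately show "t' \<in> (\<Union>u\<in>U. W u)" by blast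
  qed
  moreover have "finite (W u)" for u
    by (rule finite_subset[OF _ finite_utrees[of n]]) (auto simp: W_def)
  ultimately have "card {t' \<in> utrees n. usim D L t t'} \<le> card (\<Union>u\<in>U. W u)"
    using finU by (intro card_mono finite_UN_I) auto
  also have "\<dots> \<le> (\<Sum>u\<in>U. card (W u))" by (rule card_UN_le[OF finU])
  finally have "real (card {t' \<in> utrees n. usim D L t t'}) \<le> (\<Sum>u\<in>U. real (card (W u)))"
    by (simp flip: of_nat_sum)
  also have "\<dots> \<le> real (card U) * (exp (2 * n / L\<^sup>2) * y powr - z)"
    using cW by (intro sum_bounded_above) auto
  also have "\<dots> \<le> (exp (2 / L * n) * y powr - z) * (exp (2 * n / L\<^sup>2) * y powr - z)"
  proof (intro mult_right_mono)
    have "1 / (1 - real D * y) \<le> exp (2 / L)"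
    proof -
      have "1 \<le> (1 + 2 / L) * (1 - 1 / L)" using L2 by (simp add: field_simps)
      also have "\<dots> \<le> exp (2 / L) * (1 - real D * y)"
        using exp_ge_add_one_self[of "2 / L"] Dy L2 by (intro mult_mono) auto
      finally show ?thesis using Dy1 by (simp add: field_simps)
    qed
    then have "(1 / (1 - real D * y)) ^ tsize t \<le> exp (2 / L) ^ tsize t"
      using Dy1 by (intro power_mono) auto
    also have "\<dots> \<le> exp (2 / L) ^ n" using t L2 by (intro power_increasing) auto
    also have "\<dots> = exp (2 / L * n)" by (subst exp_of_nat_mult[symmetric]) (simp only: mult.commute)
    finally show "real (card U) \<le> exp (2 / L * n) * y powr - z"
      using order_trans[OF cU mult_right_mono] by simp
  qed auto
  also have "\<dots> = exp (2 / L * n + 2 * n / L\<^sup>2 + 6 * ln L / L * n)"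
  proof -
    have "y powr - z = exp (3 * ln L / L * n)"
      using L2 by (simp add: y_def z_def powr_def ln_div ln_realpow)
    then have "(exp (2 / L * n) * y powr - z) * (exp (2 * n / L\<^sup>2) * y powr - z) =
        exp (2 / L * n + 3 * ln L / L * n + (2 * n / L\<^sup>2 + 3 * ln L / L * n))"
      by (simp only: exp_add)
    then show ?thesis by (simp add: algebra_simps)
  qed
  also have "\<dots> \<le> exp (10 * ln L / L * n)"
  proof -
    have "2 * n / L\<^sup>2 \<le> 2 * n / L"
      using L2 by (intro divide_left_mono) (auto simp: power2_eq_square)
    moreover have "4 / L * n \<le> 4 * ln L / L * n"
      using lnL L2 by (intro mult_right_mono divide_right_mono) auto
    ultimately show ?thesis by simp
  qed
  finally show ?thesis .
qed

section \<open>Labelled trees and their shapes\<close>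

abbreviation edges :: "'a rooted \<Rightarrow> 'a rel" where "edges T \<equiv> parcs (graph_of T)"

definition sing :: "'a \<Rightarrow> 'a rooted" where
  "sing r = (\<lparr>pverts = {r}, parcs = {}\<rparr>, r)"

definition lnk :: "'a rooted \<Rightarrow> 'a rooted \<Rightarrow> 'a rooted" where
  "lnk T S = (\<lparr>pverts = vertices T \<union> vertices S,
     parcs = edges T \<union> edges S \<union> {(root_of T, root_of S), (root_of S, root_of T)}\<rparr>, root_of T)"

lemma sing_simps [simp]: "vertices (sing r) = {r}" "edges (sing r) = {}" "root_of (sing r) = r"
  by (auto simp: sing_def)

lemma lnk_simps [simp]: "vertices (lnk T S) = vertices T \<union> vertices S"
  "edges (lnk T S) = edges T \<union> edges S \<union> {(root_of T, root_of S), (root_of S, root_of T)}"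
  "root_of (lnk T S) = root_of T"
  by (auto simp: lnk_def)

lemma rooted_eqI:
  fixes T S :: "'a rooted"
  assumes "vertices T = vertices S" "edges T = edges S" "root_of T = root_of S"
  shows "T = S"
  using assms by (cases T; cases S) (auto intro: pair_pre_digraph.equality)

text \<open>\<open>T\<close> is a labelled representative of \<open>t\<close>. Building it from
  disjoint trees by single bridges lets graph properties be proved by induction.\<close>

inductive shape :: "'a rooted \<Rightarrow> utree \<Rightarrow> bool" where
  shape_sing: "shape (sing r) (Node {#})"
| shape_lnk: "shape T (Node A) \<Longrightarrow> shape S b \<Longrightarrow> vertices T \<inter> vertices S = {} \<Longrightarrow>
    shape (lnk T S) (Node (add_mset b A))"

lemma shape_wf:
  "shape T t \<Longrightarrow> finite (vertices T) \<and> root_of T \<in> vertices T \<and> edges T \<subseteq> vertices T \<times> vertices T \<and>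
    sym (edges T) \<and> irrefl (edges T) \<and> card (vertices T) = tsize t"
proof (induction rule: shape.induct)
  case (shape_lnk T A S b)
  then have "sym (edges T \<union> edges S)" by (auto intro: sym_Un)
  moreover have "sym {(root_of T, root_of S), (root_of S, root_of T)}" by (auto simp: sym_def)
  ultimately have "sym (edges (lnk T S))" by (simp only: lnk_simps sym_Un)
  with shape_lnk show ?case by (auto simp: card_Un_disjoint irrefl_def)
qed (auto simp: sym_def irrefl_def)

lemma shape_finite: "shape T t \<Longrightarrow> finite (vertices T)"
  and shape_root: "shape T t \<Longrightarrow> root_of T \<in> vertices T"
  and shape_edges: "shape T t \<Longrightarrow> edges T \<subseteq> vertices T \<times> vertices T"
  and shape_sym: "shape T t \<Longrightarrow> sym (edges T)"
  and shape_irrefl: "shape T t \<Longrightarrow> (v, v) \<notin> edges T"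
  and shape_card: "shape T t \<Longrightarrow> card (vertices T) = tsize t"
  using shape_wf[of T t] by (auto simp: irrefl_def)

text \<open>The two parts meet only in the edge between their roots, so a walk avoiding the root of
  \<open>T\<close> cannot change sides.\<close>

lemma walk_lnk_left:
  assumes "vertices T \<inter> vertices S = {}" "edges T \<subseteq> vertices T \<times> vertices T"
    "edges S \<subseteq> vertices S \<times> vertices S" "root_of S \<in> vertices S"
  shows "set (vwalk_arcs q) \<subseteq> edges (lnk T S) \<Longrightarrow> q \<noteq> [] \<Longrightarrow> hd q \<in> vertices T \<Longrightarrow> root_of T \<notin> set q \<Longrightarrow>
    set q \<subseteq> vertices T \<and> set (vwalk_arcs q) \<subseteq> edges T"
  by (induction q rule: vwalk_arcs.induct) (use assms in auto)

lemma walk_lnk_right: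
  assumes "vertices T \<inter> vertices S = {}" "edges T \<subseteq> vertices T \<times> vertices T"
    "edges S \<subseteq> vertices S \<times> vertices S" "root_of T \<in> vertices T"
  shows "set (vwalk_arcs q) \<subseteq> edges (lnk T S) \<Longrightarrow> q \<noteq> [] \<Longrightarrow> hd q \<in> vertices S \<Longrightarrow> root_of T \<notin> set q \<Longrightarrow>
    set q \<subseteq> vertices S \<and> set (vwalk_arcs q) \<subseteq> edges S"
  by (induction q rule: vwalk_arcs.induct) (use assms in auto)

lemma vwalk_arcs_Cons: "q \<noteq> [] \<Longrightarrow> vwalk_arcs (u # q) = (u, hd q) # vwalk_arcs q"
  by (cases q) auto

text \<open>A path from the root crosses the bridge at its first step or never, since crossing later
  would visit the root twice.\<close>

lemma vpath_lnk:
  assumes T: "shape T t" and S: "shape S s" and disj: "vertices T \<inter> vertices S = {}"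
  shows "vpath p (with_proj (graph_of (lnk T S))) \<and> hd p = root_of T \<longleftrightarrow>
    (vpath p (with_proj (graph_of T)) \<and> hd p = root_of T) \<or>
    (\<exists>q. p = root_of T # q \<and> vpath q (with_proj (graph_of S)) \<and> hd q = root_of S)"
    (is "?L \<longleftrightarrow> ?R1 \<or> ?R2")
proof
  note T' = shape_root[OF T] shape_edges[OF T] and S' = shape_root[OF S] shape_edges[OF S]
  assume L: ?L
  show "?R1 \<or> ?R2"
  proof (cases p)
    case Nil
    then show ?thesis using L by (auto simp: vpath_def vwalk_def)
  next
    case (Cons r q)
    then have r: "r = root_of T" "r \<notin> set q" "distinct q" using L by (auto simp: vpath_def)
    show ?thesis
    proof (cases "q = []")
      case True
      then show ?thesis using Cons r T' by (auto simp: vpath_def vwalk_def)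
    next
      case False
      have q: "set (vwalk_arcs q) \<subseteq> edges (lnk T S)" "(r, hd q) \<in> edges (lnk T S)"
        using L Cons vwalk_arcs_Cons[OF False] by (auto simp: vpath_def vwalk_def)
      have hd: "hd q = root_of S \<or> (r, hd q) \<in> edges T"
        using q(2) r T' S' disj by auto
      then show ?thesis
      proof
        assume "hd q = root_of S"
        with walk_lnk_right[OF disj T'(2) S'(2) T'(1) q(1) False] S' r False Cons
        show ?thesis by (auto simp: vpath_def vwalk_def)
      next
        assume e: "(r, hd q) \<in> edges T"
        with walk_lnk_left[OF disj T'(2) S'(2) S'(1) q(1) False] T' r False Cons
        show ?thesis by (auto simp: vpath_def vwalk_def vwalk_arcs_Cons)
      qed
    qed
  qed
next
  note T' = shape_root[OF T] shape_edges[OF T] and S' = shape_root[OF S] shape_edges[OF S]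
  assume "?R1 \<or> ?R2"
  then show ?L
  proof
    assume ?R2
    then obtain q where q: "p = root_of T # q" "vpath q (with_proj (graph_of S))" "hd q = root_of S" by blast
    then have "q \<noteq> []" by (auto simp: vpath_def vwalk_def)
    then show ?L using q T' disj by (auto simp: vpath_def vwalk_def vwalk_arcs_Cons)
  qed (auto simp: vpath_def vwalk_def)
qed

lemma shape_reach:
  "shape T t \<Longrightarrow> w \<in> vertices T \<Longrightarrow> \<exists>p. vpath p (with_proj (graph_of T)) \<and> hd p = root_of T \<and> last p = w"
proof (induction arbitrary: w rule: shape.induct)
  case (shape_sing r)
  then show ?case by (intro exI[of _ "[r]"]) (auto simp: vpath_def vwalk_def)
next
  case (shape_lnk T A S b)
  note iff = vpath_lnk[OF shape_lnk(1-3)]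
  show ?case
  proof (cases "w \<in> vertices T")
    case True
    then show ?thesis using shape_lnk iff by (metis lnk_simps(3))
  next
    case False
    then have "w \<in> vertices S" using shape_lnk.prems by simp
    from shape_lnk.IH(2)[OF this]
    obtain p where p: "vpath p (with_proj (graph_of S))" "hd p = root_of S" "last p = w"
      by blast
    have "p \<noteq> []" using p by (auto simp: vpath_def vwalk_def)
    then have "last (root_of T # p) = w" using p by simp
    then show ?thesis using p iff by (metis lnk_simps(3))
  qed
qed

section \<open>Descendant trees under linking\<close>

lemma descendants_subset: "descendants T v \<subseteq> vertices T"
  by (auto simp: descendants_def vpath_def vwalk_def subset_eq)

lemma self_descendant: "shape T t \<Longrightarrow> v \<in> vertices T \<Longrightarrow> v \<in> descendants T v"
  using shape_reach[of T t v] by (auto simp: descendants_def vpath_def vwalk_def)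

lemma descendants_root: "shape T t \<Longrightarrow> descendants T (root_of T) = vertices T"
proof
  assume T: "shape T t"
  show "vertices T \<subseteq> descendants T (root_of T)"
  proof
    fix w assume "w \<in> vertices T"
    then obtain p where p: "vpath p (with_proj (graph_of T))" "hd p = root_of T" "last p = w"
      using shape_reach[OF T] by blast
    then have "root_of T \<in> set p" by (cases p) (auto simp: vpath_def vwalk_def)
    then show "w \<in> descendants T (root_of T)" using p by (auto simp: descendants_def)
  qed
qed (rule descendants_subset)

lemma root_notin_descendants: "v \<noteq> root_of T \<Longrightarrow> root_of T \<notin> descendants T v"
proof
  assume v: "v \<noteq> root_of T" "root_of T \<in> descendants T v"
  then obtain p where p: "distinct p" "p \<noteq> []" "hd p = root_of T" "last p = root_of T" "v \<in> set p"
    by (auto simp: descendants_def vpath_def vwalk_def)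
  then show False using v by (cases p) (auto split: if_splits dest: last_in_set)
qed

lemma descendants_lnk_left:
  assumes T: "shape T t" and S: "shape S s" and disj: "vertices T \<inter> vertices S = {}"
    and v: "v \<notin> vertices S" "v \<noteq> root_of T"
  shows "descendants (lnk T S) v = descendants T v"
proof -
  have "v \<notin> set (root_of T # q)" if "vpath q (with_proj (graph_of S))" for q
    using that v by (auto simp: vpath_def vwalk_def)
  then show ?thesis
    unfolding descendants_def lnk_simps using vpath_lnk[OF T S disj] by blast
qed

lemma descendants_lnk_right:
  assumes T: "shape T t" and S: "shape S s" and disj: "vertices T \<inter> vertices S = {}"
    and v: "v \<in> vertices S"
  shows "descendants (lnk T S) v = descendants S v"
proof -
  have r: "v \<noteq> root_of T" using v disj shape_root[OF T] by auto
  have T': "v \<notin> set p" if "vpath p (with_proj (graph_of T))" for p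
    using that v disj by (auto simp: vpath_def vwalk_def)
  have S': "last (root_of T # q) = last q" if "vpath q (with_proj (graph_of S))" for q
    using that by (auto simp: vpath_def vwalk_def)
  show ?thesis
  proof (intro equalityI subsetI)
    fix w assume "w \<in> descendants (lnk T S) v"
    then obtain p where p: "vpath p (with_proj (graph_of (lnk T S)))" "hd p = root_of T" "last p = w" "v \<in> set p"
      by (auto simp: descendants_def)
    then obtain q where "p = root_of T # q" "vpath q (with_proj (graph_of S))" "hd q = root_of S"
      using vpath_lnk[OF T S disj] T' by blast
    then show "w \<in> descendants S v" using p S' r by (auto simp: descendants_def)
  next
    fix w assume "w \<in> descendants S v"
    then obtain q where q: "vpath q (with_proj (graph_of S))" "hd q = root_of S" "last q = w" "v \<in> set q"
      by (auto simp: descendants_def)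
    then have "vpath (root_of T # q) (with_proj (graph_of (lnk T S))) \<and> hd (root_of T # q) = root_of T"
      using vpath_lnk[OF T S disj] by blast
    then show "w \<in> descendants (lnk T S) v"
      unfolding descendants_def using q S'[OF q(1)] by (intro CollectI exI[of _ "root_of T # q"]) simp
  qed
qed

lemma Des_simps [simp]: "vertices (Des T v) = descendants T v"
  "edges (Des T v) = edges T \<inter> descendants T v \<times> descendants T v" "root_of (Des T v) = v"
  by (auto simp: Des_def induced_def)

lemma Des_root: "shape T t \<Longrightarrow> Des T (root_of T) = T"
  using descendants_root[of T t] shape_edges[of T t] by (intro rooted_eqI) auto

lemma Des_lnk_left:
  assumes T: "shape T t" and S: "shape S s" and disj: "vertices T \<inter> vertices S = {}"
    and v: "v \<notin> vertices S" "v \<noteq> root_of T"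
  shows "Des (lnk T S) v = Des T v"
proof -
  have "root_of S \<notin> descendants T v" "edges S \<inter> descendants T v \<times> descendants T v = {}"
    using descendants_subset[of T v] disj shape_root[OF S] shape_edges[OF S] by auto
  then show ?thesis
    using descendants_lnk_left[OF assms] by (intro rooted_eqI) auto
qed

lemma Des_lnk_right:
  assumes T: "shape T t" and S: "shape S s" and disj: "vertices T \<inter> vertices S = {}"
    and v: "v \<in> vertices S"
  shows "Des (lnk T S) v = Des S v"
proof -
  have "root_of T \<notin> descendants S v" "edges T \<inter> descendants S v \<times> descendants S v = {}"
    using descendants_subset[of S v] disj shape_root[OF T] shape_edges[OF T] by auto
  then show ?thesis
    using descendants_lnk_right[OF assms] by (intro rooted_eqI) auto
qed

text \<open>Descendants are defined through paths from the root, and inside \<open>Des T w\<close>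
  the root is \<open>w\<close>; the resulting subgraph is nevertheless the one seen from the whole
  tree.\<close>

lemma Des_Des: "shape T t \<Longrightarrow> w \<in> vertices T \<Longrightarrow> v \<in> descendants T w \<Longrightarrow> Des (Des T w) v = Des T v"
proof (induction arbitrary: w v rule: shape.induct)
  case (shape_sing r)
  then show ?case using Des_root[OF shape.shape_sing[of r]] by simp
next
  case (shape_lnk T A S b)
  note lnk = shape_lnk(1-3) and full = shape.shape_lnk[OF shape_lnk(1-3)]
  consider "w = root_of T" | "w \<in> vertices S" | "w \<in> vertices T" "w \<notin> vertices S" "w \<noteq> root_of T"
    using shape_lnk.prems by auto
  then show ?case
  proof cases
    case 1
    then show ?thesis using Des_root[OF full] by simp
  next
    case 2
    then have v: "v \<in> descendants S w" using shape_lnk.prems descendants_lnk_right[OF lnk] by simp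
    then have "v \<in> vertices S" using descendants_subset[of S w] by blast
    then show ?thesis using Des_lnk_right[OF lnk] 2 v shape_lnk.IH by simp
  next
    case 3
    then have v: "v \<in> descendants T w" using shape_lnk.prems descendants_lnk_left[OF lnk] by simp
    then have "v \<in> vertices T" "v \<noteq> root_of T" using descendants_subset[of T w] root_notin_descendants[of w T] 3 by blast+
    moreover have "v \<notin> vertices S" using calculation shape_lnk(3) by auto
    ultimately show ?thesis using Des_lnk_left[OF lnk] 3 v shape_lnk.IH by simp
  qed
qed

text \<open>The isomorphism classes of the descendant trees. Repeated classes merge, which is enough
  for upper bounds and for properties required at every vertex.\<close>

primrec subs :: "utree \<Rightarrow> utree set" where
  "subs (Node A) = insert (Node A) (\<Union>(set_mset (image_mset subs A)))"

lemma self_subs [simp]: "t \<in> subs t"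
  by (cases t) simp

lemma deg_eq: "deg T v = card {e \<in> edges T. fst e = v}"
  by (simp add: deg_def out_degree_def out_arcs_def)

lemma finite_edges: "shape T t \<Longrightarrow> finite (edges T)"
  using shape_edges[of T t] shape_finite[of T t] finite_subset by blast

lemma deg_lnk_le:
  assumes T: "shape T t" and S: "shape S s" and disj: "vertices T \<inter> vertices S = {}"
  shows "deg (lnk T S) v \<le> (if v \<in> vertices S then deg S v else deg T v) +
    (if v = root_of T \<or> v = root_of S then 1 else 0)"
proof -
  let ?E = "\<lambda>T. {e \<in> edges T. fst e = v}"
  let ?U = "if v \<in> vertices S then S else T"
  let ?X = "if v = root_of T then {(root_of T, root_of S)} else if v = root_of S then {(root_of S, root_of T)} else {}"
  have "?E (lnk T S) \<subseteq> ?E ?U \<union> ?X"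
    using shape_edges[OF T] shape_edges[OF S] disj shape_root[OF T] shape_root[OF S] by auto
  moreover have "finite (?E ?U \<union> ?X)" using finite_edges[OF T] finite_edges[OF S] by auto
  ultimately have "card (?E (lnk T S)) \<le> card (?E ?U \<union> ?X)" by (intro card_mono)
  also have "\<dots> \<le> card (?E ?U) + card ?X" by (rule card_Un_le)
  finally show ?thesis by (auto simp: deg_eq split: if_splits)
qed

lemma deg_root_le: "shape T t \<Longrightarrow> deg T (root_of T) \<le> size (children t)"
proof (induction rule: shape.induct)
  case (shape_lnk T A S b)
  have "root_of T \<notin> vertices S" using shape_lnk(3) shape_root[OF shape_lnk(1)] by auto
  then show ?case using deg_lnk_le[OF shape_lnk(1-3), of "root_of T"] shape_lnk by auto
qed (simp add: deg_eq)

text \<open>The class of \<open>Des T v\<close> and the degree of \<open>v\<close> come from the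
  same \<open>s\<close>; the added 1 is the edge to the parent.\<close>

lemma shape_Des_nonroot:
  "shape T t \<Longrightarrow> v \<in> vertices T \<Longrightarrow> v \<noteq> root_of T \<Longrightarrow>
    \<exists>a\<in>#children t. \<exists>s\<in>subs a. shape (Des T v) s \<and> deg T v \<le> size (children s) + 1"
proof (induction arbitrary: v rule: shape.induct)
  case (shape_lnk T A S b)
  note lnk = shape_lnk(1-3)
  show ?case
  proof (cases "v \<in> vertices S")
    case True
    show ?thesis
    proof (cases "v = root_of S")
      case v: True
      then have "Des (lnk T S) v = S" using Des_lnk_right[OF lnk] True Des_root[OF shape_lnk(2)] by simp
      moreover have "deg (lnk T S) v \<le> size (children b) + 1"
        using deg_lnk_le[OF lnk, of v] v True deg_root_le[OF shape_lnk(2)] by simp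
      ultimately show ?thesis using shape_lnk(2) by (intro bexI[of _ b]) auto
    next
      case False
      then obtain a s where "a \<in># children b" "s \<in> subs a" "shape (Des S v) s" "deg S v \<le> size (children s) + 1"
        using shape_lnk.IH True by blast
      moreover have "s \<in> subs b" using calculation by (cases b) auto
      moreover have "deg (lnk T S) v \<le> deg S v"
        using deg_lnk_le[OF lnk, of v] True False shape_lnk.prems by (simp split: if_splits)
      ultimately show ?thesis using Des_lnk_right[OF lnk] True
        by (intro bexI[of _ b] bexI[of _ s]) auto
    qed
  next
    case False
    then have "v \<in> vertices T" "v \<noteq> root_of T" using shape_lnk.prems by auto
    from shape_lnk.IH(1)[OF this] obtain a s
      where "a \<in># A" "s \<in> subs a" "shape (Des T v) s" "deg T v \<le> size (children s) + 1"
      by auto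
    moreover have "deg (lnk T S) v \<le> deg T v"
      using deg_lnk_le[OF lnk, of v] False shape_lnk.prems shape_root[OF shape_lnk(2)]
      by (auto split: if_splits)
    ultimately show ?thesis using Des_lnk_left[OF lnk] False shape_lnk.prems
      by (intro bexI[of _ a] bexI[of _ s]) auto
  qed
qed simp

lemma shape_Des: "shape T t \<Longrightarrow> v \<in> vertices T \<Longrightarrow> \<exists>s\<in>subs t. shape (Des T v) s"
  using shape_Des_nonroot[of T t v] Des_root[of T t] by (cases "v = root_of T"; cases t) fastforce+

lemma shape_deg: "shape T t \<Longrightarrow> v \<in> vertices T \<Longrightarrow> \<exists>s\<in>subs t. deg T v \<le> size (children s) + 1"
  using shape_Des_nonroot[of T t v] deg_root_le[of T t]
  by (cases "v = root_of T"; cases t) (fastforce intro: le_SucI)+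

text \<open>A derivation of \<open>shape\<close> depends on the order of linking, whereas the family
  \<open>g\<close> is indexed by the actual neighbours of the root. This is the bridge from
  multisets back to vertices.\<close>

lemma shape_children:
  "shape T t \<Longrightarrow> \<exists>g. children t = image_mset g (mset_set {c. (root_of T, c) \<in> edges T}) \<and>
    (\<forall>c. (root_of T, c) \<in> edges T \<longrightarrow> shape (Des T c) (g c))"
proof (induction rule: shape.induct)
  case (shape_lnk T A S b)
  note lnk = shape_lnk(1-3)
  let ?C = "{c. (root_of T, c) \<in> edges T}"
  obtain g where g: "A = image_mset g (mset_set ?C)" "\<And>c. c \<in> ?C \<Longrightarrow> shape (Des T c) (g c)"
    using shape_lnk.IH by auto
  define g' where "g' = g(root_of S := b)"
  have C: "?C \<subseteq> vertices T" using shape_edges[OF shape_lnk(1)] by auto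
  then have fin: "finite ?C" using shape_finite[OF shape_lnk(1)] finite_subset by blast
  have s: "root_of S \<notin> vertices T" "root_of T \<notin> vertices S"
    using shape_root[OF shape_lnk(2)] shape_root[OF shape_lnk(1)] shape_lnk(3) by auto
  have eq: "{c. (root_of T, c) \<in> edges (lnk T S)} = insert (root_of S) ?C"
    using s shape_edges[OF shape_lnk(2)] by auto
  have "image_mset g' (mset_set ?C) = image_mset g (mset_set ?C)"
    using C s fin by (intro image_mset_cong) (auto simp: g'_def)
  then have "add_mset b A = image_mset g' (mset_set (insert (root_of S) ?C))"
    using fin s C g by (subst mset_set.insert) (auto simp: g'_def)
  moreover have "shape (Des (lnk T S) c) (g' c)" if c: "c \<in> insert (root_of S) ?C" for c
  proof (cases "c = root_of S")
    case True
    then show ?thesis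
      using Des_lnk_right[OF lnk, of c] shape_root[OF shape_lnk(2)] Des_root[OF shape_lnk(2)] shape_lnk(2)
      by (simp add: g'_def)
  next
    case False
    then have "c \<in> ?C" using c by simp
    moreover have "c \<noteq> root_of T" using shape_irrefl[OF shape_lnk(1)] calculation by auto
    moreover have "c \<notin> vertices S" using C calculation shape_lnk(3) by auto
    ultimately show ?thesis using Des_lnk_left[OF lnk, of c] g(2)[of c] False by (simp add: g'_def)
  qed
  ultimately show ?case unfolding lnk_simps(3) using eq by (intro exI[of _ g']) auto
qed simp

text \<open>Two derivations see the same children in the graph and, by induction, assign them the
  same classes.\<close>

theorem shape_unique: "shape T t \<Longrightarrow> shape T t' \<Longrightarrow> t = t'"
proof (induction t arbitrary: T t')
  case (Node A)
  obtain A' where A': "t' = Node A'" by (cases t')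
  let ?C = "{c. (root_of T, c) \<in> edges T}"
  obtain g where g: "A = image_mset g (mset_set ?C)" "\<And>c. c \<in> ?C \<Longrightarrow> shape (Des T c) (g c)"
    using shape_children[OF Node.prems(1)] by auto
  obtain g' where g': "A' = image_mset g' (mset_set ?C)" "\<And>c. c \<in> ?C \<Longrightarrow> shape (Des T c) (g' c)"
    using shape_children[OF Node.prems(2)] A' by auto
  have "?C \<subseteq> vertices T" using shape_edges[OF Node.prems(1)] by auto
  then have fin: "finite ?C" using shape_finite[OF Node.prems(1)] finite_subset by blast
  have "g c = g' c" if "c \<in> ?C" for c
    using that fin g g' by (intro Node.IH[of "g c" "Des T c"]) auto
  then show ?case using g(1) g'(1) A' fin by (auto intro: image_mset_cong)
qed

lemma is_parent_in_Des:
  assumes T: "shape T t" and "is_parent T w v"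
  shows "w \<in> vertices T" "(w, v) \<in> edges (Des T w)" "v \<in> descendants T w"
  using assms shape_edges[OF T] self_descendant[OF T, of w] by (auto simp: is_parent_def)

lemma is_parent_root: "shape T t \<Longrightarrow> is_parent T (root_of T) c \<longleftrightarrow> (root_of T, c) \<in> edges T"
  using descendants_root[of T t] shape_edges[of T t] by (auto simp: is_parent_def)

text \<open>Subtrees at different vertices may be isomorphic, so \<open>a = b\<close> is possible;
  they still are two separate elements of the multiset of children.\<close>

lemma siblings_shape:
  assumes T: "shape T t" and v: "is_parent T w v" and v': "is_parent T w v'" and ne: "v \<noteq> v'"
  shows "\<exists>a b A. Node (add_mset a (add_mset b A)) \<in> subs t \<and> shape (Des T v) a \<and> shape (Des T v') b"
proof -
  note p = is_parent_in_Des[OF T v] and p' = is_parent_in_Des[OF T v']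
  obtain s where s: "s \<in> subs t" "shape (Des T w) s" using shape_Des[OF T p(1)] by blast
  obtain B where B: "s = Node B" by (cases s)
  let ?C = "{c. (w, c) \<in> edges (Des T w)}"
  obtain g where g: "B = image_mset g (mset_set ?C)" "\<And>c. c \<in> ?C \<Longrightarrow> shape (Des (Des T w) c) (g c)"
    using shape_children[OF s(2)] B by auto
  have "?C \<subseteq> vertices (Des T w)" using shape_edges[OF s(2)] by auto
  then have fin: "finite ?C" using shape_finite[OF s(2)] finite_subset by blast
  have "?C = insert v (insert v' (?C - {v, v'}))" using p p' by auto
  then have "mset_set ?C = add_mset v (add_mset v' (mset_set (?C - {v, v'})))"
    using fin ne by (metis (no_types, lifting) Diff_iff finite_Diff finite_insert insertE insertI1
        insert_iff mset_set.insert)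
  then have "Node (add_mset (g v) (add_mset (g v') (image_mset g (mset_set (?C - {v, v'}))))) \<in> subs t"
    using s B g(1) by simp
  moreover have "shape (Des T v) (g v)" using g(2)[of v] p Des_Des[OF T p(1) p(3)] by simp
  moreover have "shape (Des T v') (g v')" using g(2)[of v'] p' Des_Des[OF T p'(1) p'(3)] by simp
  ultimately show ?thesis by blast
qed

subsection \<open>Isomorphism\<close>

definition relabel :: "('a \<Rightarrow> 'b) \<Rightarrow> 'a rooted \<Rightarrow> 'b rooted" where
  "relabel f T = (\<lparr>pverts = f ` vertices T, parcs = map_prod f f ` edges T\<rparr>, f (root_of T))"

lemma relabel_simps [simp]: "vertices (relabel f T) = f ` vertices T"
  "edges (relabel f T) = map_prod f f ` edges T" "root_of (relabel f T) = f (root_of T)"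
  by (auto simp: relabel_def)

text \<open>Arcs are pairs with the projections as tail and head, so the arc map of a library
  isomorphism is forced by its vertex map.\<close>

lemma rooted_isoE:
  assumes "rooted_iso T T'"
  obtains f where "inj_on f (vertices T)" "T' = relabel f T"
proof -
  obtain h where h: "pre_digraph.digraph_isomorphism (with_proj (graph_of T)) h"
    "with_proj (graph_of T') = app_iso h (with_proj (graph_of T))" "iso_verts h (root_of T) = root_of T'"
    using assms by (auto simp: rooted_iso_def)
  let ?f = "iso_verts h"
  have inj: "inj_on ?f (vertices T)"
    using h(1) by (simp add: pre_digraph.digraph_isomorphism_def)
  have V: "vertices T' = ?f ` vertices T" using arg_cong[OF h(2), of verts] by simp
  have E: "edges T' = iso_arcs h ` edges T" using arg_cong[OF h(2), of arcs] by simp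
  have t: "iso_tail h = fst" using arg_cong[OF h(2), of tail] by simp
  have hd: "iso_head h = snd" using arg_cong[OF h(2), of head] by simp
  have "iso_arcs h e = map_prod ?f ?f e" if "e \<in> edges T" for e
    using h(1) that t hd by (cases e) (auto simp: pre_digraph.digraph_isomorphism_def prod_eq_iff)
  then have "edges T' = map_prod ?f ?f ` edges T" unfolding E by (intro image_cong) auto
  then have "T' = relabel ?f T" using V h(3) by (intro rooted_eqI) auto
  then show thesis using inj that by blast
qed

lemma graph_iso_relabel:
  assumes "edges T \<subseteq> vertices T \<times> vertices T" "inj_on f (vertices T)"
  shows "\<exists>h. pre_digraph.digraph_isomorphism (with_proj (graph_of T)) h \<and>
    with_proj (graph_of (relabel f T)) = app_iso h (with_proj (graph_of T)) \<and> iso_verts h = f"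
proof -
  let ?h = "\<lparr>iso_verts = f, iso_arcs = map_prod f f, iso_head = snd, iso_tail = fst\<rparr>"
  have "wf_digraph (with_proj (graph_of T))"
    using assms(1) by unfold_locales auto
  moreover have "inj_on (map_prod f f) (edges T)"
    using assms map_prod_inj_on[OF assms(2) assms(2)] inj_on_subset by blast
  ultimately have "pre_digraph.digraph_isomorphism (with_proj (graph_of T)) ?h"
    using assms by (simp add: pre_digraph.digraph_isomorphism_def)
  moreover have "with_proj (graph_of (relabel f T)) = app_iso ?h (with_proj (graph_of T))"
    by (simp add: with_proj_def app_iso_def relabel_def)
  ultimately show ?thesis by (intro exI[of _ ?h]) simp
qed

lemma rooted_isoI:
  assumes "edges T \<subseteq> vertices T \<times> vertices T" "inj_on f (vertices T)"
  shows "rooted_iso T (relabel f T)"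
proof -
  obtain h where "pre_digraph.digraph_isomorphism (with_proj (graph_of T)) h"
    "with_proj (graph_of (relabel f T)) = app_iso h (with_proj (graph_of T))" "iso_verts h = f"
    using graph_iso_relabel[OF assms] by blast
  then show ?thesis unfolding rooted_iso_def relabel_simps by blast
qed

lemma shape_relabel: "shape T t \<Longrightarrow> inj_on f (vertices T) \<Longrightarrow> shape (relabel f T) t"
proof (induction rule: shape.induct)
  case (shape_sing r)
  have "relabel f (sing r) = sing (f r)" by (intro rooted_eqI) auto
  then show ?case by (simp add: shape.shape_sing)
next
  case (shape_lnk T A S b)
  have "relabel f (lnk T S) = lnk (relabel f T) (relabel f S)"
    by (intro rooted_eqI) (auto simp: image_Un)
  moreover have "inj_on f (vertices T)" "inj_on f (vertices S)"
    using shape_lnk.prems by (auto simp: inj_on_Un)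
  moreover have "f ` vertices T \<inter> f ` vertices S = {}"
    using shape_lnk.prems shape_lnk.hyps inj_on_image_Int[of f "vertices T \<union> vertices S" "vertices T" "vertices S"]
    by auto
  ultimately show ?case using shape_lnk.IH by (simp add: shape.shape_lnk)
qed

lemma shape_leaf_inv: "shape T (Node {#}) \<Longrightarrow> T = sing (root_of T)"
  by (erule shape.cases) simp_all

lemma shape_add_inv:
  assumes "shape T (Node (add_mset b A))"
  shows "\<exists>U S. T = lnk U S \<and> shape U (Node A) \<and> shape S b \<and> vertices U \<inter> vertices S = {}"
  using assms
proof (induction T "Node (add_mset b A)" arbitrary: A rule: shape.induct)
  case (shape_lnk T A' S b')
  then consider "b = b'" "A = A'" | K where "A' = add_mset b K" "A = add_mset b' K"
    by (auto simp: add_eq_conv_ex)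
  then show ?case
  proof cases
    case 1
    then show ?thesis using shape_lnk.hyps by (intro exI[of _ T] exI[of _ S]) simp
  next
    case 2
    then obtain U S' where *: "T = lnk U S'" "shape U (Node K)" "shape S' b" "vertices U \<inter> vertices S' = {}"
      using shape_lnk(2) by blast
    have "lnk T S = lnk (lnk U S) S'" unfolding * by (intro rooted_eqI) auto
    moreover have "shape (lnk U S) (Node A)"
      unfolding 2 using * shape_lnk by (intro shape.shape_lnk) auto
    moreover have "vertices (lnk U S) \<inter> vertices S' = {}" using * shape_lnk by auto
    ultimately show ?thesis using *(3) by blast
  qed
qed (metis empty_not_add_mset)

text \<open>By \<open>shape_add_inv\<close> both graphs can be split along the same class
  \<open>b\<close>; the bijections of the two parts then combine, their domains and ranges being
  disjoint.\<close>

lemma shape_imp_relabel: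
  "shape T t \<Longrightarrow> shape T' t \<Longrightarrow> \<exists>f. inj_on f (vertices T) \<and> T' = relabel f T"
proof (induction t arbitrary: T T' rule: utree_link_induct)
  case leaf
  obtain r r' where T: "T = sing r" and T': "T' = sing r'"
    using shape_leaf_inv[OF leaf(1)] shape_leaf_inv[OF leaf(2)] by blast
  have "T' = relabel (\<lambda>_. r') T" unfolding T T' by (intro rooted_eqI) auto
  then show ?case unfolding T by (intro exI[of _ "\<lambda>_. r'"]) simp
next
  case (link A b)
  obtain U S where T: "T = lnk U S" "shape U (Node A)" "shape S b" "vertices U \<inter> vertices S = {}"
    using shape_add_inv[OF link.prems(1)] by blast
  obtain U' S' where T': "T' = lnk U' S'" "shape U' (Node A)" "shape S' b" "vertices U' \<inter> vertices S' = {}"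
    using shape_add_inv[OF link.prems(2)] by blast
  obtain f where f: "inj_on f (vertices U)" "U' = relabel f U" using link.IH(1) T T' by blast
  obtain g where g: "inj_on g (vertices S)" "S' = relabel g S" using link.IH(2) T T' by blast
  define h where "h x = (if x \<in> vertices S then g x else f x)" for x
  have hf: "h x = f x" if "x \<in> vertices U" for x using that T(4) by (auto simp: h_def)
  have hg: "h x = g x" if "x \<in> vertices S" for x using that by (auto simp: h_def)
  have 1: "h ` vertices U = f ` vertices U" "h ` vertices S = g ` vertices S"
    using hf hg by auto
  have 2: "map_prod h h ` edges U = map_prod f f ` edges U" "map_prod h h ` edges S = map_prod g g ` edges S"
    using shape_edges[OF T(2)] shape_edges[OF T(3)] hf hg by (auto intro!: image_cong)
  have 3: "h (root_of U) = f (root_of U)" "h (root_of S) = g (root_of S)"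
    using hf[OF shape_root[OF T(2)]] hg[OF shape_root[OF T(3)]] .
  have "T' = relabel h T"
    using 1 2 3 unfolding T T' f g by (intro rooted_eqI) (auto simp: image_Un)
  moreover have "inj_on h (vertices T)"
  proof -
    have "inj_on h (vertices U)" "inj_on h (vertices S)"
      using f(1) g(1) hf hg by (auto simp: inj_on_def)
    moreover have "h ` vertices U \<inter> h ` vertices S = {}" using 1 T'(4) f g by simp
    ultimately show ?thesis unfolding T by (auto simp: inj_on_Un)
  qed
  ultimately show ?case by blast
qed

lemma rooted_iso_shape_iff:
  assumes "shape T t" "shape T' t'"
  shows "rooted_iso T T' \<longleftrightarrow> t = t'"
proof
  assume "rooted_iso T T'"
  then obtain f where "inj_on f (vertices T)" "T' = relabel f T" by (rule rooted_isoE)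
  then show "t = t'" using shape_relabel[OF assms(1)] shape_unique assms(2) by blast
next
  assume "t = t'"
  then show "rooted_iso T T'" using shape_imp_relabel assms rooted_isoI shape_edges by blast
qed

lemma shape_exists: "finite X \<Longrightarrow> card X = tsize t \<Longrightarrow> \<exists>T. vertices T = X \<and> shape T t"
proof (induction t arbitrary: X rule: utree_link_induct)
  case leaf
  then obtain r where "X = {r}" by (auto simp: card_1_singleton_iff)
  then show ?case by (intro exI[of _ "sing r"]) (simp add: shape.shape_sing)
next
  case (link A b)
  obtain Y where Y: "Y \<subseteq> X" "card Y = tsize b"
    using link.prems by (metis le_add2 obtain_subset_with_card_n tsize_add)
  then have "card (X - Y) = tsize (Node A)"
    using link.prems by (simp add: card_Diff_subset finite_subset)
  then obtain T where T: "vertices T = X - Y" "shape T (Node A)" using link by blast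
  obtain S where S: "vertices S = Y" "shape S b" using link Y finite_subset by blast
  have "shape (lnk T S) (Node (add_mset b A))" using T S by (intro shape.shape_lnk) auto
  moreover have "vertices (lnk T S) = X" using T S Y by auto
  ultimately show ?case by blast
qed

subsection \<open>Every tree has a shape\<close>

text \<open>An undirected cycle, listed without repeating its first vertex; hence the separate
  closing edge.\<close>

definition ring :: "'a rel \<Rightarrow> 'a list \<Rightarrow> bool" where
  "ring E ws \<longleftrightarrow> distinct ws \<and> length ws \<ge> 3 \<and> set (vwalk_arcs ws) \<subseteq> E \<and> (last ws, hd ws) \<in> E"

lemma vwalk_arcs_append:
  assumes "ys \<noteq> []"
  shows "xs \<noteq> [] \<Longrightarrow> vwalk_arcs (xs @ ys) = vwalk_arcs xs @ (last xs, hd ys) # vwalk_arcs ys"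
proof (induction xs)
  case (Cons x xs)
  show ?case
  proof (cases "xs = []")
    case True
    then show ?thesis using vwalk_arcs_Cons[OF assms, of x] by (simp only: append.simps vwalk_arcs.simps last.simps simp_thms if_True)
  next
    case False
    have "xs @ ys \<noteq> []" using False by blast
    have "vwalk_arcs ((x # xs) @ ys) = (x, hd (xs @ ys)) # vwalk_arcs (xs @ ys)"
      using vwalk_arcs_Cons[OF \<open>xs @ ys \<noteq> []\<close>] by (simp only: append.simps)
    also have "\<dots> = (x, hd xs) # vwalk_arcs xs @ (last xs, hd ys) # vwalk_arcs ys"
      unfolding Cons.IH[OF False] hd_append2[OF False] ..
    also have "\<dots> = vwalk_arcs (x # xs) @ (last (x # xs), hd ys) # vwalk_arcs ys"
      using vwalk_arcs_Cons[OF False, of x] False by (simp only: append.simps last.simps if_False)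
    finally show ?thesis .
  qed
qed blast

lemma ring_rotate: "ring E (xs @ ys) \<Longrightarrow> ring E (ys @ xs)"
  by (cases "xs = []"; cases "ys = []") (auto simp: ring_def vwalk_arcs_append)

text \<open>At a deepest vertex of a ring neither neighbour is deeper, so the two coincide; but a
  ring has at least three distinct vertices.\<close>

lemma no_ring_if_depth:
  fixes d :: "'a \<Rightarrow> nat"
  assumes E: "sym E" and d: "\<And>v w w'. (v, w) \<in> E \<Longrightarrow> (v, w') \<in> E \<Longrightarrow> d w \<le> d v \<Longrightarrow> d w' \<le> d v \<Longrightarrow> w = w'"
  shows "\<not> ring E ws"
proof
  assume ring: "ring E ws"
  then have "d ` set ws \<noteq> {}" by (auto simp: ring_def)
  then have "Max (d ` set ws) \<in> d ` set ws" by (intro Max_in) auto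
  then obtain x where x: "x \<in> set ws" "d x = Max (d ` set ws)" by auto
  then have max: "\<And>y. y \<in> set ws \<Longrightarrow> d y \<le> d x" by simp
  obtain xs ys where ws: "ws = xs @ x # ys" using x by (meson split_list)
  then have "ring E (x # ys @ xs)" using ring ring_rotate[of E xs "x # ys"] by simp
  moreover obtain y zs where yz: "ys @ xs = y # zs" using calculation by (cases "ys @ xs") (auto simp: ring_def)
  ultimately have r: "ring E (x # y # zs)" by simp
  then have zs: "zs \<noteq> []" by (auto simp: ring_def)
  then have "last zs \<in> set zs" by simp
  have "(x, y) \<in> E" "(x, last zs) \<in> E" using r zs E by (auto simp: ring_def dest: symD)
  moreover have "y \<in> set ws" "last zs \<in> set ws"
    using yz ws \<open>last zs \<in> set zs\<close> by (metis Un_iff list.set_intros set_append set_subset_Cons subsetD)+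
  ultimately have "y = last zs" using d max by blast
  then show False using r \<open>last zs \<in> set zs\<close> by (auto simp: ring_def)
qed

text \<open>Keeps of the distance from the root only what excludes cycles: a vertex has at most one
  neighbour that is not deeper. Positivity away from the root carries the induction over
  links.\<close>

definition is_depth :: "'a rooted \<Rightarrow> ('a \<Rightarrow> nat) \<Rightarrow> bool" where
  "is_depth T d \<longleftrightarrow> d (root_of T) = 0 \<and> (\<forall>v\<in>vertices T. v \<noteq> root_of T \<longrightarrow> 0 < d v) \<and>
    (\<forall>v w w'. (v, w) \<in> edges T \<longrightarrow> (v, w') \<in> edges T \<longrightarrow> d w \<le> d v \<longrightarrow> d w' \<le> d v \<longrightarrow> w = w')"

lemma shape_depth: "shape T t \<Longrightarrow> \<exists>d. is_depth T d"
proof (induction rule: shape.induct)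
  case (shape_sing r)
  then show ?case by (intro exI[of _ "\<lambda>_. 0"]) (auto simp: is_depth_def)
next
  case (shape_lnk T A S b)
  obtain d1 where D1: "is_depth T d1" using shape_lnk.IH(1) by (rule exE)
  obtain d2 where D2: "is_depth S d2" using shape_lnk.IH(2) by (rule exE)
  have d1: "d1 (root_of T) = 0" "\<And>v. v \<in> vertices T \<Longrightarrow> v \<noteq> root_of T \<Longrightarrow> 0 < d1 v"
    "\<And>v w w'. (v, w) \<in> edges T \<Longrightarrow> (v, w') \<in> edges T \<Longrightarrow> d1 w \<le> d1 v \<Longrightarrow> d1 w' \<le> d1 v \<Longrightarrow> w = w'"
    using D1 unfolding is_depth_def by blast+
  have d2: "d2 (root_of S) = 0" "\<And>v. v \<in> vertices S \<Longrightarrow> v \<noteq> root_of S \<Longrightarrow> 0 < d2 v"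
    "\<And>v w w'. (v, w) \<in> edges S \<Longrightarrow> (v, w') \<in> edges S \<Longrightarrow> d2 w \<le> d2 v \<Longrightarrow> d2 w' \<le> d2 v \<Longrightarrow> w = w'"
    using D2 unfolding is_depth_def by blast+
  define d where "d v = (if v \<in> vertices S then Suc (d2 v) else d1 v)" for v
  note T = shape_root[OF shape_lnk(1)] shape_edges[OF shape_lnk(1)]
    and S = shape_root[OF shape_lnk(2)] shape_edges[OF shape_lnk(2)]
  have disj: "v \<notin> vertices S" if "v \<in> vertices T" for v using that shape_lnk(3) by auto
  have dT: "d v = d1 v" if "v \<in> vertices T" for v using disj[OF that] by (simp add: d_def)
  have dS: "d v = Suc (d2 v)" if "v \<in> vertices S" for v using that by (simp add: d_def)
  have r0: "d (root_of T) = 0" using dT T d1 by simp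
  have lower: "(v \<in> vertices T \<and> v \<noteq> root_of T \<and> (v, w) \<in> edges T \<and> d1 w \<le> d1 v) \<or>
      (v = root_of S \<and> w = root_of T) \<or> (v \<in> vertices S \<and> v \<noteq> root_of S \<and> (v, w) \<in> edges S \<and> d2 w \<le> d2 v)"
    if e: "(v, w) \<in> edges (lnk T S)" and le: "d w \<le> d v" for v w
  proof -
    consider "(v, w) \<in> edges T" | "(v, w) \<in> edges S" | "v = root_of T" "w = root_of S" | "v = root_of S" "w = root_of T"
      using e by auto
    then show ?thesis
    proof cases
      case 1
      then have vw: "v \<in> vertices T" "w \<in> vertices T" using T by auto
      have "v \<noteq> root_of T"
        using 1 vw le d1(2)[OF vw(2)] shape_irrefl[OF shape_lnk(1)] dT d1(1) by fastforce
      then show ?thesis using 1 vw le dT by simp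
    next
      case 2
      then have vw: "v \<in> vertices S" "w \<in> vertices S" using S by auto
      have "v \<noteq> root_of S"
        using 2 vw le d2(2)[OF vw(2)] shape_irrefl[OF shape_lnk(2)] dS d2(1) by fastforce
      then show ?thesis using 2 vw le dS by simp
    next
      case 3
      then show ?thesis using le r0 dS S by simp
    qed auto
  qed
  show ?case
    unfolding is_depth_def
  proof (intro exI[of _ d] conjI ballI allI impI)
    show "d (root_of (lnk T S)) = 0" using r0 by simp
    show "0 < d v" if "v \<in> vertices (lnk T S)" "v \<noteq> root_of (lnk T S)" for v
      using that d1(2)[of v] dT[of v] dS[of v] by (cases "v \<in> vertices S") auto
    show "w = w'" if "(v, w) \<in> edges (lnk T S)" "(v, w') \<in> edges (lnk T S)" "d w \<le> d v" "d w' \<le> d v" for v w w'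
      using lower[OF that(1,3)] lower[OF that(2,4)] d1(3)[of v w w'] d2(3)[of v w w'] disj[of v] S(1) by metis
  qed
qed

lemma shape_no_ring:
  assumes "shape T t" shows "\<not> ring (edges T) ws"
proof -
  obtain d where d: "is_depth T d" using shape_depth[OF assms] ..
  show ?thesis
  proof (rule no_ring_if_depth[OF shape_sym[OF assms]])
    fix v w w' assume "(v, w) \<in> edges T" "(v, w') \<in> edges T" "d w \<le> d v" "d w' \<le> d v"
    then show "w = w'" using d[unfolded is_depth_def] by blast
  qed
qed

lemma rtrancl_imp_walk:
  assumes "(u, v) \<in> R\<^sup>*"
  shows "\<exists>p. p \<noteq> [] \<and> distinct p \<and> hd p = u \<and> last p = v \<and> set (vwalk_arcs p) \<subseteq> R"
  using assms
proof (induction rule: converse_rtrancl_induct)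
  case base
  show ?case by (intro exI[of _ "[v]"]) auto
next
  case (step u w)
  then obtain p where p: "p \<noteq> []" "distinct p" "hd p = w" "last p = v" "set (vwalk_arcs p) \<subseteq> R" by blast
  show ?case
  proof (cases "u \<in> set p")
    case True
    then obtain as bs where "p = as @ u # bs" by (meson split_list)
    then show ?thesis using p
      by (intro exI[of _ "u # bs"]) (cases "as = []"; auto simp: vwalk_arcs_append)
  next
    case False
    then show ?thesis using p step by (intro exI[of _ "u # p"]) (auto simp: vwalk_arcs_Cons)
  qed
qed

definition gtree :: "'a rooted \<Rightarrow> bool" where
  "gtree T \<longleftrightarrow> finite (vertices T) \<and> root_of T \<in> vertices T \<and> edges T \<subseteq> vertices T \<times> vertices T \<and>
     sym (edges T) \<and> irrefl (edges T) \<and> (\<forall>v\<in>vertices T. (root_of T, v) \<in> (edges T)\<^sup>*) \<and>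
     (\<forall>ws. \<not> ring (edges T) ws)"

lemma ring_mono: "ring E ws \<Longrightarrow> E \<subseteq> F \<Longrightarrow> ring F ws"
  by (auto simp: ring_def)

text \<open>Deleting an edge at the root separates the component of the child from the rest. Both
  are smaller trees, and linking them restores \<open>T\<close>.\<close>

lemma gtree_shape: "gtree T \<Longrightarrow> \<exists>t. shape T t"
proof (induction "card (vertices T)" arbitrary: T rule: less_induct)
  case less
  let ?V = "vertices T" and ?E = "edges T" and ?r = "root_of T"
  have fin: "finite ?V" and r: "?r \<in> ?V" and E: "?E \<subseteq> ?V \<times> ?V" and sym: "sym ?E"
    and irr: "\<And>v. (v, v) \<notin> ?E" and reach: "\<And>v. v \<in> ?V \<Longrightarrow> (?r, v) \<in> ?E\<^sup>*" and nr: "\<And>ws. \<not> ring ?E ws"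
    using less.prems unfolding gtree_def irrefl_def by blast+
  show ?case
  proof (cases "\<exists>s. (?r, s) \<in> ?E")
    case False
    then have "v = ?r" if "v \<in> ?V" for v
      using reach[OF that] by (auto elim: converse_rtranclE)
    then have V: "?V = {?r}" using r by blast
    then have "?E = {}" using E False by auto
    then have "T = sing ?r" using V by (intro rooted_eqI) simp_all
    then show ?thesis using shape.shape_sing by metis
  next
    case True
    then obtain s where s: "(?r, s) \<in> ?E" by blast
    define H where "H = ?E - {(?r, s), (s, ?r)}"
    define B where "B = {v. (s, v) \<in> H\<^sup>*}"
    define A where "A = ?V - B"
    have symH: "sym H" using sym by (auto simp: H_def sym_def)
    have sne: "s \<noteq> ?r" using s irr by auto
    have sr: "(s, ?r) \<in> ?E" using s sym by (auto dest: symD)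
    \<comment> \<open>A path from \<open>s\<close> back to the root that avoids the deleted edge
      would form a ring with it. It has at least three vertices, because on two vertices it would be
      the deleted edge itself.\<close>
    have rB: "?r \<notin> B"
    proof
      assume "?r \<in> B"
      then obtain p where p: "p \<noteq> []" "distinct p" "hd p = s" "last p = ?r" "set (vwalk_arcs p) \<subseteq> H"
        using rtrancl_imp_walk[of s ?r H] by (auto simp: B_def)
      have "length p \<ge> 3"
      proof (rule ccontr)
        assume "\<not> length p \<ge> 3"
        moreover have "length p \<noteq> 0" using p(1) by simp
        ultimately have "length p = 1 \<or> length p = 2" by linarith
        then consider x where "p = [x]" | x y where "p = [x, y]"
          by (auto simp: length_Suc_conv numeral_2_eq_2)
        then show False using p sne by cases (auto simp: H_def)
      qed
      then have "ring ?E p" using p s by (auto simp: ring_def H_def)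
      then show False using nr by blast
    qed
    have BV: "B \<subseteq> ?V"
    proof
      fix v assume "v \<in> B"
      then have "(s, v) \<in> H\<^sup>*" by (simp add: B_def)
      then show "v \<in> ?V" by (cases rule: rtranclE) (use E s in \<open>auto simp: H_def\<close>)
    qed
    have Hcl: "y \<in> B" if "x \<in> B" "(x, y) \<in> H" for x y
      using that by (auto simp: B_def)
    have Hcl': "x \<in> B" if "y \<in> B" "(x, y) \<in> H" for x y
      using that Hcl symH by (meson symD)
    have sB: "s \<in> B" by (simp add: B_def)
    define TB where "TB = (\<lparr>pverts = B, parcs = ?E \<inter> B \<times> B\<rparr>, s)"
    define TA where "TA = (\<lparr>pverts = A, parcs = ?E \<inter> A \<times> A\<rparr>, ?r)"
    have "gtree TB"
    proof -
      have "(s, v) \<in> (?E \<inter> B \<times> B)\<^sup>*" if "(s, v) \<in> H\<^sup>*" for v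
        using that
      proof (induction rule: rtrancl_induct)
        case (step y z)
        have "y \<in> B" using step by (simp add: B_def)
        then have "(y, z) \<in> ?E \<inter> B \<times> B" using step Hcl by (auto simp: H_def)
        then show ?case using step by (meson rtrancl.rtrancl_into_rtrancl)
      qed simp
      then have "\<forall>v\<in>B. (s, v) \<in> (?E \<inter> B \<times> B)\<^sup>*" by (simp add: B_def)
      moreover have "\<not> ring (?E \<inter> B \<times> B) ws" for ws
        using nr ring_mono[of "?E \<inter> B \<times> B" ws ?E] by blast
      moreover have "sym (?E \<inter> B \<times> B)" using sym by (auto simp: sym_def)
      ultimately show ?thesis
        using finite_subset[OF BV fin] sB irr by (simp add: gtree_def TB_def irrefl_def)
    qed
    moreover have "gtree TA"
    proof -
      have "v \<in> A \<longrightarrow> (?r, v) \<in> (?E \<inter> A \<times> A)\<^sup>*" if "(?r, v) \<in> ?E\<^sup>*" for v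
        using that
      proof (induction rule: rtrancl_induct)
        case (step y z)
        show ?case
        proof
          assume z: "z \<in> A"
          show "(?r, z) \<in> (?E \<inter> A \<times> A)\<^sup>*"
          proof (cases "y \<in> B")
            case True
            \<comment> \<open>The only edge leaving \<open>B\<close> is the deleted one, so a walk
              re-enters \<open>A\<close> at the root and may be restarted there.\<close>
            then have "z = ?r" using step z Hcl[of y z] rB by (auto simp: H_def A_def)
            then show ?thesis by simp
          next
            case False
            then have "y \<in> A" using step E by (auto simp: A_def)
            then show ?thesis using step z by (meson IntI SigmaI rtrancl.rtrancl_into_rtrancl)
          qed
        qed
      qed simp
      then have "\<forall>v\<in>A. (?r, v) \<in> (?E \<inter> A \<times> A)\<^sup>*" using reach by (simp add: A_def)
      moreover have "\<not> ring (?E \<inter> A \<times> A) ws" for ws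
        using nr ring_mono[of "?E \<inter> A \<times> A" ws ?E] by blast
      moreover have "sym (?E \<inter> A \<times> A)" using sym by (auto simp: sym_def)
      moreover have "finite A" "?r \<in> A" using fin r rB by (simp_all add: A_def)
      ultimately show ?thesis using irr by (simp add: gtree_def TA_def irrefl_def)
    qed
    moreover have "card B < card ?V" using BV r rB fin by (intro psubset_card_mono) auto
    moreover have "card A < card ?V"
      using BV sB fin by (intro psubset_card_mono) (auto simp: A_def)
    ultimately obtain a b where ab: "shape TA a" "shape TB b"
      using less.hyps[of TA] less.hyps[of TB] by (auto simp: TA_def TB_def)
    have "?E \<subseteq> ?E \<inter> A \<times> A \<union> ?E \<inter> B \<times> B \<union> {(?r, s), (s, ?r)}"
    proof (rule subrelI)
      fix x y assume xy: "(x, y) \<in> ?E"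
      then have V: "x \<in> ?V" "y \<in> ?V" using E by auto
      have "x \<in> B \<longleftrightarrow> y \<in> B" if "(x, y) \<in> H" using that Hcl Hcl' by blast
      then show "(x, y) \<in> ?E \<inter> A \<times> A \<union> ?E \<inter> B \<times> B \<union> {(?r, s), (s, ?r)}"
        using xy V unfolding H_def A_def by blast
    qed
    then have E_eq: "?E \<inter> A \<times> A \<union> ?E \<inter> B \<times> B \<union> {(?r, s), (s, ?r)} = ?E" using s sr by blast
    have "A \<union> B = ?V" using BV by (auto simp: A_def)
    then have "T = lnk TA TB" using E_eq by (intro rooted_eqI) (simp_all add: TA_def TB_def)
    moreover have "vertices TA \<inter> vertices TB = {}" by (auto simp: TA_def TB_def A_def)
    ultimately show ?thesis using shape.shape_lnk[of TA "children a" TB b] ab by (cases a) auto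
  qed
qed

section \<open>Translation of the library's connectedness and cycles\<close>

lemma connected_iff:
  assumes "pair_graph G"
  shows "Digraph_Component.connected (with_proj G) \<longleftrightarrow>
    pverts G \<noteq> {} \<and> (\<forall>u\<in>pverts G. \<forall>v\<in>pverts G. (u, v) \<in> (parcs G)\<^sup>*)"
proof -
  interpret pair_graph G by fact
  have "mk_symmetric (with_proj G) = G"
    by (intro pair_pre_digraph.equality)
      (auto simp: parcs_mk_symmetric dest: arcs_symmetric intro: rev_bexI)
  then show ?thesis
    by (auto simp: Digraph_Component.connected_def strongly_connected_def reachable_conv)
qed

lemma pawalk_verts_neq_Nil: "pawalk_verts u p \<noteq> []"
  by (cases p) auto

lemma closed_walk_arcs:
  "pcas u p v \<Longrightarrow> p = vwalk_arcs (pawalk_verts u p) \<and> last (pawalk_verts u p) = v \<and> hd (pawalk_verts u p) = u"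
  by (induction p arbitrary: u) (auto simp: vwalk_arcs_Cons pawalk_verts_neq_Nil)

lemma pair_graph_iff:
  "pair_graph G \<longleftrightarrow> finite (pverts G) \<and> parcs G \<subseteq> pverts G \<times> pverts G \<and> sym (parcs G) \<and> irrefl (parcs G)"
proof
  assume "pair_graph G"
  then interpret pair_graph G .
  have "(x, x) \<notin> parcs G" for x using no_loops'[of x x] by blast
  then show "finite (pverts G) \<and> parcs G \<subseteq> pverts G \<times> pverts G \<and> sym (parcs G) \<and> irrefl (parcs G)"
    using pair_finite_verts in_arcsD1 in_arcsD2 arcs_symmetric by (auto simp: sym_def irrefl_def)
next
  assume G: "finite (pverts G) \<and> parcs G \<subseteq> pverts G \<times> pverts G \<and> sym (parcs G) \<and> irrefl (parcs G)"
  then have "finite (parcs G)" using finite_subset by blast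
  with G show "pair_graph G" by unfold_locales (auto simp: symmetric_def irrefl_def)
qed

lemma length_vwalk_arcs: "length (vwalk_arcs ws) = length ws - 1"
  by (induction ws rule: vwalk_arcs.induct) auto

lemma walk_of_vwalk:
  "ws \<noteq> [] \<Longrightarrow> pcas (hd ws) (vwalk_arcs ws) (last ws) \<and> pawalk_verts (hd ws) (vwalk_arcs ws) = ws"
  by (induction ws rule: vwalk_arcs.induct) auto

lemma cycle_iff_ring:
  assumes "parcs G \<subseteq> pverts G \<times> pverts G"
  shows "(\<exists>p. pre_digraph.cycle (with_proj G) p \<and> length p \<ge> 3) \<longleftrightarrow> (\<exists>ws. ring (parcs G) ws)"
proof
  assume "\<exists>p. pre_digraph.cycle (with_proj G) p \<and> length p \<ge> 3"
  then obtain p u where p: "length p \<ge> 3" "set p \<subseteq> parcs G" "pcas u p u" "distinct (tl (pawalk_verts u p))"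
    by (auto simp: pre_digraph.cycle_def pre_digraph.awalk_def cas_with_proj_eq awalk_verts_with_proj_eq)
  \<comment> \<open>The vertex list of a closed walk has the starting vertex at both ends; dropping
    the first entry removes the repetition.\<close>
  define ws where "ws = tl (pawalk_verts u p)"
  have vs: "pawalk_verts u p = u # ws"
    using closed_walk_arcs[OF p(3)] pawalk_verts_neq_Nil[of u p] unfolding ws_def
    by (metis list.exhaust_sel)
  have dist: "distinct ws" using p(4) by (simp add: ws_def)
  have p_eq: "p = vwalk_arcs (u # ws)" and last: "last (u # ws) = u"
    using closed_walk_arcs[OF p(3)] vs by auto
  have len: "length ws \<ge> 3" using p(1) p_eq length_vwalk_arcs[of "u # ws"] by simp
  then have ws: "ws \<noteq> []" by auto
  then have "p = (u, hd ws) # vwalk_arcs ws" using p_eq vwalk_arcs_Cons by metis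
  then have "ring (parcs G) ws"
    using p(2) dist len last ws by (auto simp: ring_def)
  then show "\<exists>ws. ring (parcs G) ws" ..
next
  assume "\<exists>ws. ring (parcs G) ws"
  then obtain ws where ws: "ring (parcs G) ws" ..
  then have ne: "ws \<noteq> []" by (auto simp: ring_def)
  let ?p = "(last ws, hd ws) # vwalk_arcs ws"
  have "pre_digraph.cycle (with_proj G) ?p"
    unfolding pre_digraph.cycle_def pre_digraph.awalk_def cas_with_proj_eq awalk_verts_with_proj_eq
    using ws walk_of_vwalk[OF ne] assms by (intro exI[of _ "last ws"]) (auto simp: ring_def)
  moreover have "length ?p \<ge> 3"
    using ws by (auto simp: ring_def length_vwalk_arcs)
  ultimately show "\<exists>p. pre_digraph.cycle (with_proj G) p \<and> length p \<ge> 3" by blast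
qed

lemma rooted_tree_iff_gtree: "rooted_tree T \<longleftrightarrow> gtree T"
proof -
  let ?V = "vertices T" and ?E = "edges T" and ?r = "root_of T"
  have "(\<forall>u\<in>?V. \<forall>v\<in>?V. (u, v) \<in> ?E\<^sup>*) \<longleftrightarrow> (\<forall>v\<in>?V. (?r, v) \<in> ?E\<^sup>*)" if "?r \<in> ?V" "sym ?E"
  proof -
    have "(v, ?r) \<in> ?E\<^sup>*" if "(?r, v) \<in> ?E\<^sup>*" for v
      using that sym_rtrancl[OF \<open>sym ?E\<close>] by (meson symD)
    then show ?thesis using \<open>?r \<in> ?V\<close> by (meson rtrancl_trans)
  qed
  then show ?thesis
    unfolding rooted_tree_def simple_tree_def gtree_def
    using connected_iff[of "graph_of T"] cycle_iff_ring[of "graph_of T"] pair_graph_iff[of "graph_of T"]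
    by (metis empty_iff)
qed

lemma shape_gtree: "shape T t \<Longrightarrow> gtree T"
proof -
  assume T: "shape T t"
  have "(root_of T, v) \<in> (edges T)\<^sup>*" if "v \<in> vertices T" for v
    using T that
  proof (induction arbitrary: v rule: shape.induct)
    case (shape_lnk T A S b)
    show ?case
    proof (cases "v \<in> vertices T")
      case True
      then have "(root_of T, v) \<in> (edges T)\<^sup>*" using shape_lnk.IH(1) by blast
      then show ?thesis using rtrancl_mono[of "edges T" "edges (lnk T S)"] by auto
    next
      case False
      then have "(root_of S, v) \<in> (edges S)\<^sup>*" using shape_lnk.IH(2) shape_lnk.prems by simp
      then have "(root_of S, v) \<in> (edges (lnk T S))\<^sup>*"
        using rtrancl_mono[of "edges S" "edges (lnk T S)"] by auto
      then show ?thesis by (auto intro: converse_rtrancl_into_rtrancl)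
    qed
  qed simp
  then show ?thesis
    using shape_wf[OF T] shape_no_ring[OF T] by (simp add: gtree_def)
qed

lemma rooted_tree_iff_shape: "rooted_tree T \<longleftrightarrow> (\<exists>t. shape T t)"
  using rooted_tree_iff_gtree[of T] gtree_shape[of T] shape_gtree[of T] by blast

subsection \<open>Unlabelled rooted trees\<close>

definition shape_class :: "nat \<Rightarrow> utree \<Rightarrow> nat rooted set" where
  "shape_class N t = {T \<in> rooted_trees_on N. shape T t}"

lemma rooted_trees_on_shape: "T \<in> rooted_trees_on N \<Longrightarrow> \<exists>t\<in>utrees N. shape T t"
  unfolding rooted_trees_on_def rooted_tree_iff_shape using shape_card by fastforce

lemma rooted_iso_class:
  assumes "T \<in> rooted_trees_on N" "shape T t"
  shows "rooted_iso_rel N `` {T} = shape_class N t"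
proof -
  have "rooted_iso T T' \<longleftrightarrow> shape T' t" if "T' \<in> rooted_trees_on N" for T'
    using rooted_trees_on_shape[OF that] rooted_iso_shape_iff[OF assms(2)] shape_unique by metis
  then show ?thesis using assms(1) by (auto simp: rooted_iso_rel_def shape_class_def)
qed

lemma shape_class_ex: "t \<in> utrees N \<Longrightarrow> \<exists>T. T \<in> shape_class N t"
  using shape_exists[of "{..<N}" t] by (auto simp: shape_class_def rooted_trees_on_def rooted_tree_iff_shape)

lemma unlabeled_rooted_trees_eq: "unlabeled_rooted_trees N = shape_class N ` utrees N"
proof (intro equalityI subsetI)
  fix C assume "C \<in> unlabeled_rooted_trees N"
  then obtain T where T: "T \<in> rooted_trees_on N" "C = rooted_iso_rel N `` {T}"
    by (auto simp: unlabeled_rooted_trees_def elim: quotientE)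
  then obtain t where "t \<in> utrees N" "shape T t" using rooted_trees_on_shape by blast
  then show "C \<in> shape_class N ` utrees N" using T rooted_iso_class by blast
next
  fix C assume "C \<in> shape_class N ` utrees N"
  then obtain t where t: "t \<in> utrees N" "C = shape_class N t" by blast
  then obtain T where "T \<in> rooted_trees_on N" "shape T t" using shape_class_ex[OF t(1)] unfolding shape_class_def by blast
  then show "C \<in> unlabeled_rooted_trees N"
    unfolding unlabeled_rooted_trees_def t(2) using rooted_iso_class quotientI by metis
qed

lemma inj_on_shape_class: "inj_on (shape_class N) (utrees N)"
  using shape_class_ex shape_unique unfolding inj_on_def shape_class_def by blast

lemma card_unlabeled_rooted_trees: "card (unlabeled_rooted_trees N) = card (utrees N)"
  by (simp add: unlabeled_rooted_trees_eq card_image[OF inj_on_shape_class])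

subsection \<open>Attached paths\<close>

text \<open>The new vertices are an arbitrary list, so the operation commutes with linking. In
  \<open>attach_path\<close> they depend on the maximum label of the whole tree, which does
  not.\<close>

definition att :: "'a rooted \<Rightarrow> 'a \<Rightarrow> 'a list \<Rightarrow> 'a rooted" where
  "att T u ws = (\<lparr>pverts = vertices T \<union> set (u # ws), parcs = edges T \<union> parcs (path_graph (u # ws))\<rparr>, root_of T)"

lemma att_simps [simp]: "vertices (att T u ws) = vertices T \<union> set (u # ws)"
  "edges (att T u ws) = edges T \<union> parcs (path_graph (u # ws))" "root_of (att T u ws) = root_of T"
  by (auto simp: att_def)

lemma path_graph_simps [simp]: "pverts (path_graph us) = set us"
  "parcs (path_graph us) = set (vwalk_arcs us) \<union> (set (vwalk_arcs us))\<inverse>"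
  by (auto simp: path_graph_def)

lemma path_graph_lnk: "ws \<noteq> [] \<Longrightarrow> (path_graph (u # ws), u) = lnk (sing u) (path_graph ws, hd ws)"
  by (intro rooted_eqI) (auto simp: vwalk_arcs_Cons)

lemma shape_path_graph:
  "distinct ws \<Longrightarrow> ws \<noteq> [] \<Longrightarrow> shape (path_graph ws, hd ws) (pth (length ws - 1))"
proof (induction ws)
  case (Cons u ws)
  show ?case
  proof (cases "ws = []")
    case True
    then have "(path_graph (u # ws), u) = sing u" by (intro rooted_eqI) auto
    then show ?thesis using True shape_sing[of u] by simp
  next
    case False
    then have "shape (path_graph ws, hd ws) (pth (length ws - 1))" using Cons by auto
    then have "shape (lnk (sing u) (path_graph ws, hd ws)) (Node {#pth (length ws - 1)#})"
      using Cons.prems by (intro shape_lnk shape_sing) auto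
    moreover have "Node {#pth (length ws - 1)#} = pth (length (u # ws) - 1)"
      using False by (cases ws) auto
    ultimately show ?thesis using path_graph_lnk[OF False, of u] by simp
  qed
qed simp

lemma att_root: "ws \<noteq> [] \<Longrightarrow> root_of T \<in> vertices T \<Longrightarrow> att T (root_of T) ws = lnk T (path_graph ws, hd ws)"
  by (intro rooted_eqI) (auto simp: vwalk_arcs_Cons)

lemma att_lnk_left: "u \<in> vertices T \<Longrightarrow> att (lnk T S) u ws = lnk (att T u ws) S"
  by (intro rooted_eqI) auto

lemma att_lnk_right: "u \<in> vertices S \<Longrightarrow> att (lnk T S) u ws = lnk T (att S u ws)"
  by (intro rooted_eqI) auto

text \<open>\<open>T\<close> is a subtree of \<open>U\<close>, obtained by removing \<open>p\<close> paths hanging from vertices of \<open>T\<close>.\<close>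

inductive grown :: "nat \<Rightarrow> nat \<Rightarrow> 'a rooted \<Rightarrow> 'a rooted \<Rightarrow> utree \<Rightarrow> utree \<Rightarrow> bool" for D where
  grown_sing: "set_mset P \<subseteq> {..<D} \<Longrightarrow> shape U (Node (image_mset pth P)) \<Longrightarrow> root_of U = r \<Longrightarrow>
    grown D (size P) (sing r) U (Node {#}) (Node (image_mset pth P))"
| grown_lnk: "grown D p T U (Node A) (Node B) \<Longrightarrow> grown D q S W a b \<Longrightarrow> vertices U \<inter> vertices W = {} \<Longrightarrow>
    grown D (p + q) (lnk T S) (lnk U W) (Node (add_mset a A)) (Node (add_mset b B))"

lemma grown_props:
  "grown D p T U t u \<Longrightarrow> shape U u \<and> grow D p t u \<and> vertices T \<subseteq> vertices U \<and> root_of U = root_of T"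
proof (induction rule: grown.induct)
  case (grown_sing P U r)
  then show ?case using shape_root[of U] by (auto intro: grow_leaf)
next
  case (grown_lnk p T U A B q S W a b)
  then show ?case by (auto intro: shape_lnk grow_link)
qed

lemma grown_refl: "shape T t \<Longrightarrow> grown D 0 T T t t"
proof (induction rule: shape.induct)
  case (shape_sing r)
  show ?case using grown_sing[of "{#}" D "sing r" r] shape.shape_sing[of r] by simp
next
  case (shape_lnk T A S b)
  then show ?case using grown_lnk[of D 0 T T A A 0 S S b b] by simp
qed

text \<open>\<open>T\<close> stays fixed while \<open>U\<close> grows: every path starts at a vertex
  of the original tree, so the place of attachment is the base vertex or lies in one of the two
  linked parts.\<close>

lemma grown_att:
  "grown D p T U t u \<Longrightarrow> v \<in> vertices T \<Longrightarrow> distinct ws \<Longrightarrow> ws \<noteq> [] \<Longrightarrow> length ws \<le> D \<Longrightarrow>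
    set ws \<inter> vertices U = {} \<Longrightarrow> \<exists>u'. grown D (Suc p) T (att U v ws) t u'"
proof (induction rule: grown.induct)
  case (grown_sing P U r)
  have v: "v = root_of U" using grown_sing by simp
  have r: "root_of U \<in> vertices U" using shape_root grown_sing(2) by blast
  \<comment> \<open>The first new vertex is a child of \<open>v\<close>, so the path below it has
    one edge fewer than the attached one.\<close>
  let ?P = "add_mset (length ws - 1) P"
  have "shape (att U v ws) (Node (image_mset pth ?P))"
    unfolding v att_root[OF \<open>ws \<noteq> []\<close> r] image_mset_add_mset
    using grown_sing by (intro shape_lnk shape_path_graph) auto
  moreover have "set_mset ?P \<subseteq> {..<D}" using grown_sing by (cases ws) auto
  ultimately have "grown D (size ?P) (sing r) (att U v ws) (Node {#}) (Node (image_mset pth ?P))"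
    using grown_sing(3) by (intro grown.grown_sing) auto
  then show ?case by auto
next
  case (grown_lnk p T U A B q S W a b)
  note pU = grown_props[OF grown_lnk(1)] and pW = grown_props[OF grown_lnk(2)]
  show ?case
  proof (cases "v \<in> vertices T")
    case True
    then obtain u' where u': "grown D (Suc p) T (att U v ws) (Node A) u'"
      using grown_lnk.IH(1) grown_lnk.prems by auto
    obtain B' where B': "u' = Node B'" by (cases u')
    have vU: "v \<in> vertices U" using True pU by blast
    have "grown D (Suc p + q) (lnk T S) (lnk (att U v ws) W) (Node (add_mset a A)) (Node (add_mset b B'))"
      using u' B' grown_lnk vU by (intro grown.grown_lnk) auto
    then show ?thesis using att_lnk_left[OF vU] by auto
  next
    case False
    then have vS: "v \<in> vertices S" using grown_lnk.prems by simp
    then obtain u' where u': "grown D (Suc q) S (att W v ws) a u'"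
      using grown_lnk.IH(2) grown_lnk.prems by auto
    have vW: "v \<in> vertices W" using vS pW by blast
    have "grown D (p + Suc q) (lnk T S) (lnk U (att W v ws)) (Node (add_mset a A)) (Node (add_mset u' B))"
      using u' grown_lnk vW by (intro grown.grown_lnk) auto
    then show ?thesis using att_lnk_right[OF vW] by auto
  qed
qed

lemma attach_path_eq: "attach_path T u x = att T u [Suc (Max (vertices T))..<Suc (Max (vertices T)) + x]"
  unfolding attach_path_def att_def Let_def path_graph_simps ..

text \<open>Only an inequality for \<open>p\<close>, because attaching a path with no edges leaves
  the tree unchanged.\<close>

lemma grown_attach_paths:
  assumes T: "shape T t"
  shows "(\<forall>(u, x)\<in>set ps. u \<in> vertices T \<and> x \<le> D) \<Longrightarrow>
    \<exists>p u. p \<le> length ps \<and> grown D p T (attach_paths T ps) t u"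
proof (induction ps rule: rev_induct)
  case Nil
  then show ?case using grown_refl[OF T] by (auto simp: attach_paths_def)
next
  case (snoc ux ps)
  obtain v x where ux: "ux = (v, x)" by force
  obtain p u where p: "p \<le> length ps" "grown D p T (attach_paths T ps) t u" using snoc by auto
  let ?U = "attach_paths T ps"
  let ?m = "Suc (Max (vertices ?U))"
  have v: "v \<in> vertices T" "x \<le> D" using snoc.prems ux by auto
  have vU: "v \<in> vertices ?U" using grown_props[OF p(2)] v by blast
  have eq: "attach_paths T (ps @ [ux]) = att ?U v [?m..<?m + x]"
    by (simp add: attach_paths_def ux attach_path_eq)
  show ?case
  proof (cases "x = 0")
    case True
    then have "att ?U v [?m..<?m + x] = ?U" using vU by (intro rooted_eqI) auto
    then show ?thesis using p eq by (intro exI[of _ p] exI[of _ u]) auto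
  next
    case False
    have "finite (vertices ?U)" using grown_props[OF p(2)] shape_finite by blast
    then have "set [?m..<?m + x] \<inter> vertices ?U = {}"
      using Max_ge[of "vertices ?U"] by fastforce
    then obtain u' where "grown D (Suc p) T (att ?U v [?m..<?m + x]) t u'"
      using grown_att[OF p(2) v(1), of "[?m..<?m + x]"] v False by auto
    then show ?thesis using p eq by (intro exI[of _ "Suc p"] exI[of _ u']) auto
  qed
qed

text \<open>Path lengths are integers, so the bound L^2 may be rounded down. Isomorphic grown trees
  have one and the same class, which is the common tree of \<open>usim\<close>.\<close>

lemma similar_imp_usim:
  assumes T: "shape T t" "shape T' t'" and sim: "similar \<iota> T T'"
  shows "usim (nat \<lfloor>(ln (inverse \<iota>))\<^sup>2\<rfloor>) (ln (inverse \<iota>)) t t'"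
proof -
  let ?L = "ln (inverse \<iota>)"
  let ?D = "nat \<lfloor>?L\<^sup>2\<rfloor>"
  obtain ps ps' where ps: "admissible \<iota> T ps" "admissible \<iota> T' ps'"
    "rooted_iso (attach_paths T ps) (attach_paths T' ps')" using sim by (auto simp: similar_def)
  have *: "\<exists>p u. real p \<le> real (tsize t) / ?L \<and> grown ?D p T (attach_paths T ps) t u"
    if "shape T t" "admissible \<iota> T ps" for T t ps
  proof -
    have "\<forall>(u, x)\<in>set ps. u \<in> vertices T \<and> x \<le> ?D"
      using that(2) by (auto simp: admissible_def le_nat_iff le_floor_iff)
    from grown_attach_paths[OF that(1) this] obtain p u
      where p: "p \<le> length ps" "grown ?D p T (attach_paths T ps) t u" by blast
    have "real p \<le> real (length ps)" using p(1) by simp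
    also have "\<dots> \<le> real (tsize t) / ?L" using that shape_card[OF that(1)] by (simp add: admissible_def)
    finally show ?thesis using p by blast
  qed
  obtain p u where p: "real p \<le> real (tsize t) / ?L" "grown ?D p T (attach_paths T ps) t u"
    using *[OF T(1) ps(1)] by blast
  obtain p' u' where p': "real p' \<le> real (tsize t') / ?L" "grown ?D p' T' (attach_paths T' ps') t' u'"
    using *[OF T(2) ps(2)] by blast
  have "u = u'"
    using ps(3) rooted_iso_shape_iff grown_props[OF p(2)] grown_props[OF p'(2)] by blast
  then show ?thesis
    using p p' grown_props[OF p(2)] grown_props[OF p'(2)] unfolding usim_def by blast
qed

section \<open>Good trees\<close>

text \<open>The degree, arm and sibling conditions as seen at a single vertex, the root of a
  descendant tree. The 1 added to the number of children accounts for the parent.\<close>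

definition root_ok :: "real \<Rightarrow> utree \<Rightarrow> bool" where
  "root_ok L t \<longleftrightarrow> real (size (children t)) + 1 \<le> L\<^sup>2 \<and> (\<forall>k. t = pth k \<longrightarrow> real k < L\<^sup>2) \<and>
     (\<forall>a b A. t = Node (add_mset a (add_mset b A)) \<longrightarrow> L\<^sup>2 \<le> real (tsize a) \<longrightarrow> L\<^sup>2 \<le> real (tsize b) \<longrightarrow>
        \<not> usim (nat \<lfloor>L\<^sup>2\<rfloor>) L a b)"

definition good :: "real \<Rightarrow> utree \<Rightarrow> bool" where
  "good L t \<longleftrightarrow> (\<forall>s\<in>subs t. root_ok L s)"

lemma good_Node: "good L (Node A) \<longleftrightarrow> root_ok L (Node A) \<and> (\<forall>a\<in>#A. good L a)"
  by (auto simp: good_def)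

section \<open>The size of the core\<close>

primrec bigs :: "real \<Rightarrow> utree \<Rightarrow> nat" where
  "bigs K (Node A) = sum_mset (image_mset (bigs K) A) + (if K \<le> real (tsize (Node A)) then 1 else 0)"

text \<open>Vertices in small subtrees are charged to the big vertex from which the subtree hangs. A
  big vertex has at most K - 1 children, so with its small child subtrees it accounts for at most 1
  + (K - 1) K \<le> K^2 vertices. For K = L^2 this is the factor L^4 of the core condition.\<close>

lemma tsize_le_bigs:
  assumes K: "K \<ge> 1"
  shows "\<forall>s\<in>subs t. real (size (children s)) + 1 \<le> K \<Longrightarrow> K \<le> real (tsize t) \<Longrightarrow>
    real (tsize t) \<le> K\<^sup>2 * real (bigs K t)"
proof (induction t)
  case (Node A)
  have ch: "real (tsize a) \<le> K + K\<^sup>2 * real (bigs K a)" if "a \<in># A" for a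
  proof (cases "K \<le> real (tsize a)")
    case True
    then have "real (tsize a) \<le> K\<^sup>2 * real (bigs K a)" using Node that by auto
    then show ?thesis using K by linarith
  next
    case False
    moreover have "0 \<le> K\<^sup>2 * real (bigs K a)" by simp
    ultimately show ?thesis by linarith
  qed
  have "real (sum_mset (image_mset tsize B)) \<le> real (size B) * K + K\<^sup>2 * real (sum_mset (image_mset (bigs K) B))"
    if "B \<subseteq># A" for B
    using that
  proof (induction B)
    case (add a B)
    have "a \<in># A" using mset_subset_eqD[OF add.prems, of a] by simp
    moreover have "B \<subseteq># A" using subset_mset.order_trans[OF _ add.prems, of B] by simp
    ultimately show ?case using add.IH ch[of a] by (simp add: algebra_simps)
  qed simp
  from this[of A]
  have "real (tsize (Node A)) \<le> 1 + real (size A) * K + K\<^sup>2 * real (sum_mset (image_mset (bigs K) A))"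
    by (simp add: tsize.simps)
  also have "real (size A) * K \<le> (K - 1) * K"
    using Node.prems(1) K by (intro mult_right_mono) auto
  also have "1 + (K - 1) * K \<le> K\<^sup>2" using K by (simp add: power2_eq_square algebra_simps)
  finally have "real (tsize (Node A)) \<le> K\<^sup>2 + K\<^sup>2 * real (sum_mset (image_mset (bigs K) A))" by simp
  then show ?case using Node.prems(2) by (simp add: algebra_simps)
qed

text \<open>Linking enlarges the descendants of the root alone, so the root is left out of the
  induction and added afterwards.\<close>

lemma card_big_nonroot:
  "shape T t \<Longrightarrow> card {v \<in> vertices T - {root_of T}. K \<le> real (card (descendants T v))} =
    sum_mset (image_mset (bigs K) (children t))"
proof (induction rule: shape.induct)
  case (shape_lnk T A S b)
  note lnk = shape_lnk(1-3)
  let ?X = "\<lambda>T. {v \<in> vertices T - {root_of T}. K \<le> real (card (descendants T v))}"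
  let ?R = "if K \<le> real (tsize b) then {root_of S} else {}"
  note T = shape_root[OF lnk(1)] shape_finite[OF lnk(1)]
    and S = shape_root[OF lnk(2)] shape_finite[OF lnk(2)]
  have "?X (lnk T S) = ?X T \<union> {v \<in> vertices S. K \<le> real (card (descendants S v))}"
    (is "?l = ?r")
  proof (rule set_eqI)
    fix x
    consider "x \<in> vertices S" "x \<notin> vertices T" "x \<noteq> root_of T" | "x = root_of T" "x \<notin> vertices S"
      | "x \<notin> vertices S" "x \<noteq> root_of T" using lnk(3) T(1) by blast
    then show "x \<in> ?l \<longleftrightarrow> x \<in> ?r"
      by cases (simp_all add: descendants_lnk_left[OF lnk] descendants_lnk_right[OF lnk])
  qed
  also have "{v \<in> vertices S. K \<le> real (card (descendants S v))} = ?X S \<union> ?R"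
    using S(1) descendants_root[OF lnk(2)] shape_card[OF lnk(2)] by auto
  finally have "card (?X (lnk T S)) = card (?X T \<union> (?X S \<union> ?R))" by simp
  also have "\<dots> = card (?X T) + card (?X S \<union> ?R)"
    using T S lnk(3) by (intro card_Un_disjoint) auto
  also have "card (?X S \<union> ?R) = card (?X S) + card ?R"
    using S by (intro card_Un_disjoint) auto
  also have "card (?X S) + card ?R = bigs K b"
    using shape_lnk.IH(2) by (cases b) auto
  finally show ?case using shape_lnk.IH(1) by simp
qed simp

lemma card_core_ge:
  assumes T: "shape T t"
  shows "bigs K t \<le> card {v \<in> vertices T. K \<le> real (card (descendants T v))}"
proof -
  let ?X = "{v \<in> vertices T - {root_of T}. K \<le> real (card (descendants T v))}"
  let ?R = "if K \<le> real (tsize t) then {root_of T} else {}"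
  have "?X \<union> ?R \<subseteq> {v \<in> vertices T. K \<le> real (card (descendants T v))}"
    using shape_root[OF T] descendants_root[OF T] shape_card[OF T] by auto
  then have "card (?X \<union> ?R) \<le> card {v \<in> vertices T. K \<le> real (card (descendants T v))}"
    using shape_finite[OF T] by (intro card_mono) auto
  moreover have "card (?X \<union> ?R) = card ?X + card ?R"
    using shape_finite[OF T] by (intro card_Un_disjoint) auto
  moreover have "bigs K t = card ?X + card ?R"
    using card_big_nonroot[OF T] by (cases t) auto
  ultimately show ?thesis by simp
qed

text \<open>For \<open>2 * n + 1\<close> vertices floor and ceiling agree, so the condition at the
  root is symmetric in \<open>t1\<close> and \<open>t2\<close>, and either child may be named
  first.\<close>

lemma admissible_tree_shape:
  assumes L: "L = ln (inverse \<iota>)" "L \<ge> 1"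
    and T: "shape T (Node {#t1, t2#})" and sz: "tsize t1 = n" "tsize t2 = n" "L\<^sup>2 \<le> real n"
    and g: "good L (Node {#t1, t2#})"
    and c1: "\<And>s. s \<in> subs t2 \<Longrightarrow> \<not> usim (nat \<lfloor>L\<^sup>2\<rfloor>) L t1 s"
    and c2: "\<And>s. s \<in> subs t1 \<Longrightarrow> \<not> usim (nat \<lfloor>L\<^sup>2\<rfloor>) L t2 s"
  shows "admissible_tree \<iota> (2 * n + 1) T"
proof -
  let ?t = "Node {#t1, t2#}"
  have ok: "root_ok L s" if "s \<in> subs ?t" for s using g that unfolding good_def by blast
  have "\<forall>v\<in>vertices T. real (deg T v) \<le> L\<^sup>2"
  proof
    fix v assume "v \<in> vertices T"
    then obtain s where s: "s \<in> subs ?t" "deg T v \<le> size (children s) + 1"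
      using shape_deg[OF T] by blast
    have "real (deg T v) \<le> real (size (children s)) + 1" using s(2) by linarith
    then show "real (deg T v) \<le> L\<^sup>2" using ok[OF s(1)] unfolding root_ok_def by linarith
  qed
  moreover have "\<not> (\<exists>us. arm_path T us \<and> real (length us - 1) \<ge> L\<^sup>2)"
  proof
    assume "\<exists>us. arm_path T us \<and> real (length us - 1) \<ge> L\<^sup>2"
    then obtain us where us: "us \<noteq> []" "distinct us" "set us \<subseteq> vertices T"
      "Des T (hd us) = (path_graph us, hd us)" "real (length us - 1) \<ge> L\<^sup>2"
      unfolding arm_path_def by blast
    then obtain s where s: "s \<in> subs ?t" "shape (Des T (hd us)) s" using shape_Des[OF T, of "hd us"] hd_in_set[OF us(1)] by blast
    have "s = pth (length us - 1)"
      using shape_unique[OF s(2)] shape_path_graph[OF us(2,1)] us(4) by simp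
    then show False using ok[OF s(1)] us(5) unfolding root_ok_def by fastforce
  qed
  moreover have "real (card (pverts (core \<iota> T))) \<ge> real (2 * n + 1) / L ^ 4"
  proof -
    have tn: "tsize ?t = 2 * n + 1" using sz by (simp add: tsize.simps)
    have L2: "L\<^sup>2 \<ge> 1" using L(2) by (simp add: one_le_power)
    have "real (tsize ?t) \<le> (L\<^sup>2)\<^sup>2 * real (bigs (L\<^sup>2) ?t)"
    proof (rule tsize_le_bigs[OF L2])
      show "\<forall>s\<in>subs ?t. real (size (children s)) + 1 \<le> L\<^sup>2" using ok unfolding root_ok_def by blast
      show "L\<^sup>2 \<le> real (tsize ?t)" using sz(3) unfolding tn by simp
    qed
    also have "\<dots> \<le> (L\<^sup>2)\<^sup>2 * real (card {v \<in> vertices T. L\<^sup>2 \<le> real (card (descendants T v))})"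
      by (intro mult_left_mono of_nat_mono card_core_ge[OF T]) simp
    also have "{v \<in> vertices T. L\<^sup>2 \<le> real (card (descendants T v))} = pverts (core \<iota> T)"
      by (simp add: core_def induced_def L(1))
    finally show ?thesis using L(2) unfolding tn by (simp add: field_simps flip: power_mult)
  qed
  moreover have "\<not> similar \<iota> S S'"
    if S: "descendant_tree S T" "descendant_tree S' T" "S \<noteq> S'"
      and big: "real (card (vertices S)) \<ge> L\<^sup>2" "real (card (vertices S')) \<ge> L\<^sup>2"
      and w: "is_parent T w (root_of S)" "is_parent T w (root_of S')" for S S' w
  proof
    assume sim: "similar \<iota> S S'"
    obtain v v' where v: "S = Des T v" "S' = Des T v'" using S(1,2) by (auto simp: descendant_tree_def)
    then have "v \<noteq> v'" using S(3) by auto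
    then obtain a b A where ab: "Node (add_mset a (add_mset b A)) \<in> subs ?t" "shape S a" "shape S' b"
      using siblings_shape[OF T, of w v v'] w v by auto
    have "usim (nat \<lfloor>L\<^sup>2\<rfloor>) L a b" using similar_imp_usim[OF ab(2,3) sim] L(1) by simp
    then show False using ok[OF ab(1)] big shape_card[OF ab(2)] shape_card[OF ab(3)]
      unfolding root_ok_def by auto
  qed
  moreover have "\<exists>a b. a \<noteq> b \<and> {c. is_parent T (root_of T) c} = {a, b} \<and>
        int (card (vertices (Des T a))) = \<lfloor>(real (2 * n + 1) - 1) / 2\<rfloor> \<and>
        int (card (vertices (Des T b))) = \<lceil>(real (2 * n + 1) - 1) / 2\<rceil> \<and>
        (\<forall>S. descendant_tree S (Des T b) \<longrightarrow> \<not> similar \<iota> (Des T a) S) \<and>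
        (\<forall>S'. descendant_tree S' (Des T a) \<longrightarrow> \<not> similar \<iota> (Des T b) S')"
  proof -
    let ?C = "{c. (root_of T, c) \<in> edges T}"
    obtain g where g: "{#t1, t2#} = image_mset g (mset_set ?C)" "\<And>c. c \<in> ?C \<Longrightarrow> shape (Des T c) (g c)"
      using shape_children[OF T] by auto
    have "size {#t1, t2#} = card ?C" by (subst g(1)) simp
    then have "card ?C = 2" by simp
    then obtain a0 b0 where C0: "?C = {a0, b0}" "a0 \<noteq> b0" by (meson card_2_iff)
    have "{#t1, t2#} = {#g a0, g b0#}" using g(1) C0 by simp
    then have "(g a0 = t1 \<and> g b0 = t2) \<or> (g a0 = t2 \<and> g b0 = t1)"
      by (auto simp: add_eq_conv_ex)
    then obtain a b where ab: "?C = {a, b}" "a \<noteq> b" "g a = t1" "g b = t2"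
      using C0 by (metis insert_commute)
    have a: "shape (Des T a) t1" and b: "shape (Des T b) t2" using g(2) ab by auto
    have "{c. is_parent T (root_of T) c} = {a, b}" using is_parent_root[OF T] ab(1) by simp
    moreover have "card (vertices (Des T a)) = n" "card (vertices (Des T b)) = n"
      using shape_card[OF a] shape_card[OF b] sz by auto
    moreover have "\<not> similar \<iota> (Des T a) S" if S: "descendant_tree S (Des T b)" for S
    proof
      assume sim: "similar \<iota> (Des T a) S"
      obtain v where v: "v \<in> vertices (Des T b)" "S = Des (Des T b) v" using S by (auto simp: descendant_tree_def)
      obtain s where s: "s \<in> subs t2" "shape S s" using shape_Des[OF b v(1)] v(2) by blast
      show False using similar_imp_usim[OF a s(2) sim] c1[OF s(1)] L(1) by simp
    qed
    moreover have "\<not> similar \<iota> (Des T b) S" if S: "descendant_tree S (Des T a)" for S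
    proof
      assume sim: "similar \<iota> (Des T b) S"
      obtain v where v: "v \<in> vertices (Des T a)" "S = Des (Des T a) v" using S by (auto simp: descendant_tree_def)
      obtain s where s: "s \<in> subs t1" "shape S s" using shape_Des[OF a v(1)] v(2) by blast
      show False using similar_imp_usim[OF b s(2) sim] c2[OF s(1)] L(1) by simp
    qed
    ultimately show ?thesis using ab(2) by (intro exI[of _ a] exI[of _ b]) simp
  qed
  ultimately show ?thesis unfolding admissible_tree_def L(1) by blast
qed

subsection \<open>From rooted to unrooted families\<close>

lemma finite_unlabeled_rooted_trees: "finite (unlabeled_rooted_trees N)"
  by (simp add: unlabeled_rooted_trees_eq)

lemma card_rooted_family_ge:
  assumes "X \<subseteq> utrees N" "\<And>t T. t \<in> X \<Longrightarrow> shape T t \<Longrightarrow> admissible_tree \<iota> N T"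
  shows "card X \<le> card (rooted_family \<iota> N)"
proof -
  have "shape_class N ` X \<subseteq> rooted_family \<iota> N"
  proof
    fix C assume "C \<in> shape_class N ` X"
    then obtain t where t: "t \<in> X" "C = shape_class N t" by blast
    have "t \<in> utrees N" using t(1) assms(1) by blast
    then obtain T where T: "T \<in> C" "shape T t" using shape_class_ex[of t N] unfolding t(2) shape_class_def by blast
    have "C \<in> unlabeled_rooted_trees N" unfolding unlabeled_rooted_trees_eq using t assms(1) by blast
    then show "C \<in> rooted_family \<iota> N" unfolding rooted_family_def using T assms(2)[OF t(1)] by blast
  qed
  moreover have "finite (rooted_family \<iota> N)"
    by (rule finite_subset[OF _ finite_unlabeled_rooted_trees[of N]]) (auto simp: rooted_family_def)
  ultimately have "card (shape_class N ` X) \<le> card (rooted_family \<iota> N)" by (intro card_mono)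
  then show ?thesis using card_image[OF inj_on_subset[OF inj_on_shape_class assms(1)]] by simp
qed

lemma finite_trees_on: "finite (trees_on N)"
proof (rule finite_subset)
  show "trees_on N \<subseteq> (\<lambda>E. \<lparr>pverts = {..<N}, parcs = E\<rparr>) ` Pow ({..<N} \<times> {..<N})"
  proof
    fix G assume G: "G \<in> trees_on N"
    then have "parcs G \<subseteq> {..<N} \<times> {..<N}" "pverts G = {..<N}"
      by (auto simp: trees_on_def simple_tree_def pair_graph_iff)
    then show "G \<in> (\<lambda>E. \<lparr>pverts = {..<N}, parcs = E\<rparr>) ` Pow ({..<N} \<times> {..<N})"
      by (intro image_eqI[of _ _ "parcs G"]) (auto intro: pair_pre_digraph.equality)
  qed
qed auto

lemma digraph_iso_refl:
  assumes "simple_tree G" shows "digraph_iso (with_proj G) (with_proj G)"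
proof -
  have "parcs G \<subseteq> pverts G \<times> pverts G" using assms by (simp add: simple_tree_def pair_graph_iff)
  then obtain h where "pre_digraph.digraph_isomorphism (with_proj G) h"
    "with_proj (graph_of (relabel id (G, undefined))) = app_iso h (with_proj G)"
    using graph_iso_relabel[of "(G, undefined)" id] by auto
  moreover have "graph_of (relabel id (G, undefined)) = G" by (simp add: relabel_def map_prod.id)
  ultimately show ?thesis unfolding digraph_iso_def by auto
qed

text \<open>Fix a representative of every unrooted class. Each rooted class is that of a
  representative rooted at one of its \<open>N\<close> vertices.\<close>

lemma card_rooted_family_le: "card (rooted_family \<iota> N) \<le> N * card (unrooted_family \<iota> N)"
proof -
  let ?g = "\<lambda>D. SOME G. G \<in> D"
  let ?c = "\<lambda>T. rooted_iso_rel N `` {T}"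
  have "rooted_family \<iota> N \<subseteq> (\<Union>D\<in>unrooted_family \<iota> N. (\<lambda>u. ?c (?g D, u)) ` {..<N})"
  proof
    fix C assume C: "C \<in> rooted_family \<iota> N"
    then obtain t where "t \<in> utrees N" "C = shape_class N t"
      by (auto simp: rooted_family_def unlabeled_rooted_trees_eq)
    moreover obtain T where "T \<in> shape_class N t" using shape_class_ex calculation by blast
    moreover obtain G u where "T = (G, u)" by force
    ultimately have Gu: "(G, u) \<in> rooted_trees_on N" "shape (G, u) t" "C = shape_class N t"
      by (auto simp: shape_class_def)
    then have CT: "?c (G, u) = C" using rooted_iso_class by blast
    have G: "G \<in> trees_on N" "u \<in> pverts G" using Gu(1) by (auto simp: rooted_trees_on_def trees_on_def rooted_tree_def)
    define D where "D = tree_iso_rel N `` {G}"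
    have GD: "G \<in> D" using G digraph_iso_refl by (auto simp: D_def tree_iso_rel_def trees_on_def)
    have "D \<in> unrooted_family \<iota> N"
      unfolding unrooted_family_def unlabeled_trees_def
      using GD G CT C by (auto simp: D_def intro!: quotientI)
    moreover have "?g D \<in> D" using GD by (rule someI)
    then have gD: "?g D \<in> trees_on N" "digraph_iso (with_proj G) (with_proj (?g D))"
      by (auto simp: D_def tree_iso_rel_def)
    then obtain h where h: "pre_digraph.digraph_isomorphism (with_proj G) h"
      "with_proj (?g D) = app_iso h (with_proj G)" by (auto simp: digraph_iso_def)
    let ?u = "iso_verts h u"
    have iso: "rooted_iso (G, u) (?g D, ?u)" unfolding rooted_iso_def using h by auto
    have "pverts (?g D) = iso_verts h ` pverts G" using arg_cong[OF h(2), of verts] by simp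
    then have uD: "?u \<in> pverts (?g D)" using G(2) by blast
    then have T': "(?g D, ?u) \<in> rooted_trees_on N"
      using gD(1) by (auto simp: rooted_trees_on_def trees_on_def rooted_tree_def)
    have "shape (?g D, ?u) t"
      using iso shape_relabel[OF Gu(2)] by (metis rooted_isoE)
    then have "?c (?g D, ?u) = C" using rooted_iso_class[OF T'] Gu(3) by blast
    moreover have "?u < N" using uD gD(1) by (auto simp: trees_on_def)
    ultimately show "C \<in> (\<Union>D\<in>unrooted_family \<iota> N. (\<lambda>u. ?c (?g D, u)) ` {..<N})" by blast
  qed
  moreover have fin: "finite (unrooted_family \<iota> N)"
  proof (rule finite_subset)
    show "unrooted_family \<iota> N \<subseteq> (\<lambda>G. tree_iso_rel N `` {G}) ` trees_on N"
      by (auto simp: unrooted_family_def unlabeled_trees_def elim: quotientE)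
  qed (simp add: finite_trees_on)
  ultimately have "card (rooted_family \<iota> N) \<le> card (\<Union>D\<in>unrooted_family \<iota> N. (\<lambda>u. ?c (?g D, u)) ` {..<N})"
    by (intro card_mono) auto
  also have "\<dots> \<le> (\<Sum>D\<in>unrooted_family \<iota> N. card ((\<lambda>u. ?c (?g D, u)) ` {..<N}))"
    by (rule card_UN_le[OF fin])
  also have "\<dots> \<le> (\<Sum>D\<in>unrooted_family \<iota> N. N)"
    by (intro sum_mono) (metis card_image_le card_lessThan finite_lessThan)
  finally show ?thesis by (simp add: mult.commute)
qed

section \<open>Trees whose root has many children\<close>

text \<open>Euler product: a multiset is a choice of multiplicity for each tree of \<open>X\<close>,
  which gives one geometric series per tree. The variable \<open>z\<close> marks the number of
  elements.\<close>

lemma multiset_weight_le: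
  fixes z x :: real
  assumes "finite X" and z: "0 < z" "0 < x" "x < 1" and q: "\<And>t. t \<in> X \<Longrightarrow> z * x ^ tsize t < 1"
  shows "finite F \<Longrightarrow> (\<And>A. A \<in> F \<Longrightarrow> set_mset A \<subseteq> X) \<Longrightarrow>
    (\<Sum>A\<in>F. z ^ size A * x ^ sum_mset (image_mset tsize A)) \<le> (\<Prod>t\<in>X. 1 / (1 - z * x ^ tsize t))"
  using assms(1) q
proof (induction X arbitrary: F rule: finite_induct)
  case empty
  then have "F \<subseteq> {{#}}" by auto
  then have "F = {} \<or> F = {{#}}" by blast
  then show ?case by auto
next
  case (insert t X)
  define w where "w A = z ^ size A * x ^ sum_mset (image_mset tsize A)" for A
  define q where "q = z * x ^ tsize t"
  have q: "0 < q" "q < 1" using insert.prems(3)[of t] z by (auto simp: q_def)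
  have w0: "0 \<le> w A" for A using z by (simp add: w_def)
  let ?h = "\<lambda>(c, A). replicate_mset c t + A"
  have wh: "w (replicate_mset c t + A) = q ^ c * w A" for c A
    by (simp add: w_def q_def power_add power_mult_distrib algebra_simps flip: power_mult)
  define C where "C = (\<lambda>A. (count A t, filter_mset (\<lambda>s. s \<noteq> t) A)) ` F"
  have C: "finite C" using insert.prems(1) by (simp add: C_def)
  have hF: "F = ?h ` C"
  proof -
    have "replicate_mset (count A t) t + filter_mset (\<lambda>s. s \<noteq> t) A = A" for A :: "utree multiset"
      using multiset_partition[of A "\<lambda>s. t = s"] filter_eq_replicate_mset[of t A] by (simp add: eq_commute)
    then show ?thesis unfolding C_def image_image by simp
  qed
  have sub: "set_mset A \<subseteq> X" if "A \<in> snd ` C" for A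
    using that insert.prems(2) unfolding C_def by fastforce
  have "(\<Sum>A\<in>F. w A) \<le> (\<Sum>c\<in>C. w (?h c))"
    unfolding hF using C w0 by (intro order_trans[OF sum_image_le]) auto
  also have "\<dots> = (\<Sum>c\<in>C. q ^ fst c * w (snd c))"
    by (intro sum.cong refl) (auto simp: wh)
  also have "\<dots> \<le> (\<Sum>c\<in>fst ` C \<times> snd ` C. q ^ fst c * w (snd c))"
    using C q w0 by (intro sum_mono2) (auto intro: rev_image_eqI)
  also have "\<dots> = (\<Sum>c\<in>fst ` C. q ^ c) * (\<Sum>A\<in>snd ` C. w A)"
    by (simp add: sum_product sum.cartesian_product case_prod_unfold)
  also have "\<dots> \<le> 1 / (1 - q) * (\<Prod>t\<in>X. 1 / (1 - z * x ^ tsize t))"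
  proof (rule mult_mono)
    have "(\<Sum>c\<in>fst ` C. q ^ c) \<le> (\<Sum>c. q ^ c)"
      using C q by (intro sum_le_suminf) (auto intro: summable_geometric)
    then show "(\<Sum>c\<in>fst ` C. q ^ c) \<le> 1 / (1 - q)" using q by (simp add: suminf_geometric)
    show "(\<Sum>A\<in>snd ` C. w A) \<le> (\<Prod>t\<in>X. 1 / (1 - z * x ^ tsize t))"
      unfolding w_def using C sub insert.prems(3) by (intro insert.IH) auto
  qed (use q w0 in \<open>auto intro: sum_nonneg\<close>)
  also have "\<dots> = (\<Prod>t\<in>insert t X. 1 / (1 - z * x ^ tsize t))"
    using insert.hyps by (simp add: q_def)
  finally show ?case by (simp add: w_def)
qed

text \<open>For q \<ge> 0 the product (1 + 10 q)(1 - q) is at least 1 exactly up to q = 9/10, the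
  weight that a single-vertex child will receive.\<close>

lemma one_div_le_exp:
  fixes q :: real
  assumes "0 \<le> q" "q \<le> 9 / 10"
  shows "1 / (1 - q) \<le> exp (10 * q)"
proof -
  have "1 \<le> 1 + q * (9 - 10 * q)" using assms by simp
  also have "\<dots> = (1 + 10 * q) * (1 - q)" by (simp add: algebra_simps)
  also have "\<dots> \<le> exp (10 * q) * (1 - q)"
    using assms exp_ge_add_one_self[of "10 * q"] by (intro mult_right_mono) auto
  finally show ?thesis using assms by (simp add: divide_simps)
qed

text \<open>Rankin's trick: each child gets the extra weight \<open>z = 9 / (10 x)\<close>, the largest one up to a
  constant for which the generating function of the multisets of children stays finite at \<open>x\<close>.\<close>

lemma card_many_children_le:
  fixes x d :: real
  assumes x: "0 < x" "x \<le> 1 / 2"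
    and W: "(\<Sum>k\<le>m. card (utrees k) * x ^ k) \<le> W"
  shows "card {t \<in> utrees m. d \<le> size (children t)} * x ^ m \<le> x * exp (9 / x * W) * (10 / 9 * x) powr d"
proof (cases "m = 0")
  case True
  then show ?thesis using x by simp
next
  case False
  define z where "z = 9 / 10 / x"
  have z: "1 \<le> z" "z * x = 9 / 10" using x by (auto simp: z_def field_simps)
  define X where "X = {t. tsize t \<le> m}"
  have X: "finite X" "X = (\<Union>k\<le>m. utrees k)" using finite_tsize_le by (auto simp: X_def)
  have q: "z * x ^ tsize t \<le> 9 / 10" for t
  proof -
    have "x ^ tsize t \<le> x ^ 1" using x by (intro power_decreasing) (auto simp: Suc_le_eq)
    then have "z * x ^ tsize t \<le> z * x" using z(1) by (intro mult_left_mono) auto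
    then show ?thesis using z(2) by simp
  qed
  define F where "F = children ` {t \<in> utrees m. d \<le> size (children t)}"
  have finF: "finite F"
    unfolding F_def by (intro finite_imageI finite_subset[OF _ finite_utrees[of m]]) auto
  have inj: "inj_on children {t \<in> utrees m. d \<le> size (children t)}"
    by (rule inj_onI) (metis children.simps utree.exhaust)
  have FA: "sum_mset (image_mset tsize A) = m - 1 \<and> d \<le> size A \<and> set_mset A \<subseteq> X" if AF: "A \<in> F" for A
  proof -
    obtain t where "tsize t = m" "d \<le> size (children t)" "A = children t" using AF by (auto simp: F_def)
    then have t: "tsize (Node A) = m" "d \<le> size A" by (cases t; simp)+
    then have "set_mset A \<subseteq> X" using tsize_child_less[of _ A] by (fastforce simp: X_def)
    then show ?thesis using t by (simp add: tsize.simps)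
  qed
  have "real (card F) * (z powr d * x ^ (m - 1)) = (\<Sum>A\<in>F. z powr d * x ^ (m - 1))" by simp
  also have "\<dots> \<le> (\<Sum>A\<in>F. z ^ size A * x ^ sum_mset (image_mset tsize A))"
  proof (rule sum_mono)
    fix A assume A: "A \<in> F"
    have "z powr d \<le> z powr size A" using FA[OF A] z by (intro powr_mono) auto
    then have "z powr d \<le> z ^ size A" using z by (simp add: powr_realpow)
    then show "z powr d * x ^ (m - 1) \<le> z ^ size A * x ^ sum_mset (image_mset tsize A)"
      using FA[OF A] x z by (intro mult_mono) auto
  qed
  also have "\<dots> \<le> (\<Prod>t\<in>X. 1 / (1 - z * x ^ tsize t))"
  proof (rule multiset_weight_le[OF X(1) _ _ _ _ finF])
    show "z * x ^ tsize t < 1" for t using q[of t] by simp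
  qed (use x z FA in auto)
  also have "\<dots> \<le> (\<Prod>t\<in>X. exp (10 * (z * x ^ tsize t)))"
  proof (rule prod_mono)
    fix t
    have "0 \<le> z * x ^ tsize t" using z x by simp
    from one_div_le_exp[OF this q]
    show "0 \<le> 1 / (1 - z * x ^ tsize t) \<and> 1 / (1 - z * x ^ tsize t) \<le> exp (10 * (z * x ^ tsize t))"
      using q[of t] by simp
  qed
  also have "\<dots> = exp (\<Sum>t\<in>X. 10 * (z * x ^ tsize t))" using X(1) by (simp add: exp_sum)
  also have "(\<Sum>t\<in>X. 10 * (z * x ^ tsize t)) = 10 * z * (\<Sum>t\<in>X. x ^ tsize t)"
    by (simp add: sum_distrib_left mult.assoc)
  also have "(\<Sum>t\<in>X. x ^ tsize t) = (\<Sum>k\<le>m. \<Sum>t\<in>utrees k. x ^ tsize t)"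
    unfolding X(2) by (intro sum.UNION_disjoint) auto
  also have "\<dots> = (\<Sum>k\<le>m. card (utrees k) * x ^ k)"
    by (intro sum.cong refl) simp
  also have "exp (10 * z * (\<Sum>k\<le>m. card (utrees k) * x ^ k)) \<le> exp (9 / x * W)"
    using W x mult_left_mono[OF W, of "9 / x"] by (simp add: z_def)
  finally have *: "real (card F) * (z powr d * x ^ (m - 1)) \<le> exp (9 / x * W)" .
  have "card {t \<in> utrees m. d \<le> size (children t)} = card F"
    unfolding F_def using card_image[OF inj] by simp
  moreover have "x ^ m = x * x ^ (m - 1)" using False by (cases m) auto
  moreover have "real (card F) * x ^ (m - 1) \<le> exp (9 / x * W) * (10 / 9 * x) powr d"
  proof -
    have zP: "z powr d * (10 / 9 * x) powr d = 1"
      using x z by (simp add: z_def flip: powr_mult)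
    have "real (card F) * x ^ (m - 1) = real (card F) * x ^ (m - 1) * (z powr d * (10 / 9 * x) powr d)"
      unfolding zP by simp
    also have "\<dots> = real (card F) * (z powr d * x ^ (m - 1)) * (10 / 9 * x) powr d"
      by (simp only: mult_ac)
    also have "\<dots> \<le> exp (9 / x * W) * (10 / 9 * x) powr d"
      using * by (intro mult_right_mono) auto
    finally show ?thesis .
  qed
  ultimately show ?thesis
    using x mult_left_mono[of "real (card F) * x ^ (m - 1)" "exp (9 / x * W) * (10 / 9 * x) powr d" x]
    by (simp add: mult_ac)
qed

text \<open>Telescoping: the induction proves 3 - 2 / sqrt m, whose increments dominate the
  terms.\<close>

lemma sum_powr_le_3: "(\<Sum>k=1..m. real k powr (- 3 / 2)) \<le> 3"
proof -
  have "(\<Sum>k=1..m. real k powr (- 3 / 2)) \<le> 3 - 2 / sqrt m" if "m \<ge> 1" for m :: nat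
    using that
  proof (induction m rule: nat_induct_at_least)
    case base
    show ?case by simp
  next
    case (Suc m)
    define a b where "a = sqrt m" and "b = sqrt (Suc m)"
    have ab: "1 \<le> a" "a \<le> b" "b\<^sup>2 = a\<^sup>2 + 1" using Suc by (auto simp: a_def b_def)
    have "real (Suc m) powr (- 3 / 2) = (b\<^sup>2) powr (- 3 / 2)" by (simp add: b_def)
    also have "b\<^sup>2 = b powr 2" using ab by (simp add: powr_numeral)
    also have "(b powr 2) powr (- 3 / 2) = b powr (- 3)" by (simp add: powr_powr)
    also have "\<dots> = 1 / b ^ 3" using ab by (simp add: powr_minus_divide powr_numeral)
    also have "\<dots> \<le> 2 / a - 2 / b"
    proof -
      have 1: "(b - a) * (a + b) = 1" using ab(3) by (simp add: algebra_simps power2_eq_square)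
      have "2 / a - 2 / b = 2 * (b - a) / (a * b)" using ab by (simp add: field_simps)
      also have "\<dots> = 2 * ((b - a) * (a + b)) / (a * b * (a + b))" using ab by simp
      also have "\<dots> = 2 / (a * b * (a + b))" unfolding 1 by simp
      also have "\<dots> \<ge> 2 / (b * b * (b + b))"
        using ab by (intro divide_left_mono mult_mono) (auto intro!: mult_pos_pos)
      finally show ?thesis by (simp add: power3_eq_cube)
    qed
    finally show ?case using Suc.IH by (simp add: a_def b_def)
  qed
  then show ?thesis
  proof (cases "m \<ge> 1")
    case True
    then have "(\<Sum>k=1..m. real k powr (- 3 / 2)) \<le> 3 - 2 / sqrt m"
      using \<open>\<And>m. m \<ge> 1 \<Longrightarrow> (\<Sum>k=1..m. real k powr (- 3 / 2)) \<le> 3 - 2 / sqrt m\<close> by blast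
    also have "\<dots> \<le> 3" by simp
    finally show ?thesis .
  qed simp
qed

section \<open>Most trees of moderate size are good\<close>

lemma exp_ge_power: "0 \<le> y \<Longrightarrow> (y / real k) ^ k \<le> exp (y :: real)" if "k > 0"
proof -
  assume y: "0 \<le> y"
  have "(y / real k) ^ k \<le> exp (y / real k) ^ k"
  proof (rule power_mono)
    show "y / real k \<le> exp (y / real k)" using exp_ge_add_one_self[of "y / real k"] by linarith
  qed (use y in simp)
  also have "\<dots> = exp y" using that by (subst exp_of_nat_mult[symmetric]) simp
  finally show ?thesis .
qed

lemma card_le_card_mult:
  assumes "finite I" "\<And>i. i \<in> I \<Longrightarrow> real (card (A i)) \<le> B" "X \<subseteq> (\<Union>i\<in>I. A i)" "\<And>i. i \<in> I \<Longrightarrow> finite (A i)"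
  shows "real (card X) \<le> real (card I) * B"
proof -
  have "card X \<le> card (\<Union>i\<in>I. A i)" using assms by (intro card_mono) auto
  also have "\<dots> \<le> (\<Sum>i\<in>I. card (A i))" using assms(1) by (rule card_UN_le)
  finally have "real (card X) \<le> (\<Sum>i\<in>I. real (card (A i)))" by (simp flip: of_nat_sum)
  also have "\<dots> \<le> real (card I) * B" using assms(2) by (rule sum_bounded_above)
  finally show ?thesis .
qed

section \<open>The parameters and their orders of magnitude\<close>

text \<open>\<open>x\<close> stands for Otter's constant, and a tree with n vertices has weight
  \<open>x ^ n\<close>. Whatever depends on \<open>M\<close> and \<open>x\<close> alone is bounded
  by \<open>ln L\<close>; this is how the smallness of \<iota> enters.\<close>

locale otter =
  fixes x L :: real and M :: nat
  assumes x: "0 < x" "x \<le> 1 / 2"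
    and w_le: "\<And>n. card (utrees n) * x ^ n \<le> ln L"
    and w_up: "\<And>n. M \<le> n \<Longrightarrow> card (utrees n) * x ^ n \<le> real n powr (- 3 / 2)"
    and w_lo: "\<And>n. M \<le> n \<Longrightarrow> real n powr (- 3 / 2) / 200 \<le> card (utrees n) * x ^ n"
    and M: "real M \<le> ln L" and inv_x: "1 / x \<le> ln L" and lnL: "100 \<le> ln L" and L_pos: "0 < L"
begin

definition c :: real where "c = ln L"
definition K :: real where "K = L\<^sup>2"
definition D :: nat where "D = nat \<lfloor>L\<^sup>2\<rfloor>"

lemma c_ge: "100 \<le> c" using lnL by (simp add: c_def)

lemma exp_c: "exp c = L" using L_pos by (simp add: c_def)

lemma L_ge: "1000 * c \<le> L"
proof -
  have "1000 * c \<le> 20 ^ 4 / 5 * c" using c_ge by simp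
  also have "\<dots> \<le> (c / 5) ^ 4 / 5 * c"
    using c_ge by (intro mult_right_mono divide_right_mono power_mono) auto
  also have "\<dots> = (c / real 5) ^ 5" by (simp add: eval_nat_numeral)
  also have "\<dots> \<le> exp c" using c_ge by (intro exp_ge_power) auto
  also have "exp c = L" by (rule exp_c)
  finally show ?thesis .
qed

text \<open>The error terms to come are polynomials of degree at most 3 in \<open>c\<close>; they
  are negligible against \<open>K\<close> = exp(2c).\<close>

lemma K_ge: "10 ^ 7 * c ^ 3 \<le> K"
proof -
  have "10 ^ 7 * c ^ 3 \<le> 20 ^ 7 / 125 * c ^ 3" using c_ge by simp
  also have "\<dots> \<le> (c / 5) ^ 7 / 125 * c ^ 3"
    using c_ge by (intro mult_right_mono divide_right_mono power_mono) auto
  also have "\<dots> = (2 * c / real 10) ^ 10" by (simp add: eval_nat_numeral)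
  also have "\<dots> \<le> exp (2 * c)" using c_ge by (intro exp_ge_power) auto
  also have "\<dots> = K" by (simp only: exp_double exp_c K_def)
  finally show ?thesis .
qed

lemma c_cube: "10 ^ 4 * c \<le> c ^ 3" "1 \<le> c ^ 3" "c\<^sup>2 \<le> c ^ 3"
proof -
  have "100\<^sup>2 * c \<le> c\<^sup>2 * c" using c_ge by (intro mult_right_mono power_mono) auto
  then show "10 ^ 4 * c \<le> c ^ 3" by (simp add: power3_eq_cube power2_eq_square)
  then show "1 \<le> c ^ 3" using c_ge by simp
  show "c\<^sup>2 \<le> c ^ 3" using c_ge by (intro power_increasing) auto
qed

lemma K_ge': "10 ^ 13 \<le> K"
proof -
  have "(10 :: real) ^ 13 \<le> 10 ^ 7 * 100 ^ 3" by simp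
  also have "\<dots> \<le> 10 ^ 7 * c ^ 3" using c_ge by (intro mult_left_mono power_mono) auto
  also have "\<dots> \<le> K" by (rule K_ge)
  finally show ?thesis .
qed

lemma D_le: "real D \<le> L\<^sup>2"
  by (simp add: D_def)

lemma L_ge_exp1: "exp 1 \<le> L"
  using c_ge exp_c by (metis exp_le_cancel_iff one_le_numeral order_trans)

definition \<delta> :: real where "\<delta> = 10 * ln L / L"

lemma \<delta>_le: "\<delta> \<le> 1 / 100" and \<delta>_nonneg: "0 \<le> \<delta>"
proof -
  have "0 < L" by (rule L_pos)
  then show "\<delta> \<le> 1 / 100" using L_ge by (simp add: \<delta>_def c_def[symmetric] field_simps)
  show "0 \<le> \<delta>" using c_ge L_pos by (simp add: \<delta>_def c_def[symmetric])
qed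

lemma card_usim:
  "tsize t \<le> n \<Longrightarrow> real (card {t' \<in> utrees n. usim D L t t'}) \<le> exp (\<delta> * n)"
  unfolding \<delta>_def by (rule card_usim_le[OF L_ge_exp1 D_le])

text \<open>Fewer than c + 1 sizes lie below \<open>M\<close>, each of weight at most
  \<open>c\<close>; the rest is bounded by the convergent sum of k^(-3/2).\<close>

lemma sum_w_le: "(\<Sum>k\<le>m. card (utrees k) * x ^ k) \<le> c\<^sup>2 + 3"
proof -
  have "(\<Sum>k\<le>m. card (utrees k) * x ^ k) \<le> (\<Sum>k\<le>m. (if k < M then c else 0) + (if 1 \<le> k then real k powr (- 3 / 2) else 0))"
  proof (rule sum_mono)
    fix k
    show "card (utrees k) * x ^ k \<le> (if k < M then c else 0) + (if 1 \<le> k then real k powr (- 3 / 2) else 0)"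
    proof (cases "k < M")
      case True
      then show ?thesis using w_le[of k] by (auto simp: c_def intro: add_increasing2)
    next
      case False
      then show ?thesis using w_up[of k] by (cases "k = 0") auto
    qed
  qed
  also have "\<dots> = (\<Sum>k\<le>m. if k < M then c else 0) + (\<Sum>k\<le>m. if 1 \<le> k then real k powr (- 3 / 2) else 0)"
    by (rule sum.distrib)
  also have "(\<Sum>k\<le>m. if k < M then c else 0) \<le> c\<^sup>2"
  proof -
    have "(\<Sum>k\<le>m. if k < M then c else 0) = (\<Sum>k\<in>{k. k \<le> m \<and> k < M}. c)"
      by (subst sum.inter_filter[symmetric]) auto
    also have "\<dots> = real (card {k. k \<le> m \<and> k < M}) * c" by simp
    also have "card {k. k \<le> m \<and> k < M} \<le> card {..<M}" by (intro card_mono) auto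
    then have "real (card {k. k \<le> m \<and> k < M}) * c \<le> c * c"
      using M c_ge by (intro mult_right_mono) (auto simp: c_def)
    finally show ?thesis by (simp add: power2_eq_square)
  qed
  also have "(\<Sum>k\<le>m. if 1 \<le> k then real k powr (- 3 / 2) else 0) = (\<Sum>k=1..m. real k powr (- 3 / 2))"
    by (subst sum.inter_filter[symmetric]) (auto intro: sum.cong)
  also have "\<dots> \<le> 3" by (rule sum_powr_le_3)
  finally show ?thesis by simp
qed

section \<open>Weights of the exceptional patterns\<close>

text \<open>The rate 0.57 leaves room below 0.58 for the factor exp(9 c (c^2 + 3)) from crowded
  vertices, and below 2/3 for exp(\<delta> l) from similar siblings.\<close>

definition q :: real where "q = exp (- (57 / 100) * K)"

text \<open>Gives 5/9 \<le> exp(-0.58), where 5/9 = (10/9)(1/2) is the largest base in Rankin's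
  estimate. The quadratic bound on exp is sharp only near 0, hence the 32 equal factors.\<close>

lemma exp_58: "exp (58 / 100 :: real) \<le> 9 / 5"
proof -
  have "exp (58 / 3200 :: real) \<le> 1 + 58 / 3200 + (58 / 3200)\<^sup>2" by (rule exp_bound) auto
  then have "exp (58 / 3200 :: real) ^ 32 \<le> (1 + 58 / 3200 + (58 / 3200)\<^sup>2) ^ 32" by (intro power_mono) auto
  also have "\<dots> \<le> 9 / 5" by (simp add: field_simps power2_eq_square)
  also have "exp (58 / 3200 :: real) ^ 32 = exp (58 / 100)" by (subst exp_of_nat_mult[symmetric]) simp
  finally show ?thesis .
qed

lemma card_too_many_children_le:
  "card {t \<in> utrees m. K - 1 \<le> size (children t)} * x ^ m \<le> q"
proof -
  have "card {t \<in> utrees m. K - 1 \<le> size (children t)} * x ^ m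
      \<le> x * exp (9 / x * (c\<^sup>2 + 3)) * (10 / 9 * x) powr (K - 1)"
    by (rule card_many_children_le[OF x sum_w_le])
  also have "(10 / 9 * x) powr (K - 1) = (10 / 9 * x) powr K / (10 / 9 * x)"
    using x by (simp add: powr_diff)
  also have "x * exp (9 / x * (c\<^sup>2 + 3)) * ((10 / 9 * x) powr K / (10 / 9 * x)) =
      9 / 10 * (exp (9 / x * (c\<^sup>2 + 3)) * (10 / 9 * x) powr K)"
    using x by simp
  also have "\<dots> \<le> 1 * (exp (9 * c * (c\<^sup>2 + 3)) * exp (- (58 / 100) * K))"
  proof (intro mult_mono)
    have "9 / x * (c\<^sup>2 + 3) \<le> 9 * c * (c\<^sup>2 + 3)"
      using mult_left_mono[OF inv_x, of 9] by (intro mult_right_mono) (auto simp: c_def)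
    then show "exp (9 / x * (c\<^sup>2 + 3)) \<le> exp (9 * c * (c\<^sup>2 + 3))" by simp
    have "(10 / 9 * x) powr K \<le> (5 / 9) powr K"
      using x K_ge' by (intro powr_mono2) auto
    also have "\<dots> \<le> exp (- (58 / 100)) powr K"
      using exp_58 K_ge' by (intro powr_mono2) (auto simp: exp_minus field_simps)
    also have "\<dots> = exp (- (58 / 100) * K)" by (simp add: powr_def)
    finally show "(10 / 9 * x) powr K \<le> exp (- (58 / 100) * K)" .
  qed (use x in auto)
  also have "\<dots> = exp (9 * c * (c\<^sup>2 + 3) + - (58 / 100) * K)" by (simp only: exp_add mult_1_left)
  also have "\<dots> \<le> q"
  proof -
    have "9 * c * (c\<^sup>2 + 3) = 9 * c ^ 3 + 27 * c" by (simp add: power3_eq_cube power2_eq_square algebra_simps)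
    also have "\<dots> \<le> K / 100" using K_ge c_cube c_ge by simp
    finally show ?thesis by (simp add: q_def)
  qed
  finally show ?thesis .
qed

lemma exp_ln2: "exp (2 / 3 :: real) \<le> 2"
  using ln2_ge_two_thirds by (metis exp_le_cancel_iff exp_ln zero_less_numeral)

lemma x_le_exp: "x \<le> exp (- (2 / 3))"
  using mult_mono[OF x(2) exp_ln2] x by (simp add: exp_minus field_simps)

lemma card_long_path_le:
  "card {t \<in> utrees m. \<exists>k. t = pth k \<and> K \<le> real k} * x ^ m \<le> q"
proof (cases "\<exists>k. pth k \<in> utrees m \<and> K \<le> real k")
  case True
  then obtain k where k: "m = Suc k" "K \<le> real k" by auto
  have "{t \<in> utrees m. \<exists>k. t = pth k \<and> K \<le> real k} \<subseteq> {pth k}" using k by auto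
  then have "card {t \<in> utrees m. \<exists>k. t = pth k \<and> K \<le> real k} \<le> 1"
    using card_mono[of "{pth k}"] by fastforce
  then have "card {t \<in> utrees m. \<exists>k. t = pth k \<and> K \<le> real k} * x ^ m \<le> 1 * x ^ m"
    using x by (intro mult_right_mono) auto
  also have "\<dots> \<le> x ^ k" using x k by (simp add: mult_left_le_one_le)
  also have "\<dots> \<le> exp (- (2 / 3)) ^ k" using x_le_exp x by (intro power_mono) auto
  also have "\<dots> = exp (- (2 / 3) * real k)" by (subst exp_of_nat_mult[symmetric]) (simp only: mult.commute)
  also have "\<dots> \<le> q" using k K_ge' by (simp add: q_def)
  finally show ?thesis .
next
  case False
  then have "{t \<in> utrees m. \<exists>k. t = pth k \<and> K \<le> real k} = {}" by blast
  then show ?thesis by (simp only: card.empty) (simp add: q_def)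
qed

text \<open>Once the smaller sibling is chosen, the larger one, of size l, has at most exp(\<delta>
  l) possibilities, and its weight x^l \<le> exp(-2l/3) is hardly compensated.\<close>

lemma card_similar_siblings_le:
  "card {t \<in> utrees m. \<exists>a b A. t = Node (add_mset a (add_mset b A)) \<and> K \<le> tsize a \<and> K \<le> tsize b \<and> usim D L a b}
     * x ^ m \<le> c\<^sup>2 * (real m + 1)\<^sup>2 * q"
proof -
  let ?X = "{t \<in> utrees m. \<exists>a b A. t = Node (add_mset a (add_mset b A)) \<and> K \<le> tsize a \<and> K \<le> tsize b \<and> usim D L a b}"
  \<comment> \<open>The sizes are ordered so that similar trees are counted from the smaller
    sibling; symmetry of \<open>usim\<close> covers the other order.\<close>
  define I where "I = {(k, l). k \<le> l \<and> K \<le> real l \<and> k + l < m}"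
  have I: "I \<subseteq> {..m} \<times> {..m}" by (auto simp: I_def)
  then have finI: "finite I" by (rule finite_subset) auto
  define S where "S = (\<lambda>(k, l). SIGMA a:utrees k. {b \<in> utrees l. usim D L a b} \<times> utrees (m - k - l))"
  define h where "h = (\<lambda>(a, b, s). Node (add_mset a (add_mset b (children s))))"
  have finS: "finite (S i)" for i
    unfolding S_def by (cases i) (auto intro!: finite_SigmaI finite_subset[OF _ finite_utrees])
  have sub: "?X \<subseteq> (\<Union>i\<in>I. h ` S i)"
  proof
    fix t assume "t \<in> ?X"
    then obtain a b A where t: "tsize t = m" "t = Node (add_mset a (add_mset b A))"
      "K \<le> tsize a" "K \<le> tsize b" "usim D L a b" by auto
    have *: "t \<in> (\<Union>i\<in>I. h ` S i)"
      if "t = Node (add_mset a (add_mset b A))" "K \<le> tsize b" "usim D L a b" "tsize a \<le> tsize b" for a b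
    proof -
      have m: "tsize (Node A) + tsize a + tsize b = m" using t(1) that(1) by simp
      have "tsize a + tsize b < m" using m tsize_pos[of "Node A"] by linarith
      then have "(tsize a, tsize b) \<in> I" using that by (simp add: I_def)
      moreover have "(a, b, Node A) \<in> S (tsize a, tsize b)" using that m by (simp add: S_def)
      moreover have "t = h (a, b, Node A)" using that by (simp add: h_def)
      ultimately show ?thesis by blast
    qed
    show "t \<in> (\<Union>i\<in>I. h ` S i)"
    proof (cases "tsize a \<le> tsize b")
      case True
      then show ?thesis using * t by blast
    next
      case False
      then show ?thesis using *[of b a] t usim_sym by (simp add: add_mset_commute)
    qed
  qed
  have card_S: "card (S (k, l)) * x ^ m \<le> c\<^sup>2 * q" if kl: "(k, l) \<in> I" for k l
  proof -
    define j where "j = m - k - l"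
    have finQ: "finite {b. tsize b = l \<and> usim D L a b}" for a
      by (rule finite_subset[OF _ finite_utrees[of l]]) auto
    have m: "m = k + l + j" using kl by (auto simp: I_def j_def)
    have "card (S (k, l)) = (\<Sum>a\<in>utrees k. card {b \<in> utrees l. usim D L a b} * card (utrees j))"
      unfolding S_def j_def split_conv
      by (subst card_SigmaI) (auto simp: card_cartesian_product finQ)
    then have "real (card (S (k, l))) = (\<Sum>a\<in>utrees k. real (card {b \<in> utrees l. usim D L a b}) * card (utrees j))"
      by simp
    also have "\<dots> \<le> (\<Sum>a\<in>utrees k. exp (\<delta> * l) * card (utrees j))"
      using kl by (intro sum_mono mult_right_mono card_usim) (auto simp: I_def)
    also have "\<dots> = card (utrees k) * (exp (\<delta> * l) * card (utrees j))" by simp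
    finally have "card (S (k, l)) * x ^ m \<le> card (utrees k) * (exp (\<delta> * l) * card (utrees j)) * x ^ m"
      using x by (intro mult_right_mono) auto
    also have "\<dots> = (card (utrees k) * x ^ k) * (card (utrees j) * x ^ j) * (exp (\<delta> * l) * x ^ l)"
      by (simp add: m power_add)
    also have "\<dots> \<le> c * c * q"
    proof (intro mult_mono)
      have "exp (\<delta> * l) * x ^ l \<le> exp (\<delta> * l) * exp (- (2 / 3)) ^ l"
        using x x_le_exp by (intro mult_left_mono power_mono) auto
      also have "exp (- (2 / 3) :: real) ^ l = exp (- (2 / 3) * l)"
        by (subst exp_of_nat_mult[symmetric]) (simp only: mult.commute)
      also have "exp (\<delta> * l) * exp (- (2 / 3) * l) = exp ((\<delta> - 2 / 3) * l)"
        by (simp add: algebra_simps flip: exp_add)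
      also have "\<dots> \<le> q"
      proof -
        have "(\<delta> - 2 / 3) * l \<le> - (57 / 100) * l" using \<delta>_le by (intro mult_right_mono) auto
        also have "\<dots> \<le> - (57 / 100) * K" using kl by (auto simp: I_def)
        finally show ?thesis by (simp add: q_def)
      qed
      finally show "exp (\<delta> * l) * x ^ l \<le> q" .
    qed (use w_le x c_ge in \<open>auto simp: c_def\<close>)
    finally show ?thesis by (simp add: power2_eq_square)
  qed
  have "real (card (h ` S i)) \<le> c\<^sup>2 * q / x ^ m" if "i \<in> I" for i
  proof -
    have "real (card (h ` S i)) \<le> real (card (S i))" by (intro of_nat_mono card_image_le finS)
    then have "real (card (h ` S i)) * x ^ m \<le> real (card (S i)) * x ^ m"
      using x by (intro mult_right_mono) auto
    also have "\<dots> \<le> c\<^sup>2 * q" using card_S[of "fst i" "snd i"] that by simp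
    finally show ?thesis using x by (simp add: field_simps)
  qed
  then have "real (card ?X) \<le> real (card I) * (c\<^sup>2 * q / x ^ m)"
    using finI finS sub by (intro card_le_card_mult) auto
  also have "card I \<le> card ({..m} \<times> {..m})" using I by (intro card_mono) auto
  then have "card I \<le> Suc m * Suc m" by (simp only: card_cartesian_product card_atMost)
  then have "real (card I) \<le> real (Suc m * Suc m)" by (simp only: of_nat_le_iff)
  then have "real (card I) \<le> (real m + 1)\<^sup>2" by (simp add: power2_eq_square algebra_simps)
  then have "real (card I) * (c\<^sup>2 * q / x ^ m) \<le> (real m + 1)\<^sup>2 * (c\<^sup>2 * q / x ^ m)"
    using x by (intro mult_right_mono) (auto simp: q_def)
  finally show ?thesis using x by (simp add: field_simps)
qed

lemma card_bad_roots_le: "card {t \<in> utrees m. \<not> root_ok L t} * x ^ m \<le> 3 * c\<^sup>2 * (real m + 1)\<^sup>2 * q"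
proof -
  let ?X1 = "{t \<in> utrees m. K - 1 \<le> size (children t)}"
  let ?X2 = "{t \<in> utrees m. \<exists>k. t = pth k \<and> K \<le> real k}"
  let ?X3 = "{t \<in> utrees m. \<exists>a b A. t = Node (add_mset a (add_mset b A)) \<and> K \<le> tsize a \<and> K \<le> tsize b \<and> usim D L a b}"
  have fin: "finite {t \<in> utrees m. P t}" for P by (rule finite_subset[OF _ finite_utrees[of m]]) auto
  have "{t \<in> utrees m. \<not> root_ok L t} \<subseteq> ?X1 \<union> (?X2 \<union> ?X3)"
    unfolding root_ok_def K_def D_def by fastforce
  then have "card {t \<in> utrees m. \<not> root_ok L t} \<le> card (?X1 \<union> (?X2 \<union> ?X3))"
    using fin by (intro card_mono finite_UnI)
  also have "\<dots> \<le> card ?X1 + (card ?X2 + card ?X3)"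
    by (meson add_left_mono card_Un_le order_trans)
  finally have "real (card {t \<in> utrees m. \<not> root_ok L t}) \<le> card ?X1 + (card ?X2 + card ?X3)"
    by (simp flip: of_nat_add)
  then have "card {t \<in> utrees m. \<not> root_ok L t} * x ^ m \<le> (card ?X1 + (card ?X2 + card ?X3)) * x ^ m"
    using x by (intro mult_right_mono) auto
  also have "\<dots> = card ?X1 * x ^ m + (card ?X2 * x ^ m + card ?X3 * x ^ m)"
    by (simp only: distrib_right of_nat_add)
  also have "\<dots> \<le> q + (q + c\<^sup>2 * (real m + 1)\<^sup>2 * q)"
    by (intro add_mono card_too_many_children_le card_long_path_le card_similar_siblings_le)
  also have "\<dots> \<le> 3 * c\<^sup>2 * (real m + 1)\<^sup>2 * q"
  proof -
    have "1 * 1 \<le> c\<^sup>2 * (real m + 1)\<^sup>2" using c_ge by (intro mult_mono) (auto simp: one_le_power)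
    then have "1 * q \<le> c\<^sup>2 * (real m + 1)\<^sup>2 * q" by (intro mult_right_mono) (auto simp: q_def)
    moreover have "3 * c\<^sup>2 * (real m + 1)\<^sup>2 * q = 3 * (c\<^sup>2 * (real m + 1)\<^sup>2 * q)" by simp
    ultimately show ?thesis by linarith
  qed
  finally show ?thesis .
qed

lemma not_good_plug: "\<not> good L t \<Longrightarrow> \<exists>C s. t = plug C s \<and> \<not> root_ok L s"
proof (induction t)
  case (Node A)
  show ?case
  proof (cases "root_ok L (Node A)")
    case True
    then obtain a where a: "a \<in># A" "\<not> good L a" using Node.prems good_Node by blast
    then obtain C s where "a = plug C s" "\<not> root_ok L s" using Node.IH by blast
    then show ?thesis using a(1)
      by (intro exI[of _ "(A - {#a#}) # C"] exI[of _ s]) simp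
  next
    case False
    then show ?thesis by (intro exI[of _ "[]"] exI[of _ "Node A"]) simp
  qed
qed

lemma card_ctxts_le: "card (ctxts j) * x ^ j \<le> (real j + 1) * c"
proof (cases "j = 0")
  case True
  then show ?thesis using c_ge by (simp add: ctxts_0)
next
  case False
  have "card (ctxts j) \<le> j * card (utrees j)" using ctxts_finite_card False by auto
  then have "real (card (ctxts j)) \<le> j * real (card (utrees j))" by (simp flip: of_nat_mult)
  then have "card (ctxts j) * x ^ j \<le> j * real (card (utrees j)) * x ^ j"
    using x by (intro mult_right_mono) auto
  also have "\<dots> = j * (card (utrees j) * x ^ j)" by simp
  also have "\<dots> \<le> j * c" using w_le[of j] by (intro mult_left_mono) (auto simp: c_def)
  also have "\<dots> \<le> (real j + 1) * c" using c_ge by (intro mult_right_mono) auto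
  finally show ?thesis .
qed

text \<open>A bad subtree on m vertices and its context determine the tree, and their weights
  multiply. The four powers of n + 1 come from m, from the context and from the two sibling
  sizes.\<close>

lemma card_not_good_le: "card {t \<in> utrees n. \<not> good L t} * x ^ n \<le> 3 * c ^ 3 * (real n + 1) ^ 4 * q"
proof -
  let ?B = "\<lambda>m. {t \<in> utrees m. \<not> root_ok L t}"
  let ?A = "\<lambda>m. (\<lambda>(C, s). plug C s) ` (ctxts (n - m) \<times> ?B m)"
  have finB: "finite (?B m)" for m by (rule finite_subset[OF _ finite_utrees[of m]]) auto
  have sub: "{t \<in> utrees n. \<not> good L t} \<subseteq> (\<Union>m\<in>{..n}. ?A m)"
  proof
    fix t assume t: "t \<in> {t \<in> utrees n. \<not> good L t}"
    then obtain C s where Cs: "t = plug C s" "\<not> root_ok L s" using not_good_plug by blast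
    then have "csize C + tsize s = n" using t by (simp add: tsize_plug)
    then have "tsize s \<in> {..n}" "(C, s) \<in> ctxts (n - tsize s) \<times> ?B (tsize s)"
      using Cs by (auto simp: ctxts_def)
    then show "t \<in> (\<Union>m\<in>{..n}. ?A m)" using Cs(1) by (intro UN_I[of "tsize s"] image_eqI[of _ _ "(C, s)"]) auto
  qed
  have "real (card (?A m)) \<le> 3 * c ^ 3 * (real n + 1) ^ 3 * q / x ^ n" if "m \<in> {..n}" for m
  proof -
    have mn: "m \<le> n" using that by simp
    then have xn: "x ^ n = x ^ (n - m) * x ^ m" by (simp flip: power_add)
    have "card (?A m) \<le> card (ctxts (n - m) \<times> ?B m)" by (rule card_image_le) (use finB in auto)
    also have "\<dots> = card (ctxts (n - m)) * card (?B m)" by (rule card_cartesian_product)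
    finally have "card (?A m) * x ^ n \<le> real (card (ctxts (n - m)) * card (?B m)) * x ^ n"
      using x by (intro mult_right_mono of_nat_mono) auto
    also have "real (card (ctxts (n - m)) * card (?B m)) * x ^ n =
        (card (ctxts (n - m)) * x ^ (n - m)) * (card (?B m) * x ^ m)"
      unfolding xn by simp
    also have "\<dots> \<le> ((real (n - m) + 1) * c) * (3 * c\<^sup>2 * (real m + 1)\<^sup>2 * q)"
      using x c_ge by (intro mult_mono card_ctxts_le card_bad_roots_le) auto
    also have "\<dots> \<le> ((real n + 1) * c) * (3 * c\<^sup>2 * (real n + 1)\<^sup>2 * q)"
      using mn c_ge by (intro mult_mono power_mono) (auto simp: q_def)
    also have "\<dots> = 3 * c ^ 3 * (real n + 1) ^ 3 * q" by (simp add: power2_eq_square power3_eq_cube)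
    finally show ?thesis using x by (simp add: field_simps)
  qed
  then have "real (card {t \<in> utrees n. \<not> good L t}) \<le> real (card {..n}) * (3 * c ^ 3 * (real n + 1) ^ 3 * q / x ^ n)"
    using sub finB by (intro card_le_card_mult) auto
  then have "card {t \<in> utrees n. \<not> good L t} * x ^ n \<le> (real n + 1) * (3 * c ^ 3 * (real n + 1) ^ 3 * q)"
    using x by (simp add: field_simps)
  then show ?thesis by (simp add: eval_nat_numeral mult_ac)
qed


section \<open>Gluing good trees\<close>

definition good_trees :: "nat \<Rightarrow> utree set" where
  "good_trees n = {t \<in> utrees n. good L t}"

lemma finite_good_trees [simp]: "finite (good_trees n)"
  by (rule finite_subset[OF _ finite_utrees[of n]]) (auto simp: good_trees_def)

definition S :: nat where "S = nat \<lceil>exp (51 / 500 * K)\<rceil>"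
definition \<eta> :: real where "\<eta> = 5 * exp (- (1 / 10) * K)"

lemma S_ge: "exp (51 / 500 * K) \<le> S"
  by (simp add: S_def)

lemma S_le: "S \<le> exp (51 / 500 * K) + 1"
proof -
  have "0 < \<lceil>exp (51 / 500 * K)\<rceil>" by simp
  then have "real S = real_of_int \<lceil>exp (51 / 500 * K)\<rceil>" by (simp add: S_def)
  then show ?thesis using of_int_ceiling_le_add_one[of "exp (51 / 500 * K)"] by simp
qed

lemma exp_K_ge: "K \<le> exp (51 / 500 * K)"
proof -
  have "(K * 1) * 1 \<le> (K * K) * (51 / 1000)\<^sup>2"
    using K_ge' by (simp add: power2_eq_square field_simps)
  also have "\<dots> = (51 / 500 * K / real 2) ^ 2" by (simp add: power2_eq_square)
  also have "\<dots> \<le> exp (51 / 500 * K)" using K_ge' by (intro exp_ge_power) auto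
  finally show ?thesis by simp
qed

lemma S_bounds: "K \<le> S" "M \<le> S" "1 \<le> S"
proof -
  show 1: "K \<le> S" using exp_K_ge S_ge by linarith
  have "c \<le> K" using K_ge c_cube c_ge by simp
  then have "real M \<le> S" using M 1 by (simp add: c_def)
  then show "M \<le> S" by simp
  have "1 \<le> real S" using 1 K_ge' by simp
  then show "1 \<le> S" by simp
qed

lemma \<eta>_bounds: "0 < \<eta>" "\<eta> \<le> 1 / 100"
proof -
  show "0 < \<eta>" by (simp add: \<eta>_def)
  have "500 \<le> 1 / 10 * K" using K_ge' by simp
  also have "\<dots> \<le> exp (1 / 10 * K)" using exp_ge_add_one_self[of "1 / 10 * K"] by linarith
  finally have "500 \<le> exp (1 / 10 * K)" .
  then show "\<eta> \<le> 1 / 100" unfolding \<eta>_def by (simp add: exp_minus field_simps)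
qed

text \<open>The bad trees take away at most half of the lower bound for all trees. The range stops
  at 2S + 2 because every larger tree can be assembled from a root and two parts of size at least
  \<open>S\<close>.\<close>

lemma card_good_trees_base:
  assumes n: "S \<le> n" "n \<le> 2 * S + 2"
  shows "real n powr (- 3 / 2) / 400 \<le> card (good_trees n) * x ^ n"
proof -
  define E where "E = exp (51 / 500 * K)"
  have E1: "1 \<le> E" using exp_K_ge K_ge' by (simp add: E_def)
  have "real n \<le> 2 * real S + 2" using n(2) by linarith
  moreover have "real S \<le> E + 1" using S_le unfolding E_def .
  ultimately have nE: "real n + 1 \<le> 7 * E" using E1 by linarith
  have n1: "1 \<le> n" using n S_bounds by linarith
  have "real n powr (3 / 2) \<le> (7 * E) powr (3 / 2)" using nE by (intro powr_mono2) auto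
  also have "\<dots> = 7 powr (3 / 2) * E powr (3 / 2)" using E1 by (simp add: powr_mult)
  also have "\<dots> \<le> 7 powr 2 * E powr (3 / 2)" by (intro mult_right_mono powr_mono) auto
  also have "\<dots> = 49 * E powr (3 / 2)" by simp
  finally have n32: "real n powr (3 / 2) \<le> 49 * E powr (3 / 2)" .
  have "3 * c ^ 3 * (real n + 1) ^ 4 * q * (400 * real n powr (3 / 2)) \<le>
      3 * c ^ 3 * (7 * E) ^ 4 * q * (400 * (49 * E powr (3 / 2)))"
    using nE n32 c_ge by (intro mult_mono power_mono) (auto simp: q_def)
  also have "\<dots> = 141178800 * c ^ 3 * (E ^ 4 * E powr (3 / 2) * q)" by (simp add: power_mult_distrib)
  \<comment> \<open>The exponents are 4 * 0.102 + 1.5 * 0.102 - 0.57 = -0.009.\<close>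
  also have "E ^ 4 * E powr (3 / 2) * q = exp (- (9 / 1000) * K)"
  proof -
    have "E ^ 4 = exp (real 4 * (51 / 500 * K))" unfolding E_def by (rule exp_of_nat_mult[symmetric])
    moreover have "E powr (3 / 2) = exp (3 / 2 * (51 / 500 * K))" by (simp add: E_def powr_def)
    ultimately have "E ^ 4 * E powr (3 / 2) * q =
        exp (real 4 * (51 / 500 * K) + 3 / 2 * (51 / 500 * K) + - (57 / 100) * K)"
      unfolding q_def by (simp only: exp_add)
    then show ?thesis by simp
  qed
  also have "141178800 * c ^ 3 * exp (- (9 / 1000) * K) \<le> 1"
  proof -
    have 1: "9 * 10 ^ 4 * c ^ 3 \<le> 9 / 1000 * K" using K_ge by simp
    \<comment> \<open>A square is produced here because the exponential is bounded below by a
      square; the numerical factor disappears in it.\<close>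
    have "141178800 * u \<le> (45000 * u) * (45000 * u)" if "1 \<le> u" for u :: real
    proof -
      have "u * 1 \<le> u * u" using that by (intro mult_left_mono) auto
      then show ?thesis using that by simp
    qed
    from this[OF c_cube(2)]
    have "141178800 * c ^ 3 \<le> (45000 * c ^ 3) * (45000 * c ^ 3)" .
    also have "\<dots> \<le> (9 / 1000 * K / real 2) ^ 2"
      unfolding power2_eq_square using 1 c_ge K_ge' by (intro mult_mono) auto
    also have "\<dots> \<le> exp (9 / 1000 * K)" using K_ge' by (intro exp_ge_power) auto
    finally show ?thesis by (simp add: exp_minus field_simps)
  qed
  finally have "3 * c ^ 3 * (real n + 1) ^ 4 * q * (400 * real n powr (3 / 2)) \<le> 1" .
  then have small: "3 * c ^ 3 * (real n + 1) ^ 4 * q \<le> real n powr (- 3 / 2) / 400"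
    using n1 by (simp add: powr_minus field_simps)
  have "utrees n = good_trees n \<union> {t \<in> utrees n. \<not> good L t}" by (auto simp: good_trees_def)
  then have "card (utrees n) \<le> card (good_trees n) + card {t \<in> utrees n. \<not> good L t}"
    by (metis card_Un_le)
  then have "real (card (utrees n)) \<le> card (good_trees n) + real (card {t \<in> utrees n. \<not> good L t})"
    by (simp flip: of_nat_add)
  then have "card (utrees n) * x ^ n \<le> (card (good_trees n) + real (card {t \<in> utrees n. \<not> good L t})) * x ^ n"
    using x by (intro mult_right_mono) auto
  also have "\<dots> = card (good_trees n) * x ^ n + card {t \<in> utrees n. \<not> good L t} * x ^ n"
    by (rule distrib_right)
  finally have "real n powr (- 3 / 2) / 200 \<le> card (good_trees n) * x ^ n + real n powr (- 3 / 2) / 400"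
    using card_not_good_le[of n] small w_lo[of n] n S_bounds by linarith
  then show ?thesis by simp
qed

definition y :: real where "y = x * exp \<eta>"

lemma y_bounds: "0 < y" "y * exp \<delta> \<le> 10 / 19" "x \<le> y"
proof -
  show "0 < y" using x by (simp add: y_def)
  have "exp (\<eta> + \<delta>) \<le> exp (1 / 50)" using \<eta>_bounds \<delta>_le by simp
  also have "\<dots> \<le> 1 + 1 / 50 + (1 / 50)\<^sup>2" by (rule exp_bound) auto
  also have "\<dots> \<le> 20 / 19" by (simp add: power2_eq_square)
  finally have "x * exp (\<eta> + \<delta>) \<le> 1 / 2 * (20 / 19)" using x by (intro mult_mono) auto
  then show "y * exp \<delta> \<le> 10 / 19" by (simp add: y_def exp_add)
  show "x \<le> y" using x \<eta>_bounds by (simp add: y_def)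
qed

lemma pow_19: "real n \<le> (19 / 10) ^ n"
proof (induction n)
  case (Suc n)
  show ?case
  proof (cases "n \<le> 1")
    case True
    then consider "n = 0" | "n = 1" by linarith
    then show ?thesis by cases auto
  next
    case False
    then have "real (Suc n) \<le> 19 / 10 * n" by simp
    also have "\<dots> \<le> 19 / 10 * (19 / 10) ^ n" using Suc by simp
    finally show ?thesis by simp
  qed
qed simp

text \<open>Good trees number at least 4 y^(-n-1), while y exp(\<delta>) \<le> 10/19; so they
  outnumber exp(\<delta> n) by the factor 4 (19/10)^(n+1). The version with a linear factor is for
  comparisons with all descendants.\<close>

lemma good_dominates:
  assumes "4 \<le> card (good_trees n) * y ^ (n + 1)"
  shows "4 * real n * exp (\<delta> * n) \<le> card (good_trees n)" "2 * exp (\<delta> * n) \<le> card (good_trees n)"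
proof -
  have *: "4 * (19 / 10) ^ (n + 1) * exp (\<delta> * n) \<le> card (good_trees n)"
  proof -
    have "exp (\<delta> * n) * y ^ (n + 1) \<le> exp (\<delta> * (n + 1)) * y ^ (n + 1)"
      using \<delta>_nonneg y_bounds by (intro mult_right_mono) (auto simp: algebra_simps)
    also have "exp (\<delta> * (n + 1)) = exp \<delta> ^ (n + 1)"
      by (subst exp_of_nat_mult[symmetric]) (simp only: mult.commute of_nat_add of_nat_1)
    also have "exp \<delta> ^ (n + 1) * y ^ (n + 1) = (y * exp \<delta>) ^ (n + 1)"
      by (simp only: power_mult_distrib mult.commute)
    also have "\<dots> \<le> (10 / 19) ^ (n + 1)" using y_bounds by (intro power_mono) auto
    finally have "4 * (19 / 10) ^ (n + 1) * (exp (\<delta> * n) * y ^ (n + 1)) \<le> 4 * (19 / 10) ^ (n + 1) * (10 / 19) ^ (n + 1)"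
      by (intro mult_left_mono) auto
    also have "\<dots> = 4 * (19 / 10 * (10 / 19)) ^ (n + 1)" by (simp only: power_mult_distrib mult.assoc)
    also have "\<dots> = 4" by simp
    also note assms
    finally have "(4 * (19 / 10) ^ (n + 1) * exp (\<delta> * n)) * y ^ (n + 1) \<le> card (good_trees n) * y ^ (n + 1)"
      by (simp only: mult.assoc)
    then show ?thesis using y_bounds by (simp only: mult_le_cancel_right_pos zero_less_power)
  qed
  have "4 * real n * exp (\<delta> * n) \<le> 4 * (19 / 10) ^ (n + 1) * exp (\<delta> * n)"
    using pow_19[of "n + 1"] by (intro mult_right_mono mult_left_mono) auto
  then show "4 * real n * exp (\<delta> * n) \<le> card (good_trees n)" using * by linarith
  have "1 \<le> (19 / 10 :: real) ^ (n + 1)" by (intro one_le_power) auto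
  then have "2 * exp (\<delta> * n) \<le> 4 * (19 / 10) ^ (n + 1) * exp (\<delta> * n)"
    by (intro mult_right_mono) auto
  then show "2 * exp (\<delta> * n) \<le> card (good_trees n)" using * by linarith
qed

text \<open>A root with two children meets the degree bound and is not the start of an arm, so only
  similarity of the two subtrees could make it bad.\<close>

lemma good_join:
  assumes "good L s" "good L t" "\<not> usim D L s t"
  shows "good L (Node {#s, t#})"
proof -
  have "root_ok L (Node {#s, t#})"
    unfolding root_ok_def
  proof (intro conjI allI impI)
    show "real (size (children (Node {#s, t#}))) + 1 \<le> L\<^sup>2" using K_ge' by (simp add: K_def)
    show "real k < L\<^sup>2" if "Node {#s, t#} = pth k" for k using that by (cases k) auto
    show "\<not> usim (nat \<lfloor>L\<^sup>2\<rfloor>) L a b" if "Node {#s, t#} = Node (add_mset a (add_mset b A))" for a b A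
    proof -
      have "(a = s \<and> b = t) \<or> (a = t \<and> b = s)" using that by (auto simp: add_eq_conv_ex)
      then show ?thesis using assms(3) usim_sym unfolding D_def by blast
    qed
  qed
  then show ?thesis using assms by (simp add: good_Node)
qed

lemma card_join_image:
  assumes "finite P"
  shows "real (card P) / 2 \<le> card ((\<lambda>(s, t). Node {#s, t#}) ` P)"
proof -
  let ?f = "\<lambda>(s, t). Node {#s, t#}"
  have "real (card P) \<le> real (card (?f ` P)) * 2"
  proof (rule card_le_card_mult[where A = "\<lambda>u. {p \<in> P. ?f p = u}"])
    fix u assume "u \<in> ?f ` P"
    then obtain s t where u: "u = Node {#s, t#}" by auto
    have "{p \<in> P. ?f p = u} \<subseteq> {(s, t), (t, s)}" unfolding u by (auto simp: add_eq_conv_ex)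
    then have "card {p \<in> P. ?f p = u} \<le> card {(s, t), (t, s)}" by (intro card_mono) auto
    also have "\<dots> \<le> 2" using card_insert_le_m1[of 2 "{(t, s)}" "(s, t)"] by simp
    finally show "real (card {p \<in> P. ?f p = u}) \<le> 2" by simp
  qed (use assms in auto)
  then show ?thesis by simp
qed

text \<open>At least half of the good trees of the larger size are not similar to a given
  \<open>s\<close>, and forgetting the order of the two subtrees costs another factor 2. With a
  \<le> b the similar trees can be counted from \<open>s\<close>.\<close>

lemma card_good_trees_step:
  assumes ab: "a \<le> b" "n = a + b + 1" and b: "4 \<le> card (good_trees b) * y ^ (b + 1)"
  shows "card (good_trees a) * real (card (good_trees b)) / 4 \<le> card (good_trees n)"
proof -
  let ?Q = "\<lambda>s. {t \<in> utrees b. usim D L s t}"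
  define P where "P = (SIGMA s:good_trees a. good_trees b - ?Q s)"
  have finQ: "finite (?Q s)" for s by (rule finite_subset[OF _ finite_utrees[of b]]) auto
  have "(\<lambda>(s, t). Node {#s, t#}) ` P \<subseteq> good_trees n"
    using ab by (auto simp: P_def good_trees_def tsize.simps intro!: good_join)
  then have "card ((\<lambda>(s, t). Node {#s, t#}) ` P) \<le> card (good_trees n)" by (intro card_mono) auto
  then have 1: "real (card P) / 2 \<le> card (good_trees n)"
    using card_join_image[of P] by (simp add: P_def)
  have "card (good_trees a) * (card (good_trees b) / 2) = (\<Sum>s\<in>good_trees a. card (good_trees b) / 2)" by simp
  also have "\<dots> \<le> (\<Sum>s\<in>good_trees a. real (card (good_trees b - ?Q s)))"
  proof (rule sum_mono)
    fix s assume s: "s \<in> good_trees a"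
    have "card (good_trees b) - card (?Q s) \<le> card (good_trees b - ?Q s)"
      using finQ by (rule diff_card_le_card_Diff)
    moreover have "real (card (?Q s)) \<le> exp (\<delta> * b)" using s ab by (intro card_usim) (auto simp: good_trees_def)
    moreover have "2 * exp (\<delta> * b) \<le> card (good_trees b)" by (rule good_dominates(2)[OF b])
    ultimately show "card (good_trees b) / 2 \<le> real (card (good_trees b - ?Q s))" by linarith
  qed
  also have "\<dots> = real (card P)" unfolding P_def by (simp add: card_SigmaI)
  finally show ?thesis using 1 by simp
qed

text \<open>Up to 2S + 2 the gain exp(\<eta> n) outweighs the polynomial deficit of the starting
  trees. Beyond, the bounds for the two parts multiply to 16 and the gluing divides by 4.\<close>

lemma card_good_trees_growth: "S \<le> n \<Longrightarrow> 4 \<le> card (good_trees n) * y ^ (n + 1)"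
proof (induction n rule: less_induct)
  case (less n)
  show ?case
  proof (cases "n \<le> 2 * S + 2")
    case True
    define E where "E = exp (51 / 500 * K)"
    have n1: "1 \<le> n" using less.prems S_bounds by linarith
    have E1: "1 \<le> E" using exp_K_ge K_ge' by (simp add: E_def)
    have "real n \<le> 2 * real S + 2" using True by linarith
    moreover have "real S \<le> E + 1" using S_le unfolding E_def .
    ultimately have nE: "real n \<le> 7 * E" using E1 by linarith
    have "1600 * c * real n powr (3 / 2) \<le> exp (\<eta> * n)"
    proof -
      have "real n powr (3 / 2) \<le> real n powr 2" using n1 by (intro powr_mono) auto
      also have "\<dots> = (real n)\<^sup>2" using n1 by (simp add: powr_numeral)
      also have "\<dots> \<le> (7 * E)\<^sup>2" by (rule power_mono[OF nE]) simp
      finally have "1600 * c * real n powr (3 / 2) \<le> 1600 * c * (7 * E)\<^sup>2"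
        using c_ge by (intro mult_left_mono) auto
      also have "\<dots> = (78400 * c) * E\<^sup>2" by (simp add: power_mult_distrib)
      also have "\<dots> \<le> exp (1 / 10 * K) * E\<^sup>2"
      proof (rule mult_right_mono)
        have "78400 * c \<le> 1 / 10 * K" using K_ge c_cube c_ge by simp
        then show "78400 * c \<le> exp (1 / 10 * K)" using exp_ge_add_one_self[of "1 / 10 * K"] by linarith
      qed simp
      also have "\<dots> = exp (1 / 10 * K + 2 * (51 / 500 * K))" unfolding E_def exp_add exp_double ..
      also have "\<dots> \<le> exp (\<eta> * n)"
      proof -
        have "K * 1 \<le> K * (10 ^ 13 * (1 / 1000)\<^sup>2)" using K_ge' by (intro mult_left_mono) (auto simp: power2_eq_square)
        also have "\<dots> \<le> K * (K * (1 / 1000)\<^sup>2)" using K_ge' by (intro mult_left_mono mult_right_mono) auto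
        also have "\<dots> = (2 / 1000 * K / real 2) ^ 2" by (simp add: power2_eq_square)
        also have "\<dots> \<le> exp (2 / 1000 * K)" using K_ge' by (intro exp_ge_power) auto
        finally have 1: "K \<le> exp (2 / 1000 * K)" by simp
        \<comment> \<open>Here the surplus of 0.102 over 0.1 is used: \<eta> n is at least 5
          exp(0.002 K), which exceeds 5 K.\<close>
        have "1 / 10 * K + 2 * (51 / 500 * K) \<le> 5 * K" using K_ge' by simp
        also have "\<dots> \<le> 5 * exp (2 / 1000 * K)" using 1 by simp
        also have "\<dots> = \<eta> * E" by (simp add: \<eta>_def E_def flip: exp_add)
        also have "\<dots> \<le> \<eta> * n" using \<eta>_bounds S_ge less.prems by (intro mult_left_mono) (auto simp: E_def)
        finally show ?thesis by simp
      qed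
      finally show ?thesis .
    qed
    then have 1: "1600 * c * real n powr (3 / 2) \<le> exp (\<eta> * (n + 1))"
      using \<eta>_bounds by (smt (verit) exp_le_cancel_iff mult_left_mono of_nat_add of_nat_1)
    have "1600 * c \<le> real n powr (- 3 / 2) * exp (\<eta> * (n + 1))"
      using 1 n1 by (simp add: powr_minus field_simps)
    then have "1600 * c * x \<le> (real n powr (- 3 / 2) * exp (\<eta> * (n + 1))) * x"
      using x by (intro mult_right_mono) auto
    \<comment> \<open>The surplus factor \<open>x\<close> in y^(n+1) may be small, but not below
      1/c; this is why \<open>c\<close> was put on the left side.\<close>
    moreover have "1 \<le> c * x" using inv_x x by (simp add: c_def field_simps)
    ultimately have "4 \<le> (real n powr (- 3 / 2) / 400 * (x * exp (\<eta> * (n + 1))))"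
      by (simp add: field_simps)
    also have "\<dots> \<le> (card (good_trees n) * x ^ n) * (x * exp (\<eta> * (n + 1)))"
      using card_good_trees_base[OF less.prems True] x by (intro mult_right_mono) auto
    also have "exp (\<eta> * (n + 1)) = exp \<eta> ^ (n + 1)"
      by (subst exp_of_nat_mult[symmetric]) (simp only: mult.commute of_nat_add of_nat_1)
    also have "(card (good_trees n) * x ^ n) * (x * exp \<eta> ^ (n + 1)) = card (good_trees n) * y ^ (n + 1)"
      by (simp add: y_def power_mult_distrib mult_ac)
    finally show ?thesis .
  next
    case False
    \<comment> \<open>As n > 2S + 2, even the smaller part has at least \<open>S\<close>
      vertices.\<close>
    define a b where "a = (n - 1) div 2" and "b = n - 1 - a"
    have ab: "a \<le> b" "n = a + b + 1" "S \<le> a" "a < n" "b < n" using False by (auto simp: a_def b_def)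
    have "S \<le> b" using ab by linarith
    have a4: "4 \<le> card (good_trees a) * y ^ (a + 1)" and b4: "4 \<le> card (good_trees b) * y ^ (b + 1)"
      using less.IH ab \<open>S \<le> b\<close> by auto
    have "4 * 4 \<le> (card (good_trees a) * y ^ (a + 1)) * (card (good_trees b) * y ^ (b + 1))"
      using a4 b4 by (intro mult_mono) auto
    also have "\<dots> = (card (good_trees a) * real (card (good_trees b))) * y ^ (n + 1)"
      using ab(2) by (simp add: power_add mult_ac)
    finally have "4 \<le> (card (good_trees a) * real (card (good_trees b)) / 4) * y ^ (n + 1)" by simp
    also have "\<dots> \<le> card (good_trees n) * y ^ (n + 1)"
      using card_good_trees_step[OF ab(1,2) b4] y_bounds by (intro mult_right_mono) auto
    finally show ?thesis .
  qed
qed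

section \<open>The two halves below the top root\<close>

lemma card_subs_le: "finite (subs t) \<and> card (subs t) \<le> tsize t"
proof (induction t)
  case (Node A)
  have fin: "finite (\<Union>a\<in>set_mset A. subs a)" using Node by auto
  have "card (\<Union>a\<in>set_mset A. subs a) \<le> (\<Sum>a\<in>set_mset A. card (subs a))" by (rule card_UN_le) auto
  also have "\<dots> \<le> (\<Sum>a\<in>set_mset A. tsize a)" using Node by (intro sum_mono) auto
  also have "\<dots> \<le> sum_mset (image_mset tsize A)" by (rule sum_set_mset_le)
  finally have "card (\<Union>a\<in>set_mset A. subs a) \<le> sum_mset (image_mset tsize A)" .
  then show ?case using fin card_insert_le_m1[of "tsize (Node A)" "\<Union>a\<in>set_mset A. subs a" "Node A"]
    by (simp add: tsize.simps)
qed

lemma tsize_subs_le: "s \<in> subs t \<Longrightarrow> tsize s \<le> tsize t"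
proof (induction t)
  case (Node A)
  show ?case
  proof (cases "s = Node A")
    case False
    then obtain a where a: "a \<in># A" "s \<in> subs a" using Node.prems by auto
    then show ?thesis using Node.IH[OF a] tsize_child_less[OF a(1)] by linarith
  qed simp
qed

text \<open>At the top each half must differ from all descendants of the other; inside the halves
  only siblings are compared, which is why this last gluing is treated separately.\<close>

definition top_trees :: "nat \<Rightarrow> utree set" where
  "top_trees n = {Node {#s, t#} | s t. s \<in> good_trees n \<and> t \<in> good_trees n \<and>
     (\<forall>r\<in>subs t. \<not> usim D L s r) \<and> (\<forall>r\<in>subs s. \<not> usim D L t r)}"

text \<open>Counting from each descendant \<open>r\<close> of \<open>t\<close> towards
  \<open>s\<close> keeps the given tree no larger than \<open>n\<close>, as the bound on similar
  trees requires.\<close>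

lemma card_sub_similar:
  assumes "tsize t = n"
  shows "real (card {s \<in> utrees n. \<exists>r\<in>subs t. usim D L s r}) \<le> n * exp (\<delta> * n)"
proof -
  have "real (card {s \<in> utrees n. \<exists>r\<in>subs t. usim D L s r}) \<le> real (card (subs t)) * exp (\<delta> * n)"
  proof (rule card_le_card_mult[where A = "\<lambda>r. {s \<in> utrees n. usim D L r s}"])
    show "real (card {s \<in> utrees n. usim D L r s}) \<le> exp (\<delta> * n)" if "r \<in> subs t" for r
      using tsize_subs_le[OF that] assms by (intro card_usim) simp
    show "{s \<in> utrees n. \<exists>r\<in>subs t. usim D L s r} \<subseteq> (\<Union>r\<in>subs t. {s \<in> utrees n. usim D L r s})"
      using usim_sym by blast
    show "finite {s \<in> utrees n. usim D L r s}" for r by (rule finite_subset[OF _ finite_utrees[of n]]) auto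
  qed (use card_subs_le in blast)
  also have "\<dots> \<le> n * exp (\<delta> * n)"
    using card_subs_le[of t] assms by (intro mult_right_mono) auto
  finally show ?thesis .
qed

text \<open>Each of the two directions excludes at most a quarter of the ordered pairs, so half of
  them remain; dropping the order leaves a quarter, the same loss as in an ordinary gluing.\<close>

lemma card_top_trees:
  assumes n: "S \<le> n"
  shows "4 \<le> card (top_trees n) * y ^ (2 * n + 2)"
proof -
  let ?G = "good_trees n" and ?g = "real (card (good_trees n))"
  let ?Q = "\<lambda>t. {s \<in> utrees n. \<exists>r\<in>subs t. usim D L s r}"
  define B where "B = (SIGMA t:?G. ?Q t \<inter> ?G)"
  define P where "P = ?G \<times> ?G - (B \<union> prod.swap ` B)"
  have finB: "finite B" unfolding B_def by auto
  have g4: "4 \<le> ?g * y ^ (n + 1)" by (rule card_good_trees_growth[OF n])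
  have "real (card B) \<le> (\<Sum>t\<in>?G. ?g / 4)"
  proof -
    have "real (card B) = (\<Sum>t\<in>?G. real (card (?Q t \<inter> ?G)))" unfolding B_def by (simp add: card_SigmaI)
    also have "\<dots> \<le> (\<Sum>t\<in>?G. ?g / 4)"
    proof (rule sum_mono)
      fix t assume t: "t \<in> ?G"
      have "finite (?Q t)" by (rule finite_subset[OF _ finite_utrees[of n]]) auto
      then have "real (card (?Q t \<inter> ?G)) \<le> real (card (?Q t))" by (intro of_nat_mono card_mono) auto
      also have "\<dots> \<le> n * exp (\<delta> * n)" using t by (intro card_sub_similar) (auto simp: good_trees_def)
      also have "\<dots> \<le> ?g / 4" using good_dominates(1)[OF g4] by simp
      finally show "real (card (?Q t \<inter> ?G)) \<le> ?g / 4" .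
    qed
    finally show ?thesis .
  qed
  then have B: "real (card B) \<le> ?g * ?g / 4" by simp
  have "card (B \<union> prod.swap ` B) \<le> card B + card (prod.swap ` B)" by (rule card_Un_le)
  also have "\<dots> \<le> card B + card B" using card_image_le[OF finB] by simp
  finally have "real (card (B \<union> prod.swap ` B)) \<le> ?g * ?g / 2" using B by linarith
  moreover have "card (?G \<times> ?G) - card (B \<union> prod.swap ` B) \<le> card P"
    unfolding P_def using finB by (intro diff_card_le_card_Diff) auto
  moreover have "real (card (?G \<times> ?G)) = ?g * ?g" by (simp add: card_cartesian_product)
  ultimately have P: "?g * ?g / 2 \<le> card P" by linarith
  have sub: "(\<lambda>(s, t). Node {#s, t#}) ` P \<subseteq> top_trees n"
  proof
    fix u assume "u \<in> (\<lambda>(s, t). Node {#s, t#}) ` P"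
    then obtain s t where st: "u = Node {#s, t#}" "(s, t) \<in> P" by auto
    then have G: "s \<in> ?G" "t \<in> ?G" "(s, t) \<notin> B" "(t, s) \<notin> B" by (auto simp: P_def image_iff)
    then have "\<not> usim D L t r" if "r \<in> subs s" for r using that by (auto simp: B_def good_trees_def)
    moreover have "\<not> usim D L s r" if "r \<in> subs t" for r using that G by (auto simp: B_def good_trees_def)
    ultimately show "u \<in> top_trees n" using st(1) G by (auto simp: top_trees_def)
  qed
  have "top_trees n \<subseteq> (\<lambda>(s, t). Node {#s, t#}) ` (?G \<times> ?G)" by (auto simp: top_trees_def)
  then have "finite (top_trees n)" by (rule finite_subset) auto
  then have "card ((\<lambda>(s, t). Node {#s, t#}) ` P) \<le> card (top_trees n)" using sub by (intro card_mono)
  moreover have "real (card P) / 2 \<le> card ((\<lambda>(s, t). Node {#s, t#}) ` P)"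
    by (intro card_join_image) (simp add: P_def)
  ultimately have *: "?g * ?g / 4 \<le> card (top_trees n)" using P by linarith
  have yy: "y ^ (n + 1) * y ^ (n + 1) = y ^ (2 * n + 2)" by (simp add: mult_2 flip: power_add)
  have "4 * 4 \<le> (?g * y ^ (n + 1)) * (?g * y ^ (n + 1))" using g4 by (intro mult_mono) auto
  also have "\<dots> = (?g * ?g) * y ^ (2 * n + 2)" unfolding yy[symmetric] by (simp only: mult_ac)
  finally have "4 \<le> (?g * ?g / 4) * y ^ (2 * n + 2)" by simp
  also have "\<dots> \<le> card (top_trees n) * y ^ (2 * n + 2)"
    using * y_bounds by (intro mult_right_mono) auto
  finally show ?thesis .
qed

lemma card_rooted_family:
  assumes \<iota>: "L = ln (inverse \<iota>)" and n: "S \<le> n" and N: "N = 2 * n + 1"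
  shows "x powr (- real N) * exp (- 10 * exp (- (1 / 10) * L\<^sup>2) * real N) \<le> card (rooted_family \<iota> N)"
proof -
  have L1: "1 \<le> L" using L_ge c_ge by linarith
  have nK: "L\<^sup>2 \<le> real n" using S_bounds n unfolding K_def by linarith
  have "card (top_trees n) \<le> card (rooted_family \<iota> N)"
  proof (rule card_rooted_family_ge)
    show "top_trees n \<subseteq> utrees N" by (auto simp: top_trees_def good_trees_def tsize.simps N)
    fix u and T :: "nat rooted" assume u: "u \<in> top_trees n" and T: "shape T u"
    then obtain s t where st: "u = Node {#s, t#}" "s \<in> good_trees n" "t \<in> good_trees n"
      "\<forall>r\<in>subs t. \<not> usim D L s r" "\<forall>r\<in>subs s. \<not> usim D L t r" by (auto simp: top_trees_def)
    have "\<not> usim D L s t" using st(4) self_subs by blast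
    then have "good L u" unfolding st(1) using st(2,3) by (intro good_join) (auto simp: good_trees_def)
    then show "admissible_tree \<iota> N T"
      unfolding N using st T nK unfolding D_def
      by (intro admissible_tree_shape[OF \<iota> L1, of T s t]) (auto simp: good_trees_def)
  qed
  then have 1: "real (card (top_trees n)) \<le> card (rooted_family \<iota> N)" by simp
  have "4 \<le> card (top_trees n) * y ^ (N + 1)" using card_top_trees[OF n] N by simp
  also have "\<dots> \<le> card (rooted_family \<iota> N) * y ^ (N + 1)"
    using 1 y_bounds by (intro mult_right_mono) auto
  also have "y ^ (N + 1) \<le> x ^ N * exp (2 * \<eta> * N)"
  proof -
    have "y ^ (N + 1) = x * (x ^ N * exp \<eta> ^ (N + 1))" by (simp add: y_def power_mult_distrib mult_ac)
    also have "\<dots> \<le> 1 * (x ^ N * exp \<eta> ^ (N + 1))" using x by (intro mult_right_mono) auto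
    also have "exp \<eta> ^ (N + 1) = exp (real (N + 1) * \<eta>)" by (rule exp_of_nat_mult[symmetric])
    \<comment> \<open>The surplus exponent is absorbed by doubling \<eta>, and 2 \<eta> = 10
      exp(-K/10) is the rate of the claim.\<close>
    also have "real (N + 1) * \<eta> \<le> (2 * real N) * \<eta>"
      using N \<eta>_bounds by (intro mult_right_mono) auto
    finally show ?thesis using x by (simp add: mult_ac)
  qed
  finally have "4 \<le> card (rooted_family \<iota> N) * (x ^ N * exp (2 * \<eta> * N))"
    by (simp add: mult_left_mono)
  then have "1 / (x ^ N * exp (2 * \<eta> * N)) \<le> card (rooted_family \<iota> N)"
    using x by (simp add: field_simps)
  moreover have "x powr (- real N) * exp (- 10 * exp (- (1 / 10) * L\<^sup>2) * real N) = 1 / (x ^ N * exp (2 * \<eta> * N))"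
    using x by (simp add: powr_minus powr_realpow exp_minus \<eta>_def K_def field_simps)
  ultimately show ?thesis by simp
qed

end

section \<open>Growth rate of the families\<close>

text \<open>Both bounds come from the upper estimate and the doubling of the number of trees.
  \<open>real_of_ereal\<close> sends an infinite radius to 0, so excluding 0 excludes that case
  too.\<close>

lemma otter_const_bounds:
  assumes M: "2 \<le> M" and up: "\<And>k. M \<le> k \<Longrightarrow>
    real (card (unlabeled_rooted_trees k)) \<le> otter_const powr (- real k) / real k powr (3 / 2)"
  shows "0 < otter_const" "otter_const \<le> 1 / 2"
proof -
  let ?x = otter_const
  have low: "(2 :: real) ^ (k - 2) \<le> ?x powr (- real k)" if k: "M \<le> k" for k
  proof -
    have "2 ^ (k - 2) \<le> card (unlabeled_rooted_trees k)"
      using card_utrees_ge_pow[of k] M k unfolding card_unlabeled_rooted_trees by linarith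
    then have "(2 :: real) ^ (k - 2) \<le> real (card (unlabeled_rooted_trees k))"
      by (metis of_nat_le_iff of_nat_numeral of_nat_power)
    also have "\<dots> \<le> ?x powr (- real k) / real k powr (3 / 2)" by (rule up[OF k])
    also have "\<dots> \<le> ?x powr (- real k) / 1"
      using M k by (intro divide_left_mono ge_one_powr_ge_zero) auto
    finally show ?thesis by simp
  qed
  have "0 \<le> ?x" unfolding otter_const_def by (intro real_of_ereal_pos conv_radius_nonneg)
  moreover have "?x \<noteq> 0"
  proof
    assume "?x = 0"
    \<comment> \<open>A power of 0 is 0 under \<open>powr\<close>, so the upper estimate would leave
      no tree of size \<open>M\<close>.\<close>
    then have "(2 :: real) ^ (M - 2) \<le> 0" using low[of M] by simp
    moreover have "(0 :: real) < 2 ^ (M - 2)" by simp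
    ultimately show False by linarith
  qed
  ultimately show x: "0 < ?x" by simp
  show "?x \<le> 1 / 2"
  proof (rule ccontr)
    assume "\<not> ?x \<le> 1 / 2"
    then have gt: "1 < 2 * ?x" by simp
    \<comment> \<open>Once (2x)^k exceeds 4, the lower bound 2^(k-2) on the number of trees exceeds
      its upper bound x^(-k).\<close>
    obtain n where n: "4 < (2 * ?x) ^ n" using real_arch_pow[OF gt] by blast
    define k where "k = max n M"
    have k: "M \<le> k" "n \<le> k" by (auto simp: k_def)
    have "4 * 2 ^ (k - 2) = (2 :: real) ^ (2 + (k - 2))" by (simp add: power_add)
    also have "2 + (k - 2) = k" using k M by simp
    finally have "(2 * ?x) ^ k = 4 * 2 ^ (k - 2) * ?x ^ k" by (simp add: power_mult_distrib)
    also have "\<dots> \<le> 4 * ?x powr (- real k) * ?x ^ k"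
      using low[OF k(1)] x by (intro mult_right_mono mult_left_mono) auto
    also have "\<dots> = 4" using x by (simp add: powr_minus powr_realpow)
    also have "\<dots> < (2 * ?x) ^ n" by (rule n)
    also have "\<dots> \<le> (2 * ?x) ^ k" using gt k by (intro power_increasing) auto
    finally show False by simp
  qed
qed

text \<open>The iterated logarithm in the choice of \<iota> amounts to ln L > exp(exp M); this shows
  that such a bound swallows the crude constants attached to \<open>M\<close>.\<close>

lemma power_le_exp_exp:
  assumes "100 \<le> M"
  shows "200 * (real M)\<^sup>2 * real (M ^ M) \<le> exp (exp (real M))"
proof -
  have M: "100 \<le> real M" using assms by simp
  have "200 \<le> (real M)\<^sup>2" using power_mono[OF M, of 2] by simp
  then have "200 * (real M)\<^sup>2 * real (M ^ M) \<le> (real M)\<^sup>2 * (real M)\<^sup>2 * real (M ^ M)"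
    by (intro mult_right_mono) auto
  also have "\<dots> = real M ^ (M + 4)" by (simp add: power_add eval_nat_numeral)
  also have "real M ^ (M + 4) = exp (ln (real M)) ^ (M + 4)" using M by simp
  also have "\<dots> = exp (real (M + 4) * ln (real M))" by (rule exp_of_nat_mult[symmetric])
  also have "real (M + 4) * ln (real M) \<le> (2 * real M) * real M"
    using M ln_le_minus_one[of "real M"] by (intro mult_mono) auto
  also have "\<dots> \<le> (real M * real M) * (real M / 27)"
    using M mult_left_mono[of 2 "real M / 27" "real M * real M"] by simp
  also have "\<dots> = (real M / real 3) ^ 3" by (simp add: power3_eq_cube)
  also have "\<dots> \<le> exp (real M)" by (intro exp_ge_power) auto
  finally show ?thesis by simp
qed

text \<open>The estimates start at size \<open>M\<close>; smaller sizes are controlled by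
  monotonicity and the factorial bound on the number of trees of size \<open>M\<close>.\<close>

lemma otter_locale:
  assumes M: "100 \<le> M"
    and r: "\<And>k. M \<le> k \<Longrightarrow>
      otter_const powr (- real k) / (200 * real k powr (3/2)) \<le> real (card (unlabeled_rooted_trees k)) \<and>
      real (card (unlabeled_rooted_trees k)) \<le> otter_const powr (- real k) / real k powr (3/2)"
    and L: "exp (exp (real M)) \<le> ln L" "0 < L"
  shows "otter otter_const L M"
proof
  let ?x = otter_const
  have up: "real (card (unlabeled_rooted_trees k)) \<le> ?x powr (- real k) / real k powr (3 / 2)" if "M \<le> k" for k
    using r[OF that] by simp
  have M2: "2 \<le> M" using M by simp
  show x: "0 < ?x" "?x \<le> 1 / 2" using otter_const_bounds[OF M2 up] by auto
  have MM: "200 * (real M)\<^sup>2 * real (M ^ M) \<le> ln L" using power_le_exp_exp[OF M] L(1) by linarith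
  have "real M \<le> exp (real M)" using exp_ge_add_one_self[of "real M"] by linarith
  also have "\<dots> \<le> exp (exp (real M))" using exp_ge_add_one_self[of "exp (real M)"] by linarith
  finally show M_le: "real M \<le> ln L" using L(1) by linarith
  then show lnL: "100 \<le> ln L" using M by linarith
  show "0 < L" by (rule L)
  show w_up: "card (utrees n) * ?x ^ n \<le> real n powr (- 3 / 2)" if "M \<le> n" for n
    using up[OF that] x M that
    by (simp add: card_unlabeled_rooted_trees powr_minus powr_realpow field_simps)
  show "real n powr (- 3 / 2) / 200 \<le> card (utrees n) * ?x ^ n" if "M \<le> n" for n
    using r[OF that] x M that
    by (simp add: card_unlabeled_rooted_trees powr_minus powr_realpow field_simps)
  have fac: "real (card (utrees M)) \<le> real (M ^ M)"
  proof -
    have "card (utrees M) \<le> fact (M - 1)" using card_utrees_le_fact M by simp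
    also have "\<dots> \<le> fact M" by (intro fact_mono) simp
    finally have "real (card (utrees M)) \<le> fact M" by (metis of_nat_fact of_nat_le_iff)
    also have "\<dots> \<le> real (M ^ M)" by (rule fact_le_power)
    finally show ?thesis .
  qed
  have "1 * real (M ^ M) \<le> 200 * (real M)\<^sup>2 * real (M ^ M)"
  proof (rule mult_right_mono)
    have "1\<^sup>2 \<le> (real M)\<^sup>2" using M by (intro power_mono) auto
    then show "1 \<le> 200 * (real M)\<^sup>2" by simp
  qed simp
  then have facL: "real (card (utrees M)) \<le> ln L" using fac MM by linarith
  show "card (utrees n) * ?x ^ n \<le> ln L" for n
  proof (cases "M \<le> n")
    case True
    have "real n powr (- 3 / 2) \<le> real n powr 0" using True M by (intro powr_mono) auto
    then have "real n powr (- 3 / 2) \<le> 1" using True M by simp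
    then show ?thesis using w_up[OF True] lnL by linarith
  next
    case False
    have "card (utrees n) * ?x ^ n \<le> real (card (utrees M)) * 1"
      using card_utrees_mono[of n M] False x by (intro mult_mono power_le_one) auto
    then show ?thesis using facL by simp
  qed
  show "1 / ?x \<le> ln L"
  proof -
    \<comment> \<open>The lower estimate at size \<open>M\<close> bounds x^(-M), and with it 1/x, in
      terms of the number of trees of that size.\<close>
    have "1 / ?x \<le> (1 / ?x) ^ M" using x M by (intro self_le_power) auto
    also have "\<dots> = ?x powr (- real M)" using x by (simp add: powr_minus powr_realpow power_divide field_simps)
    also have "\<dots> \<le> 200 * real M powr (3 / 2) * real (card (utrees M))"
      using r[of M] M by (simp add: card_unlabeled_rooted_trees field_simps)
    also have "\<dots> \<le> 200 * (real M)\<^sup>2 * real (M ^ M)"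
    proof (intro mult_mono fac)
      have "real M powr (3 / 2) \<le> real M powr 2" using M by (intro powr_mono) auto
      then show "real M powr (3 / 2) \<le> (real M)\<^sup>2" using M by (simp add: powr_numeral)
    qed auto
    finally show ?thesis using MM by linarith
  qed
qed

theorem theorem2p7:
  fixes \<epsilon> \<iota> :: real and M :: nat
  assumes "0 < \<epsilon>" and "\<epsilon> < 1"
    and "M \<ge> 100"
    and "\<And>k. k \<ge> M \<Longrightarrow>
      otter_const powr (- real k) / (100 * real k powr (5/2)) \<le> real (card (unlabeled_trees k)) \<and>
      real (card (unlabeled_trees k)) \<le> otter_const powr (- real k) / real k powr (5/2)"
    and "\<And>k. k \<ge> M \<Longrightarrow>
      otter_const powr (- real k) / (200 * real k powr (3/2)) \<le> real (card (unlabeled_rooted_trees k)) \<and>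
      real (card (unlabeled_rooted_trees k)) \<le> otter_const powr (- real k) / real k powr (3/2)"
    and "0 < \<iota>" and "\<iota> < 1"
    (* the iterated logarithm is only applied to positive arguments *)
    and "ln (ln (inverse \<iota>)) > 0" and "ln (ln (ln (inverse \<iota>))) > 0"
    and "ln (ln (ln (ln (inverse \<iota>)))) > Max {real M, 1 / \<epsilon>, 1 / ln (inverse \<epsilon>)}"
  shows "(\<forall>\<^sub>F N :: nat in sequentially. (real N - 1) / 2 \<in> \<nat> \<and> \<iota> * real N \<in> \<nat> \<longrightarrow>
      real (card (rooted_family \<iota> N)) \<ge>
        otter_const powr (- real N) * exp (- 10 * exp (- (1/10) * (ln (inverse \<iota>))^2) * real N)) \<and>
    (\<exists>\<delta> :: nat \<Rightarrow> real. \<delta> \<longlonglongrightarrow> 0 \<and>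
      (\<forall>\<^sub>F N in sequentially. (real N - 1) / 2 \<in> \<nat> \<and> \<iota> * real N \<in> \<nat> \<longrightarrow>
        real (card (unrooted_family \<iota> N)) \<ge>
          (otter_const + \<delta> N) powr (- real N) * exp (- 10 * exp (- (1/10) * (ln (inverse \<iota>))^2) * real N)))"
proof -
  define L where "L = ln (inverse \<iota>)"
  have "1 < inverse \<iota>" using assms(6,7) by (simp add: one_less_inverse)
  then have L0: "0 < L" unfolding L_def by (rule ln_gt_zero)
  have "real M \<le> Max {real M, 1 / \<epsilon>, 1 / ln (inverse \<epsilon>)}" by simp
  then have "real M < ln (ln (ln L))" using assms(10) unfolding L_def by linarith
  then have "exp (real M) < ln (ln L)" using assms(9) unfolding L_def by (metis exp_less_cancel_iff exp_ln)
  then have "exp (exp (real M)) < ln L" using assms(8) unfolding L_def by (metis exp_less_cancel_iff exp_ln)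
  then interpret otter otter_const L M using otter_locale[OF assms(3,5)] L0 by simp
  let ?e = "\<lambda>N. exp (- 10 * exp (- (1/10) * (ln (inverse \<iota>))^2) * real N)"
  have rooted: "otter_const powr (- real N) * ?e N \<le> real (card (rooted_family \<iota> N))"
    if N: "2 * S + 1 \<le> N" "(real N - 1) / 2 \<in> \<nat>" for N
  proof -
    obtain n where "(real N - 1) / 2 = real n" using N(2) by (auto elim: Nats_cases)
    then have "real N = real (2 * n + 1)" by simp
    then have n: "N = 2 * n + 1" by (simp only: of_nat_eq_iff)
    then show ?thesis using card_rooted_family[OF L_def, of n N] N(1) unfolding L_def by simp
  qed
  \<comment> \<open>The factor N lost by forgetting the root is the N-th power of
    \<open>root N (real N)\<close>, which tends to 1 and can be moved into the base.\<close>
  define \<delta> where "\<delta> N = otter_const * (root N (real N) - 1)" for N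
  have "(\<lambda>N. otter_const * (root N (real N) - 1)) \<longlonglongrightarrow> otter_const * (1 - 1)"
    by (intro tendsto_intros LIMSEQ_root)
  then have lim: "\<delta> \<longlonglongrightarrow> 0" unfolding \<delta>_def by simp
  have unrooted: "(otter_const + \<delta> N) powr (- real N) * ?e N \<le> real (card (unrooted_family \<iota> N))"
    if N: "2 * S + 1 \<le> N" "(real N - 1) / 2 \<in> \<nat>" for N
  proof -
    have N0: "0 < N" using N by simp
    have r: "0 < root N (real N)" "root N (real N) ^ N = real N" using N0 by (auto simp: real_root_pow_pos2)
    have "(otter_const + \<delta> N) powr (- real N) = (otter_const * root N (real N)) powr (- real N)"
      by (simp add: \<delta>_def algebra_simps)
    also have "\<dots> = otter_const powr (- real N) * root N (real N) powr (- real N)"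
      using x r by (simp add: powr_mult)
    also have "root N (real N) powr (- real N) = 1 / real N"
      using r by (simp add: powr_minus powr_realpow inverse_eq_divide)
    finally have "(otter_const + \<delta> N) powr (- real N) * ?e N = otter_const powr (- real N) * ?e N / real N" by simp
    also have "\<dots> \<le> real (card (rooted_family \<iota> N)) / real N"
      by (intro divide_right_mono rooted N) simp
    also have "\<dots> \<le> real (N * card (unrooted_family \<iota> N)) / real N"
      by (intro divide_right_mono of_nat_mono card_rooted_family_le) simp
    also have "\<dots> = real (card (unrooted_family \<iota> N))" using N0 by simp
    finally show ?thesis .
  qed
  show ?thesis
  proof (intro conjI exI[of _ \<delta>] lim)
    show "\<forall>\<^sub>F N in sequentially. (real N - 1) / 2 \<in> \<nat> \<and> \<iota> * real N \<in> \<nat> \<longrightarrow>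
        otter_const powr (- real N) * ?e N \<le> real (card (rooted_family \<iota> N))"
      by (rule eventually_mono[OF eventually_ge_at_top[of "2 * S + 1"]]) (use rooted in blast)
    show "\<forall>\<^sub>F N in sequentially. (real N - 1) / 2 \<in> \<nat> \<and> \<iota> * real N \<in> \<nat> \<longrightarrow>
        (otter_const + \<delta> N) powr (- real N) * ?e N \<le> real (card (unrooted_family \<iota> N))"
      by (rule eventually_mono[OF eventually_ge_at_top[of "2 * S + 1"]]) (use unrooted in blast)
  qed
qed

end
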